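(* Let $K$ be a locally compact hypergroup with a left Haar measure and let $\sigma\in M(K)$ with $\|\sigma\|=1$. Then there is a contractive linear projection $P_\sigma: M(K)\to M(K)$ with $P_\sigma(M(K))=H_\sigma(K)$.
   Context: $K$ is a locally compact hypergroup (Jewett/Bloom–Heyer sense), assumed to have a left Haar measure, with measure algebra $(M(K),* )$. For $\sigma\in M(K)$, a measure $\mu\in M(K)$ is $\sigma$-harmonic if $\sigma*\mu=\mu$, and $H_\sigma(K)$ is the set of all $\sigma$-harmonic measures. *)

theory Defs
  imports "HOL-Probability.Probability"
begin

definition msupp :: "'a::topological_space measure \<Rightarrow> 'a set" where
  "msupp M = {x. \<forall>U. open U \<and> x \<in> U \<longrightarrow> emeasure M U > 0}"

definition radon_pos :: "'a::topological_space measure \<Rightarrow> bool" where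
  "radon_pos M \<longleftrightarrow> sets M = sets borel \<and>
     (\<forall>C. compact C \<longrightarrow> emeasure M C < \<infinity>) \<and>
     (\<forall>A\<in>sets borel. emeasure M A = (INF U\<in>{U. open U \<and> A \<subseteq> U}. emeasure M U)) \<and>
     (\<forall>U. open U \<longrightarrow> emeasure M U = (SUP C\<in>{C. compact C \<and> C \<subseteq> U}. emeasure M C))"

definition Cc :: "('a::topological_space \<Rightarrow> real) set" where
  "Cc = {f. continuous_on UNIV f \<and> compact (closure {x. f x \<noteq> 0})}"

definition complex_measure :: "('a::topological_space set \<Rightarrow> complex) \<Rightarrow> bool" where
  "complex_measure \<mu> \<longleftrightarrow> \<mu> {} = 0 \<and> (\<forall>A. A \<notin> sets borel \<longrightarrow> \<mu> A = 0) \<and>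
     (\<forall>F::nat \<Rightarrow> 'a set. range F \<subseteq> sets borel \<longrightarrow> disjoint_family F \<longrightarrow>
        (\<lambda>n. \<mu> (F n)) sums \<mu> (\<Union>n. F n))"

definition tvar :: "('a::topological_space set \<Rightarrow> complex) \<Rightarrow> 'a set \<Rightarrow> ennreal" where
  "tvar \<mu> A = (SUP P\<in>{P. finite P \<and> disjoint P \<and> P \<subseteq> sets borel \<and> \<Union>P \<subseteq> A}.
                 \<Sum>B\<in>P. ennreal (norm (\<mu> B)))"

definition mnorm :: "('a::topological_space set \<Rightarrow> complex) \<Rightarrow> ennreal" where
  "mnorm \<mu> = tvar \<mu> UNIV"

definition MK :: "('a::topological_space set \<Rightarrow> complex) set" where
  "MK = {\<mu>. complex_measure \<mu> \<and>
            (\<forall>A\<in>sets borel. tvar \<mu> A = (SUP C\<in>{C. compact C \<and> C \<subseteq> A}. tvar \<mu> C))}"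

definition pospart :: "('a::topological_space set \<Rightarrow> real) \<Rightarrow> 'a measure" where
  "pospart r = measure_of UNIV (sets borel)
      (\<lambda>A. SUP B\<in>{B\<in>sets borel. B \<subseteq> A}. ennreal (r B))"

definition cint :: "('a::topological_space set \<Rightarrow> complex) \<Rightarrow> ('a \<Rightarrow> complex) \<Rightarrow> complex" where
  "cint \<mu> f =
     ((integral\<^sup>L (pospart (\<lambda>A. Re (\<mu> A))) f) - (integral\<^sup>L (pospart (\<lambda>A. - Re (\<mu> A))) f)) +
     \<i> * ((integral\<^sup>L (pospart (\<lambda>A. Im (\<mu> A))) f) - (integral\<^sup>L (pospart (\<lambda>A. - Im (\<mu> A))) f))"

text \<open>A hypergroup structure on the locally compact Hausdorff space \<open>'a\<close> is given by
  \<open>conv x y = \<delta>\<^sub>x * \<delta>\<^sub>y\<close>, an involution \<open>iv\<close> and an identity \<open>e\<close>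
  (Jewett / Bloom--Heyer axioms).  The convolution on \<open>M(K)\<close> is the
  (unique) bilinear weakly continuous extension, given by the formula in \<open>mconv\<close>.\<close>
definition hypergroup :: "('a::t2_space \<Rightarrow> 'a \<Rightarrow> 'a measure) \<Rightarrow> ('a \<Rightarrow> 'a) \<Rightarrow> 'a \<Rightarrow> bool" where
  "hypergroup conv iv e \<longleftrightarrow>
     locally_compact_space (euclidean :: 'a topology) \<and>
     \<comment> \<open>\<delta>x * \<delta>y is a probability Radon measure with compact support\<close>
     (\<forall>x y. prob_space (conv x y) \<and> radon_pos (conv x y) \<and> compact (msupp (conv x y))) \<and>
     \<comment> \<open>associativity: (\<delta>x * \<delta>y) * \<delta>z = \<delta>x * (\<delta>y * \<delta>z)\<close>
     (\<forall>x y z. \<forall>A\<in>sets borel.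
        (\<integral>u. measure (conv u z) A \<partial>conv x y) = (\<integral>v. measure (conv x v) A \<partial>conv y z)) \<and>
     \<comment> \<open>(x,y) \<mapsto> \<delta>x * \<delta>y is continuous into M(K) with the cone (vague) topology\<close>
     (\<forall>f\<in>Cc. continuous_on UNIV (\<lambda>(x,y). \<integral>t. f t \<partial>conv x y)) \<and>
     \<comment> \<open>(x,y) \<mapsto> supp(\<delta>x * \<delta>y) is continuous for the Michael topology\<close>
     (\<forall>U. open U \<longrightarrow> open {(x,y). msupp (conv x y) \<inter> U \<noteq> {}} \<and>
                      open {(x,y). msupp (conv x y) \<subseteq> U}) \<and>
     \<comment> \<open>identity\<close>
     (\<forall>x. conv e x = return borel x \<and> conv x e = return borel x) \<and>
     \<comment> \<open>involution\<close>
     continuous_on UNIV iv \<and> (\<forall>x. iv (iv x) = x) \<and>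
     (\<forall>x y. conv (iv y) (iv x) = distr (conv x y) borel iv) \<and>
     (\<forall>x y. e \<in> msupp (conv x y) \<longleftrightarrow> y = iv x)"

definition left_haar :: "('a::t2_space \<Rightarrow> 'a \<Rightarrow> 'a measure) \<Rightarrow> 'a measure \<Rightarrow> bool" where
  "left_haar conv \<omega> \<longleftrightarrow> radon_pos \<omega> \<and> emeasure \<omega> UNIV \<noteq> 0 \<and>
     (\<forall>f\<in>Cc. \<forall>x. (\<integral>y. (\<integral>t. f t \<partial>conv x y) \<partial>\<omega>) = (\<integral>y. f y \<partial>\<omega>))"

definition mconv :: "('a::t2_space \<Rightarrow> 'a \<Rightarrow> 'a measure) \<Rightarrow>
    ('a set \<Rightarrow> complex) \<Rightarrow> ('a set \<Rightarrow> complex) \<Rightarrow> ('a set \<Rightarrow> complex)" where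
  "mconv conv \<mu> \<nu> = (\<lambda>A. cint \<mu> (\<lambda>x. cint \<nu> (\<lambda>y. complex_of_real (measure (conv x y) A))))"

definition harmonic :: "('a::t2_space \<Rightarrow> 'a \<Rightarrow> 'a measure) \<Rightarrow>
    ('a set \<Rightarrow> complex) \<Rightarrow> ('a set \<Rightarrow> complex) set" where
  "harmonic conv \<sigma> = {\<mu>\<in>MK. mconv conv \<sigma> \<mu> = \<mu>}"

end

theory Submission
  imports Defs
begin

text \<open>
  The operator \<open>T \<mu> = \<sigma> * \<mu>\<close> is a contraction of \<open>M(K)\<close>, and \<open>P \<mu>\<close> is the weak limit of the Cesaro
  averages of \<open>T\<^sup>n \<mu>\<close> along an ultrafilter. Weak limits of bounded sequences exist because the setwise
  ultralimit of positive measures, although only finitely additive, can be regularised to a Radon measure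
  with the same integrals of compactly supported functions. The operator \<open>T\<close> is weakly continuous on
  bounded sets since \<open>z \<in> supp (x * y)\<close> forces \<open>y \<in> supp (x\<^sup>- * z)\<close>, so that \<open>y \<mapsto> f(x * y)\<close> has compact
  support, locally uniformly in \<open>x\<close>; hence \<open>T P = P\<close>. As \<open>K\<close> need not be second countable, the
  measurability of \<open>x \<mapsto> \<integral> (x * y)(A) d\<nu>(y)\<close> and the regularity of \<open>\<sigma> * \<nu>\<close> rest on lower semicontinuity
  and on the additivity of Radon measures over directed families.
\<close>

section \<open>Ultrafilters\<close>

text \<open>A limit tested on compactly supported functions may lose mass at infinity. This does no
  harm: the dual of \<open>T\<close> sends such a function to a uniform limit of finite combinations
  of such functions, so fixed points can be recognised without the lost mass. The ultrafilter is
  fixed before any \<open>\<mu>\<close> is chosen. It yields a limit for every \<open>\<mu>\<close>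
  at once, and one that is linear in \<open>\<mu>\<close>; a convergent subsequence would depend on
  \<open>\<mu>\<close>. The limit is the weak-star limit in the dual of the continuous functions
  vanishing at infinity, but it is built directly from set functions. Contractivity is lower
  semicontinuity of the norm, so the total variation must be recovered with the exact constant 1
  from finite weighted sums of test functions with disjoint supports. A recurrent obstacle is that
  integration is defined through the positive and negative parts of the real and imaginary part,
  while the parts of a sum, a limit or a convolution are not the sums, limits or convolutions of the
  parts. Different decompositions of one measure are compared through layer sums, which see only its
  values on level sets.\<close>

lemma ultrafilter_below:
  fixes F :: "'b filter"
  assumes "F \<noteq> bot"
  obtains G where "G \<le> F" "G \<noteq> bot" "\<And>P. eventually P G \<or> eventually (\<lambda>x. \<not> P x) G"
proof -
  let ?A = "{G. G \<le> F \<and> G \<noteq> bot}"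
  \<comment> \<open>Zorn is applied to the reversed order, so the maximal element is a minimal
    proper filter.\<close>
  have "\<exists>m\<in>?A. \<forall>a\<in>?A. m \<ge> a \<longrightarrow> a = m"
  proof (rule predicate_Zorn)
    show "partial_order_on ?A (relation_of (\<ge>) ?A)"
      by (auto simp: partial_order_on_def preorder_on_def refl_on_def trans_def antisym_def relation_of_def)
    fix C assume C: "C \<in> Chains (relation_of (\<ge>) ?A)"
    then have lin: "a \<le> b \<or> b \<le> a" if "a \<in> C" "b \<in> C" for a b
      using that by (auto simp: Chains_def relation_of_def)
    have sub: "C \<subseteq> ?A"
      using C by (auto simp: Chains_def relation_of_def)
    show "\<exists>u\<in>?A. \<forall>a\<in>C. a \<ge> u"
    proof (cases "C = {}")
      case True
      then show ?thesis using assms by auto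
    next
      case False
      \<comment> \<open>On a chain, what holds eventually along the infimum already does so along
        one member; hence the infimum of proper filters is proper.\<close>
      have "\<not> eventually (\<lambda>x. False) (Inf C)"
      proof (subst eventually_Inf_base[OF False])
        show "\<exists>x\<in>C. x \<le> inf a b" if "a \<in> C" "b \<in> C" for a b
          using lin[OF that] that by (auto intro: bexI[of _ a] bexI[of _ b])
        show "\<not> (\<exists>b\<in>C. eventually (\<lambda>x. False) b)"
          using sub by (auto simp: trivial_limit_def)
      qed
      moreover have "Inf C \<le> F"
        using False sub by (auto intro: Inf_lower2)
      ultimately show ?thesis
        by (intro bexI[of _ "Inf C"]) (auto simp: trivial_limit_def intro: Inf_lower)
    qed
  qed
  then obtain G where G: "G \<le> F" "G \<noteq> bot" "\<And>a. a \<le> F \<Longrightarrow> a \<noteq> bot \<Longrightarrow> a \<le> G \<Longrightarrow> a = G"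
    by auto
  \<comment> \<open>Adding \<open>P\<close> to the minimal \<open>G\<close> either destroys
    properness, which means that \<open>P\<close> fails eventually, or gives \<open>G\<close>
    back.\<close>
  have "eventually P G \<or> eventually (\<lambda>x. \<not> P x) G" for P
  proof (cases "inf G (principal {x. P x}) = bot")
    case True
    then have "eventually (\<lambda>x. False) (inf G (principal {x. P x}))" by simp
    then show ?thesis by (simp add: eventually_inf_principal)
  next
    case False
    then have "inf G (principal {x. P x}) = G"
      by (intro G(3)) (auto intro: le_infI1 G(1))
    moreover have "eventually P (inf G (principal {x. P x}))"
      by (simp add: eventually_inf_principal)
    ultimately show ?thesis by simp
  qed
  with G show ?thesis using that by blast
qed

text \<open>Compactness of the closed ball gives a cluster point, and an ultrafilter converges to
  each of its cluster points.\<close>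

lemma ultrafilter_tendsto_bounded:
  fixes s :: "'b \<Rightarrow> 'c::{real_normed_vector,heine_borel}"
  assumes G: "G \<noteq> bot" "\<And>P. eventually P G \<or> eventually (\<lambda>x. \<not> P x) G"
    and bound: "\<And>n. norm (s n) \<le> c"
  obtains l where "(s \<longlongrightarrow> l) G"
proof -
  have "\<exists>x\<in>cball 0 c. inf (nhds x) (filtermap s G) \<noteq> bot"
    using compact_cball[of "0::'c" c] G(1) bound unfolding compact_filter
    by (auto simp: filtermap_bot_iff eventually_filtermap)
  then obtain l where l: "inf (nhds l) (filtermap s G) \<noteq> bot" by blast
  have "eventually (\<lambda>n. s n \<in> S) G" if S: "open S" "l \<in> S" for S
  proof (rule ccontr)
    assume "\<not> ?thesis"
    with G(2)[of "\<lambda>n. s n \<in> S"] have "eventually (\<lambda>n. s n \<notin> S) G" by blast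
    then have "eventually (\<lambda>y. y \<notin> S) (filtermap s G)" by (simp add: eventually_filtermap)
    moreover have "eventually (\<lambda>y. y \<in> S) (nhds l)" using S by (rule eventually_nhds_in_open)
    ultimately have "eventually (\<lambda>y. False) (inf (nhds l) (filtermap s G))"
      unfolding eventually_inf by blast
    with l show False by (simp add: trivial_limit_def)
  qed
  then show ?thesis using that by (auto simp: tendsto_def)
qed

section \<open>Finite Radon measures\<close>

text \<open>As the measure is finite, a small remainder \<open>A - C\<close> expresses inner
  regularity in real numbers; approximation from outside follows by complements.\<close>

definition radon_finite :: "'a::t2_space measure \<Rightarrow> bool" where
  "radon_finite M \<longleftrightarrow> finite_measure M \<and> sets M = sets borel \<and>
     (\<forall>A\<in>sets borel. \<forall>\<epsilon>>0. \<exists>C. compact C \<and> C \<subseteq> A \<and> measure M (A - C) < \<epsilon>)"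

lemma compact_borel [measurable]: "compact (C::'a::t2_space set) \<Longrightarrow> C \<in> sets borel"
  by (intro borel_closed compact_imp_closed)

lemma radon_finite_space: "radon_finite M \<Longrightarrow> space M = UNIV"
  using sets_eq_imp_space_eq[of M borel] by (auto simp: radon_finite_def)

text \<open>Being squeezed between a compact and an open set of small difference is stable under
  complements and countable unions, so it spreads from the open sets to all Borel sets.\<close>

lemma radon_finiteI_open:
  fixes M :: "'a::t2_space measure"
  assumes fin: "finite_measure M" and sets: "sets M = sets borel"
    and op: "\<And>U \<epsilon>. open U \<Longrightarrow> 0 < \<epsilon> \<Longrightarrow> \<exists>C. compact C \<and> C \<subseteq> U \<and> measure M (U - C) < \<epsilon>"
  shows "radon_finite M"
proof -
  interpret finite_measure M by fact
  note [measurable_cong, simp] = sets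
  have [simp]: "space M = UNIV" using sets_eq_imp_space_eq[OF sets] by simp
  have mono: "measure M A \<le> measure M B" if "A \<subseteq> B" "B \<in> sets borel" for A B
    using that by (intro finite_measure_mono) auto
  define Q where "Q A \<longleftrightarrow> A \<in> sets borel \<and>
    (\<forall>\<epsilon>>0. \<exists>C U. compact C \<and> C \<subseteq> A \<and> A \<subseteq> U \<and> open U \<and> measure M (U - C) < \<epsilon>)" for A
  have "Q A" if "A \<in> sigma_sets UNIV {S. open S}" for A
    using that
  proof (induction rule: sigma_sets.induct)
    case (Basic a)
    then have "open a" by simp
    show ?case unfolding Q_def
    proof (intro conjI allI impI)
      fix \<epsilon> :: real assume "0 < \<epsilon>"
      then show "\<exists>C U. compact C \<and> C \<subseteq> a \<and> a \<subseteq> U \<and> open U \<and> measure M (U - C) < \<epsilon>"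
        using op[OF \<open>open a\<close>] \<open>open a\<close> by (metis order_refl)
    qed (use \<open>open a\<close> in auto)
  next
    case Empty
    show ?case unfolding Q_def by (auto intro!: exI[of _ "{}"])
  next
    case (Compl A)
    show ?case unfolding Q_def
    proof (intro conjI allI impI)
      show "UNIV - A \<in> sets borel" using Compl by (auto simp: Q_def)
      fix \<epsilon> :: real assume "0 < \<epsilon>"
      then obtain C U where CU: "compact C" "C \<subseteq> A" "A \<subseteq> U" "open U" "measure M (U - C) < \<epsilon>/2"
        using Compl unfolding Q_def by (meson half_gt_zero)
      \<comment> \<open>The complement of \<open>U\<close> is closed but perhaps not compact;
        intersecting it with a compact \<open>K\<close> that carries almost all the mass repairs
        this.\<close>
      obtain K where K: "compact K" "measure M (UNIV - K) < \<epsilon>/2"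
        using op[of UNIV "\<epsilon>/2"] \<open>0 < \<epsilon>\<close> by auto
      have b: "C \<in> sets borel" "U \<in> sets borel" "K \<in> sets borel"
        using CU K by (auto intro: compact_borel)
      have "measure M ((UNIV - C) - (K - U)) \<le> measure M ((U - C) \<union> (UNIV - K))"
        using b by (intro mono) auto
      also have "\<dots> \<le> measure M (U - C) + measure M (UNIV - K)"
        using b by (intro measure_Un_le) auto
      also have "\<dots> < \<epsilon>" using CU K by simp
      finally have "measure M ((UNIV - C) - (K - U)) < \<epsilon>" .
      moreover have "compact (K - U)" "open (UNIV - C)"
        using CU K by (auto intro: compact_diff compact_imp_closed open_Diff)
      ultimately show "\<exists>C' U'. compact C' \<and> C' \<subseteq> UNIV - A \<and> UNIV - A \<subseteq> U' \<and> open U' \<and> measure M (U' - C') < \<epsilon>"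
        using CU by (intro exI[of _ "K - U"] exI[of _ "UNIV - C"]) auto
    qed
  next
    case (Union A)
    show ?case unfolding Q_def
    proof (intro conjI allI impI)
      show "(\<Union>i. A i) \<in> sets borel" using Union by (auto simp: Q_def)
      fix \<epsilon> :: real assume "0 < \<epsilon>"
      have "\<exists>C U. compact C \<and> C \<subseteq> A i \<and> A i \<subseteq> U \<and> open U \<and> measure M (U - C) < \<epsilon>/2 * (1/2)^Suc i" for i
      proof -
        have "0 < \<epsilon>/2 * (1/2)^Suc i" using \<open>0 < \<epsilon>\<close> by simp
        then show ?thesis using Union(2)[of i] unfolding Q_def by blast
      qed
      then obtain C U where CU: "\<And>i. compact (C i)" "\<And>i. C i \<subseteq> A i" "\<And>i. A i \<subseteq> U i" "\<And>i. open (U i)"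
        "\<And>i. measure M (U i - C i) < \<epsilon>/2 * (1/2)^Suc i"
        by metis
      have b: "C i \<in> sets borel" "U i \<in> sets borel" for i
        using CU by (auto intro: compact_borel)
      \<comment> \<open>Only finitely many of the \<open>C i\<close> have a compact union. The
        remainders \<open>?D N\<close> decrease to a set of measure at most
        \<open>\<epsilon>/2\<close>, so some \<open>N\<close> suffices.\<close>
      let ?D = "\<lambda>N. (\<Union>i. U i) - (\<Union>i<N. C i)"
      have gs: "(\<lambda>i. \<epsilon>/2 * (1/2)^Suc i) sums (\<epsilon>/2 * 1)"
        by (intro sums_mult power_half_series)
      have sm: "summable (\<lambda>i. measure M (U i - C i))"
        using less_imp_le[OF CU(5)]
        by (intro summable_comparison_test[OF _ sums_summable[OF gs]] exI[of _ 0]) simp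
      have "(\<lambda>N. measure M (?D N)) \<longlonglongrightarrow> measure M (\<Inter>N. ?D N)"
        using b by (intro finite_Lim_measure_decseq) (auto simp: decseq_def)
      moreover have "measure M (\<Inter>N. ?D N) \<le> \<epsilon>/2"
      proof -
        have "measure M (\<Inter>N. ?D N) \<le> measure M (\<Union>i. U i - C i)"
          using b by (intro mono) (auto, metis lessI lessThan_iff)
        also have "\<dots> \<le> (\<Sum>i. measure M (U i - C i))"
          using b by (intro finite_measure_subadditive_countably sm) auto
        also have "\<dots> \<le> (\<Sum>i. \<epsilon>/2 * (1/2)^Suc i)"
          by (intro suminf_le sm sums_summable[OF gs] less_imp_le[OF CU(5)])
        also have "\<dots> = \<epsilon>/2" using sums_unique[OF gs] by simp
        finally show ?thesis .
      qed
      ultimately have "eventually (\<lambda>N. measure M (?D N) < \<epsilon>) sequentially"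
        using \<open>0 < \<epsilon>\<close> by (elim order_tendstoD(2)) linarith
      then obtain N where "measure M (?D N) < \<epsilon>"
        by (auto simp: eventually_sequentially)
      moreover have "compact (\<Union>i<N. C i)" using CU by (intro compact_UN) auto
      ultimately show "\<exists>C' U'. compact C' \<and> C' \<subseteq> (\<Union>i. A i) \<and> (\<Union>i. A i) \<subseteq> U' \<and> open U' \<and> measure M (U' - C') < \<epsilon>"
        using CU(2,3,4)
        by (intro exI[of _ "\<Union>i<N. C i"] exI[of _ "\<Union>i. U i"] conjI UN_mono open_UN ballI) auto
    qed
  qed
  then have Q: "Q A" if "A \<in> sets borel" for A
    using that by (simp add: borel_def)
  show ?thesis unfolding radon_finite_def
  proof (intro conjI ballI allI impI fin sets)
    fix A :: "'a set" and \<epsilon> :: real assume "A \<in> sets borel" "0 < \<epsilon>"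
    then have "\<exists>C U. compact C \<and> C \<subseteq> A \<and> A \<subseteq> U \<and> open U \<and> measure M (U - C) < \<epsilon>"
      using Q[of A] unfolding Q_def by simp
    then obtain C U where CU: "compact C" "C \<subseteq> A" "A \<subseteq> U" "open U" "measure M (U - C) < \<epsilon>"
      by (elim exE conjE)
    have "measure M (A - C) \<le> measure M (U - C)"
      using CU by (intro mono) (auto intro: compact_borel)
    with CU show "\<exists>C. compact C \<and> C \<subseteq> A \<and> measure M (A - C) < \<epsilon>"
      by (intro exI[of _ C]) simp
  qed
qed

lemma radon_finite_outer:
  assumes "radon_finite M" "A \<in> sets borel" "0 < \<epsilon>"
  obtains U where "open U" "A \<subseteq> U" "measure M (U - A) < \<epsilon>"
proof -
  obtain C where C: "compact C" "C \<subseteq> - A" "measure M (- A - C) < \<epsilon>"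
    using assms unfolding radon_finite_def by (meson borel_comp)
  have "- A - C = - C - A" by auto
  then show ?thesis using C by (intro that[of "- C"]) (auto simp: compact_imp_closed open_Compl)
qed

section \<open>Layer sums\<close>

text \<open>A staircase of step \<open>1/n\<close> for functions into \<open>[0,1]\<close>. The
  strict inequality keeps the level sets open when \<open>f\<close> is lower semicontinuous.\<close>

definition layer :: "nat \<Rightarrow> ('a \<Rightarrow> real) \<Rightarrow> 'a \<Rightarrow> real" where
  "layer n f x = (\<Sum>k=1..n. indicator {x. real k / real n < f x} x) / real n"

lemma layer_bounds:
  assumes "0 \<le> f x" "f x \<le> 1" "0 < n"
  shows "layer n f x \<le> f x" "f x \<le> layer n f x + 1 / n"
proof -
  \<comment> \<open>The number of \<open>k \<ge> 1\<close> with \<open>k < n * f x\<close>; at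
    \<open>f x = 0\<close> the value \<open>-1\<close> is cut off to \<open>0\<close> by
    \<open>nat\<close>.\<close>
  define m where "m = nat (\<lceil>n * f x\<rceil> - 1)"
  have nf: "0 \<le> n * f x" "n * f x \<le> n" using assms by (auto simp: mult_left_le)
  have "real k / n < f x \<longleftrightarrow> k \<le> m" if "1 \<le> k" for k
  proof -
    have "real k / n < f x \<longleftrightarrow> real k < n * f x" using assms(3) by (simp add: field_simps)
    also have "\<dots> \<longleftrightarrow> int k \<le> \<lceil>n * f x\<rceil> - 1" by linarith
    also have "\<dots> \<longleftrightarrow> k \<le> m" using that unfolding m_def by linarith
    finally show ?thesis .
  qed
  moreover have "m \<le> n" unfolding m_def using nf by linarith
  ultimately have eq: "{k\<in>{1..n}. real k / n < f x} = {1..m}" by auto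
  have "(\<Sum>k=1..n. indicator {x. real k / real n < f x} x :: real) = (\<Sum>k\<in>{k\<in>{1..n}. real k / n < f x}. 1)"
    by (subst sum.inter_filter) (simp, intro sum.cong, auto simp: indicator_def)
  then have "(\<Sum>k=1..n. indicator {x. real k / real n < f x} x) = real m"
    unfolding eq by simp
  moreover have "real m \<le> n * f x" "n * f x \<le> real m + 1" unfolding m_def using nf by linarith+
  ultimately show "layer n f x \<le> f x" "f x \<le> layer n f x + 1 / n"
    using assms(3) unfolding layer_def by (simp_all add: field_simps)
qed

lemma level_set_borel:
  fixes f :: "'a::topological_space \<Rightarrow> real"
  shows "f \<in> borel_measurable borel \<Longrightarrow> {x. t < f x} \<in> sets borel"
  using borel_measurable_less[of "\<lambda>_. t" borel f] by simp

lemma layer_measurable: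
  fixes f :: "'a::topological_space \<Rightarrow> real"
  assumes "f \<in> borel_measurable borel"
  shows "layer n f \<in> borel_measurable borel"
  unfolding layer_def[abs_def] using level_set_borel[OF assms]
  by (intro borel_measurable_divide borel_measurable_sum borel_measurable_indicator borel_measurable_const)

lemma integrable_bounded_borel:
  fixes f :: "'a::topological_space \<Rightarrow> 'c::{banach, second_countable_topology}"
  assumes "finite_measure M" "sets M = sets borel" "f \<in> borel_measurable borel" "\<And>x. norm (f x) \<le> B"
  shows "integrable M f"
proof -
  have "f \<in> borel_measurable M" using assms by (simp cong: measurable_cong_sets)
  then show ?thesis using assms by (intro finite_measure.integrable_const_bound[where B=B]) auto
qed

lemma layer_range: "0 \<le> layer n f x" "layer n f x \<le> 1"
proof -
  have "(\<Sum>k=1..n. indicator {x. real k / real n < f x} x) \<le> (\<Sum>k=1..n. 1::real)"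
    by (intro sum_mono) (auto simp: indicator_def)
  then show "layer n f x \<le> 1" unfolding layer_def by (simp add: divide_le_eq)
  show "0 \<le> layer n f x" unfolding layer_def by (simp add: sum_nonneg)
qed

lemma integral_layer:
  fixes f :: "'a::topological_space \<Rightarrow> real"
  assumes "finite_measure M" "sets M = sets borel" "f \<in> borel_measurable borel"
  shows "(\<integral>x. layer n f x \<partial>M) = (\<Sum>k=1..n. measure M {x. real k / real n < f x}) / n"
proof -
  interpret finite_measure M by fact
  have sp: "space M = UNIV" using sets_eq_imp_space_eq[OF assms(2)] by simp
  have A: "{x. t < f x} \<in> sets M" for t using level_set_borel[OF assms(3)] assms(2) by simp
  have "(\<integral>x. layer n f x \<partial>M) = (\<Sum>k=1..n. \<integral>x. indicator {x. real k / real n < f x} x \<partial>M) / n"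
    unfolding layer_def using A
    by (subst Bochner_Integration.integral_divide_zero, subst Bochner_Integration.integral_sum)
       (auto intro!: integrable_real_indicator simp: emeasure_eq_measure)
  then show ?thesis using sp by simp
qed

text \<open>Up to the total mass divided by \<open>n\<close>, an integral is determined by the
  measures of finitely many level sets; this turns setwise information into information on
  integrals.\<close>

lemma integral_layer_bounds:
  fixes f :: "'a::topological_space \<Rightarrow> real"
  assumes M: "finite_measure M" "sets M = sets borel" and f: "f \<in> borel_measurable borel"
    and r: "\<And>x. 0 \<le> f x" "\<And>x. f x \<le> 1" and n: "0 < n"
  shows "(\<Sum>k=1..n. measure M {x. real k / real n < f x}) / n \<le> (\<integral>x. f x \<partial>M)"
    and "(\<integral>x. f x \<partial>M) \<le> (\<Sum>k=1..n. measure M {x. real k / real n < f x}) / n + measure M UNIV / n"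
proof -
  interpret finite_measure M by fact
  have sp: "space M = UNIV" using sets_eq_imp_space_eq[OF M(2)] by simp
  have If: "integrable M f" using r by (intro integrable_bounded_borel[OF M f, of 1]) auto
  have Il: "integrable M (layer n f)"
    by (rule integrable_bounded_borel[OF M layer_measurable[OF f], of n 1])
       (use layer_range[of n f] in auto)
  have "(\<integral>x. layer n f x \<partial>M) \<le> (\<integral>x. f x \<partial>M)"
    using layer_bounds[of f _ n, OF r n] by (intro integral_mono Il If) auto
  then show "(\<Sum>k=1..n. measure M {x. real k / real n < f x}) / n \<le> (\<integral>x. f x \<partial>M)"
    unfolding integral_layer[OF M f] .
  have "(\<integral>x. f x \<partial>M) \<le> (\<integral>x. layer n f x + 1 / n \<partial>M)"
    using layer_bounds[of f _ n, OF r n] by (intro integral_mono Bochner_Integration.integrable_add Il If) auto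
  also have "\<dots> = (\<integral>x. layer n f x \<partial>M) + measure M UNIV / n"
    by (subst Bochner_Integration.integral_add) (auto simp: Il sp)
  finally show "(\<integral>x. f x \<partial>M) \<le> (\<Sum>k=1..n. measure M {x. real k / real n < f x}) / n + measure M UNIV / n"
    unfolding integral_layer[OF M f] .
qed

section \<open>Lower semicontinuous functions\<close>

lemma lsc_borel:
  fixes g :: "'a::topological_space \<Rightarrow> real"
  assumes "\<And>t. open {y. t < g y}"
  shows "g \<in> borel_measurable borel"
  using assms by (auto simp: borel_measurable_iff_greater)

text \<open>A lower semicontinuous \<open>g\<close> is tested, up to \<open>\<epsilon>\<close>, on finitely many compact sets:
  every \<open>h\<close> that beats the same thresholds there has almost as large an integral.\<close>

lemma lsc_integral_approx:
  fixes g :: "'a::t2_space \<Rightarrow> real"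
  assumes M: "radon_finite M" and lsc: "\<And>t. open {y. t < g y}"
    and r: "\<And>y. 0 \<le> g y" "\<And>y. g y \<le> 1" and "0 < \<epsilon>"
  shows "\<exists>(n::nat) C. (\<forall>k. compact (C k) \<and> C k \<subseteq> {y. real k / n < g y}) \<and>
    (\<forall>h\<in>borel_measurable borel. (\<forall>y. 0 \<le> h y \<and> h y \<le> 1) \<longrightarrow>
       (\<forall>k\<in>{1..n}. C k \<subseteq> {y. real k / n < h y}) \<longrightarrow> (\<integral>y. g y \<partial>M) - \<epsilon> \<le> (\<integral>y. h y \<partial>M))"
proof -
  have fM: "finite_measure M" and sM: "sets M = sets borel" using M by (auto simp: radon_finite_def)
  interpret finite_measure M by fact
  \<comment> \<open>Half of \<open>\<epsilon>\<close> pays for the layer error, the other half for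
    replacing level sets by compact subsets. Layer sums are averages over the levels, so the second
    loss does not grow with \<open>n\<close>.\<close>
  obtain n :: nat where n: "measure M UNIV / (\<epsilon>/2) < n" using reals_Archimedean2 by blast
  moreover have "0 \<le> measure M UNIV / (\<epsilon>/2)" using \<open>0 < \<epsilon>\<close> by simp
  ultimately have n0: "0 < n" by (metis of_nat_0_less_iff order_le_less_trans)
  have ne: "measure M UNIV / n \<le> \<epsilon>/2" using n n0 \<open>0 < \<epsilon>\<close> by (simp add: field_simps)
  have "\<exists>C. compact C \<and> C \<subseteq> {y. real k / n < g y} \<and> measure M ({y. real k / n < g y} - C) < \<epsilon>/2" for k
    using M borel_open[OF lsc[of "k/n"]] half_gt_zero[OF \<open>0 < \<epsilon>\<close>] unfolding radon_finite_def by blast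
  then obtain C where C: "\<And>k. compact (C k)" "\<And>k. C k \<subseteq> {y. real k / n < g y}"
    "\<And>k. measure M ({y. real k / n < g y} - C k) < \<epsilon>/2" by metis
  show ?thesis
  proof (intro exI[of _ n] exI[of _ C] conjI allI ballI impI C(1,2))
    fix h :: "'a \<Rightarrow> real" assume "h \<in> borel_measurable borel" "\<forall>y. 0 \<le> h y \<and> h y \<le> 1"
      "\<forall>k\<in>{1..n}. C k \<subseteq> {y. real k / n < h y}"
    then have h: "h \<in> borel_measurable borel" "\<And>y. 0 \<le> h y" "\<And>y. h y \<le> 1"
      "\<And>k. k \<in> {1..n} \<Longrightarrow> C k \<subseteq> {y. real k / n < h y}" by auto
    have "measure M {y. real k / n < g y} \<le> measure M {y. real k / n < h y} + \<epsilon>/2" if k: "k \<in> {1..n}" for k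
    proof -
      have "measure M {y. real k / n < g y} = measure M (C k) + measure M ({y. real k / n < g y} - C k)"
        using C(2)[of k] compact_borel[OF C(1)] lsc sM
        by (subst finite_measure_Union[symmetric]) (auto intro!: arg_cong[where f="measure M"])
      moreover have "measure M (C k) \<le> measure M {y. real k / n < h y}"
        using h(4)[OF k] level_set_borel[OF h(1)] sM by (intro finite_measure_mono) auto
      ultimately show ?thesis using C(3)[of k] by simp
    qed
    then have "(\<Sum>k=1..n. measure M {y. real k / n < g y}) \<le> (\<Sum>k=1..n. measure M {y. real k / n < h y} + \<epsilon>/2)"
      by (rule sum_mono)
    then have "(\<Sum>k=1..n. measure M {y. real k / n < g y}) / n \<le> (\<Sum>k=1..n. measure M {y. real k / n < h y} + \<epsilon>/2) / n"
      by (simp add: divide_right_mono)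
    also have "\<dots> = (\<Sum>k=1..n. measure M {y. real k / n < h y}) / n + \<epsilon>/2"
      using n0 by (simp add: sum.distrib add_divide_distrib)
    finally show "(\<integral>y. g y \<partial>M) - \<epsilon> \<le> (\<integral>y. h y \<partial>M)"
      using integral_layer_bounds(2)[OF fM sM lsc_borel[OF lsc] r n0]
        integral_layer_bounds(1)[OF fM sM h(1-3) n0] ne by linarith
  qed
qed

lemma directed_finite_bound:
  fixes G :: "'i \<Rightarrow> 'b \<Rightarrow> real"
  assumes dir: "\<And>i j. i \<in> I \<Longrightarrow> j \<in> I \<Longrightarrow> \<exists>k\<in>I. \<forall>y. G i y \<le> G k y \<and> G j y \<le> G k y"
    and "I \<noteq> {}" "finite J" "J \<subseteq> I"
  shows "\<exists>k\<in>I. \<forall>j\<in>J. \<forall>y. G j y \<le> G k y"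
  using assms(3,4)
proof (induction J rule: finite_induct)
  case empty
  then show ?case using \<open>I \<noteq> {}\<close> by auto
next
  case (insert j J)
  then obtain k where k: "k \<in> I" "\<forall>j\<in>J. \<forall>y. G j y \<le> G k y" by auto
  obtain k' where "k' \<in> I" "\<forall>y. G k y \<le> G k' y \<and> G j y \<le> G k' y"
    using dir[OF k(1), of j] insert by auto
  then show ?case using k by (intro bexI[of _ k']) (auto intro: order_trans)
qed

text \<open>Monotone convergence handles sequences, but this family is an arbitrary directed one.
  Finitely many compact sets decide the integral of \<open>g\<close> up to
  \<open>\<epsilon>\<close>; each is covered by finitely many level sets of members, so a single
  member beats all thresholds.\<close>

lemma tau_additive:
  fixes G :: "'i \<Rightarrow> 'a::t2_space \<Rightarrow> real"
  assumes M: "radon_finite M" and "I \<noteq> {}"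
    and dir: "\<And>i j. i \<in> I \<Longrightarrow> j \<in> I \<Longrightarrow> \<exists>k\<in>I. \<forall>y. G i y \<le> G k y \<and> G j y \<le> G k y"
    and lsc: "\<And>i t. i \<in> I \<Longrightarrow> open {y. t < G i y}"
    and r: "\<And>i y. i \<in> I \<Longrightarrow> 0 \<le> G i y" "\<And>i y. i \<in> I \<Longrightarrow> G i y \<le> g y" "\<And>y. g y \<le> 1"
    and sup: "\<And>y t. t < g y \<Longrightarrow> \<exists>i\<in>I. t < G i y" and "0 < \<epsilon>"
  shows "\<exists>i\<in>I. (\<integral>y. g y \<partial>M) - \<epsilon> \<le> (\<integral>y. G i y \<partial>M)"
proof -
  have eq: "{y. t < g y} = (\<Union>i\<in>I. {y. t < G i y})" for t
    using sup r(2) by (fastforce intro: less_le_trans)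
  have lscg: "open {y. t < g y}" for t unfolding eq using lsc by auto
  have g0: "0 \<le> g y" for y using \<open>I \<noteq> {}\<close> r(1,2) by (meson all_not_in_conv order_trans)
  obtain n :: nat and C where C: "\<forall>k. compact (C k) \<and> C k \<subseteq> {y. real k / n < g y}"
    and appr: "\<forall>h\<in>borel_measurable borel. (\<forall>y. 0 \<le> h y \<and> h y \<le> 1) \<longrightarrow>
       (\<forall>k\<in>{1..n}. C k \<subseteq> {y. real k / n < h y}) \<longrightarrow> (\<integral>y. g y \<partial>M) - \<epsilon> \<le> (\<integral>y. h y \<partial>M)"
    using lsc_integral_approx[OF M lscg g0 r(3) \<open>0 < \<epsilon>\<close>] by (elim exE conjE)
  have C: "compact (C k)" "C k \<subseteq> {y. real k / n < g y}" for k using C by auto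
  have "\<exists>i\<in>I. C k \<subseteq> {y. real k / n < G i y}" for k
  proof -
    have "C k \<subseteq> (\<Union>i\<in>I. {y. real k / n < G i y})" using C(2)[of k] unfolding eq .
    then obtain J where J: "J \<subseteq> I" "finite J" "C k \<subseteq> (\<Union>i\<in>J. {y. real k / n < G i y})"
      using compactE_image[OF C(1)[of k], of I "\<lambda>i. {y. real k / n < G i y}"] lsc by blast
    obtain i where "i \<in> I" "\<forall>j\<in>J. \<forall>y. G j y \<le> G i y"
      using directed_finite_bound[OF dir \<open>I \<noteq> {}\<close> J(2,1)] by blast
    then have "C k \<subseteq> {y. real k / n < G i y}"
      using J(3) by (smt (verit) UN_iff mem_Collect_eq subset_iff)
    with \<open>i \<in> I\<close> show ?thesis by blast
  qed
  then obtain i where i: "\<And>k. i k \<in> I" "\<And>k. C k \<subseteq> {y. real k / n < G (i k) y}" by metis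
  obtain j where j: "j \<in> I" "\<forall>k\<in>i ` {1..n}. \<forall>y. G k y \<le> G j y"
    using directed_finite_bound[OF dir \<open>I \<noteq> {}\<close>, of "i ` {1..n}"] i(1) by blast
  have "(\<integral>y. g y \<partial>M) - \<epsilon> \<le> (\<integral>y. G j y \<partial>M)"
  proof (rule appr[rule_format])
    show "G j \<in> borel_measurable borel" using lsc[OF j(1)] by (rule lsc_borel)
    show "0 \<le> G j y \<and> G j y \<le> 1" for y using r(1,2)[OF j(1)] r(3) order_trans by blast
    show "C k \<subseteq> {y. real k / n < G j y}" if "k \<in> {1..n}" for k
      using i(2)[of k] j(2) that by (smt (verit) imageI mem_Collect_eq subset_iff)
  qed
  with j(1) show ?thesis by blast
qed

text \<open>The tube lemma spreads each of finitely many threshold inequalities from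
  \<open>{x0} \<times> C k\<close> to a neighbourhood of \<open>x0\<close>. Joint lower
  semicontinuity replaces joint measurability, because the Borel sets of a product may exceed the
  product sigma-algebra.\<close>

lemma lsc_integral_parametric:
  fixes G :: "'b::topological_space \<Rightarrow> 'a::t2_space \<Rightarrow> real"
  assumes M: "radon_finite M" and lsc: "\<And>t. open {(x,y). t < G x y}"
    and r: "\<And>x y. 0 \<le> G x y" "\<And>x y. G x y \<le> 1"
  shows "open {x. t < (\<integral>y. G x y \<partial>M)}"
proof (subst open_subopen, safe)
  fix x0 assume x0: "t < (\<integral>y. G x0 y \<partial>M)"
  have lscx: "open {y. s < G x y}" for s x
  proof -
    have "open ((\<lambda>y. (x,y)) -` {(x,y). s < G x y})"
      by (intro open_vimage lsc continuous_intros)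
    then show ?thesis by simp
  qed
  define \<epsilon> where "\<epsilon> = ((\<integral>y. G x0 y \<partial>M) - t) / 2"
  have "0 < \<epsilon>" using x0 by (simp add: \<epsilon>_def)
  obtain n :: nat and C where C: "\<forall>k. compact (C k) \<and> C k \<subseteq> {y. real k / n < G x0 y}"
    and appr: "\<forall>h\<in>borel_measurable borel. (\<forall>y. 0 \<le> h y \<and> h y \<le> 1) \<longrightarrow>
       (\<forall>k\<in>{1..n}. C k \<subseteq> {y. real k / n < h y}) \<longrightarrow> (\<integral>y. G x0 y \<partial>M) - \<epsilon> \<le> (\<integral>y. h y \<partial>M)"
    using lsc_integral_approx[OF M lscx r \<open>0 < \<epsilon>\<close>, of x0] by (elim exE conjE)
  have C: "compact (C k)" "C k \<subseteq> {y. real k / n < G x0 y}" for k using C by auto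
  have "\<exists>X. x0 \<in> X \<and> open X \<and> X \<times> C k \<subseteq> {(x,y). real k / n < G x y}" for k
    using Elementary_Topology.tube_lemma[OF C(1)[of k] lsc[of "k/n"], of x0] C(2)[of k] by blast
  then obtain X where X: "\<And>k. x0 \<in> X k" "\<And>k. open (X k)" "\<And>k. X k \<times> C k \<subseteq> {(x,y). real k / n < G x y}"
    by metis
  have "t < (\<integral>y. G x y \<partial>M)" if "x \<in> (\<Inter>k\<in>{1..n}. X k)" for x
  proof -
    have "(\<integral>y. G x0 y \<partial>M) - \<epsilon> \<le> (\<integral>y. G x y \<partial>M)"
    proof (intro appr[rule_format] lsc_borel lscx conjI r)
      show "C k \<subseteq> {y. real k / n < G x y}" if "k \<in> {1..n}" for k
        using X(3)[of k] \<open>x \<in> _\<close> that by blast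
    qed
    then show ?thesis using \<open>0 < \<epsilon>\<close> unfolding \<epsilon>_def by argo
  qed
  then show "\<exists>T. open T \<and> x0 \<in> T \<and> T \<subseteq> {x. t < (\<integral>y. G x y \<partial>M)}"
    using X by (intro exI[of _ "\<Inter>k\<in>{1..n}. X k"]) auto
qed

section \<open>Locally compact Hausdorff spaces\<close>

lemma Hausdorff_space_euclidean_t2: "Hausdorff_space (euclidean :: 'a::t2_space topology)"
  unfolding Hausdorff_space_def by (auto simp: disjnt_def) (meson hausdorff)

lemma compact_separation_t2:
  fixes S T :: "'a::t2_space set"
  assumes "compact S" "compact T" "S \<inter> T = {}"
  obtains U V where "open U" "open V" "S \<subseteq> U" "T \<subseteq> V" "U \<inter> V = {}"
  using Hausdorff_space_compact_separation[OF Hausdorff_space_euclidean_t2, of S T] assms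
  by (auto simp: disjnt_def)

text \<open>\<open>C - U\<close> and \<open>C - V\<close> are disjoint compact sets; removing
  separating neighbourhoods of them from \<open>C\<close> leaves the two pieces. This will make a
  content subadditive on open sets.\<close>

lemma compact_split:
  fixes C :: "'a::t2_space set"
  assumes "compact C" "open U" "open V" "C \<subseteq> U \<union> V"
  obtains C1 C2 where "compact C1" "compact C2" "C1 \<subseteq> U" "C2 \<subseteq> V" "C = C1 \<union> C2"
proof -
  obtain S T where ST: "open S" "open T" "C - U \<subseteq> S" "C - V \<subseteq> T" "S \<inter> T = {}"
    using compact_separation_t2[of "C - U" "C - V"] assms by (auto intro: compact_diff)
  show ?thesis
    using assms ST by (intro that[of "C - S" "C - T"]) (auto intro: compact_diff)
qed

lemma compact_closure_nbhd:
  fixes C :: "'a::t2_space set"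
  assumes lc: "locally_compact_space (euclidean :: 'a topology)"
    and C: "compact C" "C \<subseteq> U" "open U"
  obtains V where "open V" "C \<subseteq> V" "compact (closure V)" "closure V \<subseteq> U"
proof -
  have "\<exists>V K. open V \<and> compact K \<and> x \<in> V \<and> V \<subseteq> K \<and> K \<subseteq> U" if "x \<in> C" for x
    using lc that C Hausdorff_space_euclidean_t2
    by (subst (asm) locally_compact_space_neighbourhood_base_closedin)
       (auto simp: neighbourhood_base_of, metis subsetD)
  then obtain V K where VK: "\<And>x. x \<in> C \<Longrightarrow> open (V x) \<and> compact (K x) \<and> x \<in> V x \<and> V x \<subseteq> K x \<and> K x \<subseteq> U"
    by metis
  obtain D where D: "D \<subseteq> C" "finite D" "C \<subseteq> (\<Union>x\<in>D. V x)"
    using compactE_image[OF C(1), of C V] VK by blast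
  have K: "compact (\<Union>x\<in>D. K x)" using D VK by (intro compact_UN) auto
  have "closure (\<Union>x\<in>D. V x) \<subseteq> (\<Union>x\<in>D. K x)"
    using D VK by (intro closure_minimal compact_imp_closed[OF K]) blast
  then show ?thesis
  proof (intro that[of "\<Union>x\<in>D. V x"])
    show "open (\<Union>x\<in>D. V x)" using D(1) VK by (intro open_UN) auto
    assume "closure (\<Union>x\<in>D. V x) \<subseteq> (\<Union>x\<in>D. K x)"
    moreover have "(\<Union>x\<in>D. K x) \<subseteq> U" using D(1) VK by (intro UN_least) auto
    ultimately show "closure (\<Union>x\<in>D. V x) \<subseteq> U" "compact (closure (\<Union>x\<in>D. V x))"
      using compact_Int_closed[OF K closed_closure[of "\<Union>x\<in>D. V x"]] by (simp_all add: inf.absorb2)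
  qed (rule D(3))
qed

definition Cc01 :: "('a::topological_space \<Rightarrow> real) set" where
  "Cc01 = {f\<in>Cc. \<forall>x. 0 \<le> f x \<and> f x \<le> 1}"

lemma Cc01D:
  assumes "f \<in> Cc01"
  shows "continuous_on UNIV f" "f \<in> borel_measurable borel" "0 \<le> f x" "f x \<le> 1" "\<bar>f x\<bar> \<le> 1"
    "f \<in> Cc" "compact (closure {x. f x \<noteq> 0})"
  using assms by (auto simp: Cc01_def Cc_def intro: borel_measurable_continuous_onI)

text \<open>Compact support comes from inserting a relatively compact open \<open>V\<close> between
  \<open>C\<close> and \<open>U\<close> and letting the function vanish off
  \<open>V\<close>.\<close>

lemma urysohn_Cc01:
  fixes C :: "'a::t2_space set"
  assumes lc: "locally_compact_space (euclidean :: 'a topology)"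
    and C: "compact C" "C \<subseteq> U" "open U"
  obtains f where "f \<in> Cc01" "\<And>x. x \<in> C \<Longrightarrow> f x = 1" "\<And>x. x \<notin> U \<Longrightarrow> f x = 0"
proof -
  obtain V where V: "open V" "C \<subseteq> V" "compact (closure V)" "closure V \<subseteq> U"
    using compact_closure_nbhd[OF assms] by blast
  have "completely_regular_space (euclidean :: 'a topology)"
    using locally_compact_regular_imp_completely_regular_space[OF lc] Hausdorff_space_euclidean_t2 by blast
  then obtain f :: "'a \<Rightarrow> real" where f: "continuous_map euclidean (top_of_set {0..1}) f"
    "f ` (- V) \<subseteq> {0}" "f ` C \<subseteq> {1}"
    using Urysohn_completely_regular_compact_closed[of 0 1 "euclidean :: 'a topology" C "- V"] C V
    by (auto simp: disjnt_def)
  have c: "continuous_on UNIV f" and r: "\<And>x. 0 \<le> f x \<and> f x \<le> 1"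
    using f(1) by (auto simp: continuous_map_in_subtopology image_subset_iff)
  have s: "closure {x. f x \<noteq> 0} \<subseteq> closure V"
    using f(2) by (intro closure_mono) auto
  then have "compact (closure {x. f x \<noteq> 0})"
    using compact_Int_closed[OF V(3) closed_closure[of "{x. f x \<noteq> 0}"]] by (simp add: inf.absorb2)
  then have "f \<in> Cc01" using c r by (auto simp: Cc01_def Cc_def)
  then show ?thesis
  proof (rule that)
    fix x
    show "f x = 1" if "x \<in> C" using that f(3) by auto
    show "f x = 0" if "x \<notin> U"
    proof -
      have "x \<in> - V" using that V(4) closure_subset[of V] by auto
      then show ?thesis using f(2) by auto
    qed
  qed
qed

section \<open>Real signed measures and their positive parts\<close>

definition signed_measure :: "('a::topological_space set \<Rightarrow> real) \<Rightarrow> bool" where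
  "signed_measure r \<longleftrightarrow> r {} = 0 \<and> (\<forall>F::nat \<Rightarrow> 'a set. range F \<subseteq> sets borel \<longrightarrow> disjoint_family F \<longrightarrow>
        (\<lambda>n. r (F n)) sums r (\<Union>n. F n))"

lemma signed_measure_uminus: "signed_measure r \<Longrightarrow> signed_measure (\<lambda>A. - r A)"
  by (auto simp: signed_measure_def intro: sums_minus)

lemma signed_measure_sums:
  assumes "signed_measure r" "\<And>n. F n \<in> sets borel" "disjoint_family F"
  shows "(\<lambda>n. r (F n)) sums r (\<Union>n. F n)"
  using assms unfolding signed_measure_def by (metis image_subsetI)

lemma signed_measure_Un:
  assumes r: "signed_measure r" and "A \<in> sets borel" "B \<in> sets borel" "A \<inter> B = {}"
  shows "r (A \<union> B) = r A + r B"
proof -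
  have "(\<lambda>n. r (binaryset A B n)) sums r (\<Union>n. binaryset A B n)"
    using assms by (intro signed_measure_sums) (auto simp: binaryset_def disjoint_family_on_def)
  moreover have "(\<lambda>n. r (binaryset A B n)) sums (r A + r B)"
    using r by (intro binaryset_sums) (simp add: signed_measure_def)
  ultimately show ?thesis by (simp add: UN_binaryset_eq sums_iff)
qed

lemma signed_measure_Diff:
  assumes "signed_measure r" "A \<in> sets borel" "B \<in> sets borel" "B \<subseteq> A"
  shows "r A = r B + r (A - B)"
  using signed_measure_Un[of r B "A - B"] assms by (auto simp: Un_absorb1)

text \<open>If boundedness failed, sets with subsets of arbitrarily large value could be shrunk
  forever, each time discarding a piece of value beyond 1; these disjoint pieces contradict the
  convergence of their series.\<close>

lemma signed_measure_bounded:
  fixes r :: "'a::topological_space set \<Rightarrow> real"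
  assumes r: "signed_measure r"
  obtains c where "\<And>A. A \<in> sets borel \<Longrightarrow> \<bar>r A\<bar> \<le> c"
proof (rule ccontr)
  assume neg: "\<not> thesis"
  define unb where "unb E \<longleftrightarrow> E \<in> sets borel \<and> (\<forall>c. \<exists>B\<in>sets borel. B \<subseteq> E \<and> c < \<bar>r B\<bar>)" for E
  have step: "\<exists>E'. E' \<subseteq> E \<and> unb E' \<and> 1 < \<bar>r (E - E')\<bar>" if E: "unb E" for E
  proof -
    obtain B where B: "B \<in> sets borel" "B \<subseteq> E" "\<bar>r E\<bar> + 1 < \<bar>r B\<bar>" using E by (auto simp: unb_def)
    have Eb: "E \<in> sets borel" using E by (simp add: unb_def)
    have sp: "r E = r B + r (E - B)" by (rule signed_measure_Diff[OF r Eb B(1,2)])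
    \<comment> \<open>Whichever half is kept, the discarded one has value beyond 1:
      \<open>\<bar>r B\<bar> > \<bar>r E\<bar> + 1\<close> forces
      \<open>\<bar>r (E - B)\<bar> > 1\<close> as well.\<close>
    have "unb B \<or> unb (E - B)"
    proof (rule ccontr)
      assume "\<not> ?thesis"
      then obtain c1 c2 where c: "\<And>D. D \<in> sets borel \<Longrightarrow> D \<subseteq> B \<Longrightarrow> \<bar>r D\<bar> \<le> c1"
        "\<And>D. D \<in> sets borel \<Longrightarrow> D \<subseteq> E - B \<Longrightarrow> \<bar>r D\<bar> \<le> c2"
        using B(1) Eb unfolding unb_def by (metis not_le sets.Diff)
      obtain D where D: "D \<in> sets borel" "D \<subseteq> E" "c1 + c2 < \<bar>r D\<bar>" using E by (auto simp: unb_def)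
      have "r D = r (D \<inter> B) + r (D - D \<inter> B)"
        using D B by (intro signed_measure_Diff[OF r]) auto
      moreover have "\<bar>r (D \<inter> B)\<bar> \<le> c1" using D B by (intro c(1)) auto
      moreover have "\<bar>r (D - D \<inter> B)\<bar> \<le> c2" using D B by (intro c(2)) auto
      ultimately show False using D(3) by linarith
    qed
    then show ?thesis
    proof
      assume "unb B" then show ?thesis using B sp by (intro exI[of _ B]) linarith
    next
      assume "unb (E - B)"
      then show ?thesis using B by (intro exI[of _ "E - B"]) (auto simp: double_diff)
    qed
  qed
  have "unb UNIV" using neg that unfolding unb_def by (metis not_le sets.top space_borel subset_UNIV)
  then obtain E where E: "\<And>n. unb (E n)" "\<And>n. E (Suc n) \<subseteq> E n \<and> 1 < \<bar>r (E n - E (Suc n))\<bar>"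
    using dependent_nat_choice[of "\<lambda>_. unb" "\<lambda>_ E E'. E' \<subseteq> E \<and> 1 < \<bar>r (E - E')\<bar>"] step by metis
  have dec: "decseq E" using E(2) by (auto simp: decseq_Suc_iff)
  have "disjoint_family (\<lambda>n. E n - E (Suc n))"
  proof -
    have "(E m - E (Suc m)) \<inter> (E n - E (Suc n)) = {}" if "m < n" for m n
      using decseqD[OF dec, of "Suc m" n] that by auto
    then show ?thesis unfolding disjoint_family_on_def by (metis Int_commute nat_neq_iff)
  qed
  then have "(\<lambda>n. r (E n - E (Suc n))) sums r (\<Union>n. E n - E (Suc n))"
    using E(1) by (intro signed_measure_sums[OF r]) (auto simp: unb_def)
  then have "(\<lambda>n. r (E n - E (Suc n))) \<longlonglongrightarrow> 0" by (intro summable_LIMSEQ_zero sums_summable)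
  then have "eventually (\<lambda>n. \<bar>r (E n - E (Suc n))\<bar> < 1) sequentially"
    by (auto dest: tendstoD[of _ _ _ 1] simp: dist_real_def)
  then obtain n where "\<bar>r (E n - E (Suc n))\<bar> < 1" by (auto simp: eventually_sequentially)
  then show False using E(2)[of n] by simp
qed

lemma SUP_add_SUP_le:
  fixes f :: "'i \<Rightarrow> ennreal" and g :: "'j \<Rightarrow> ennreal"
  assumes "I \<noteq> {}" "J \<noteq> {}" "\<And>i j. i \<in> I \<Longrightarrow> j \<in> J \<Longrightarrow> f i + g j \<le> c"
  shows "(SUP i\<in>I. f i) + (SUP j\<in>J. g j) \<le> c"
proof -
  have "f i + (SUP j\<in>J. g j) \<le> c" if "i \<in> I" for i
    using assms(3)[OF that] by (subst ennreal_SUP_add_right[OF assms(2)]) (rule SUP_least)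
  then show ?thesis
    by (subst ennreal_SUP_add_left[OF assms(1), symmetric]) (rule SUP_least)
qed

lemma sets_pospart [simp, measurable_cong]: "sets (pospart r) = sets borel"
  unfolding pospart_def using sets.sigma_sets_eq[of borel] by simp

lemma space_pospart [simp]: "space (pospart r) = UNIV"
  unfolding pospart_def by simp

text \<open>\<open>measure_of\<close> returns its set function only if that is countably additive,
  so this is the point to prove. \<open>ennreal\<close> cuts negative values to 0, which makes the
  supremum the positive part without a Hahn decomposition.\<close>

lemma emeasure_pospart:
  fixes r :: "'a::topological_space set \<Rightarrow> real"
  assumes r: "signed_measure r" and A: "A \<in> sets borel"
  shows "emeasure (pospart r) A = (SUP B\<in>{B\<in>sets borel. B \<subseteq> A}. ennreal (r B))"
proof -
  define p where "p A = (SUP B\<in>{B\<in>sets borel. B \<subseteq> A}. ennreal (r B))" for A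
  have ne: "{B\<in>sets borel. B \<subseteq> A} \<noteq> {}" for A :: "'a set" by auto
  have p0: "p {} = 0"
  proof -
    have "{B \<in> sets borel. B \<subseteq> {}} = {{}::'a set}" by auto
    then show ?thesis using r by (simp add: p_def signed_measure_def)
  qed
  have pmono: "p A \<le> p B" if "A \<subseteq> B" for A B
    unfolding p_def using that by (intro SUP_subset_mono) auto
  have pUn: "p A + p B \<le> p (A \<union> B)" if "A \<in> sets borel" "B \<in> sets borel" "A \<inter> B = {}" for A B
    unfolding p_def
  proof (rule SUP_add_SUP_le[OF ne ne])
    fix C D assume "C \<in> {B \<in> sets borel. B \<subseteq> A}" "D \<in> {C \<in> sets borel. C \<subseteq> B}"
    then have CD: "C \<in> sets borel" "D \<in> sets borel" "C \<subseteq> A" "D \<subseteq> B" by auto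
    have e: "ennreal (r E) \<le> (SUP B\<in>{C\<in>sets borel. C \<subseteq> A \<union> B}. ennreal (r B))" if "E \<in> sets borel" "E \<subseteq> A \<union> B" for E
      using that by (intro SUP_upper2[of E]) auto
    have rCD: "r (C \<union> D) = r C + r D"
      using CD \<open>A \<inter> B = {}\<close> by (intro signed_measure_Un[OF r]) auto
    show "ennreal (r C) + ennreal (r D) \<le> (SUP B\<in>{C\<in>sets borel. C \<subseteq> A \<union> B}. ennreal (r B))"
    \<comment> \<open>If one value is negative, its truncation is 0 and the other set alone is a
      witness; the union would then be too small.\<close>
    proof (cases "0 \<le> r C \<and> 0 \<le> r D")
      case True
      then have "ennreal (r C) + ennreal (r D) = ennreal (r (C \<union> D))" by (simp add: rCD)
      then show ?thesis using e[of "C \<union> D"] CD by (auto intro: sets.Un)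
    next
      case False
      then have "ennreal (r C) + ennreal (r D) = ennreal (r C) \<or> ennreal (r C) + ennreal (r D) = ennreal (r D)"
        by (auto simp: ennreal_neg)
      then show ?thesis using e[OF CD(1) le_supI1[OF CD(3)]] e[OF CD(2) le_supI2[OF CD(4)]] by metis
    qed
  qed
  have "countably_additive (sets borel) p"
  proof (rule countably_additiveI)
    fix F :: "nat \<Rightarrow> 'a set"
    assume F: "range F \<subseteq> sets borel" "disjoint_family F" "(\<Union>i. F i) \<in> sets borel"
    have Fb: "F i \<in> sets borel" for i using F(1) by auto
    show "(\<Sum>i. p (F i)) = p (\<Union>i. F i)"
    proof (rule antisym)
      have "(\<Sum>i<n. p (F i)) \<le> p (\<Union>i<n. F i)" for n
      proof (induction n)
        case (Suc n)
        have "(\<Sum>i<Suc n. p (F i)) \<le> p (\<Union>i<n. F i) + p (F n)" using Suc by (auto intro: add_mono)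
        also have "\<dots> \<le> p ((\<Union>i<n. F i) \<union> F n)"
        proof (intro pUn)
          have "F i \<inter> F n = {}" if "i < n" for i using F(2) that by (auto simp: disjoint_family_on_def)
          then show "(\<Union>i<n. F i) \<inter> F n = {}" by auto
        qed (use Fb in auto)
        also have "(\<Union>i<n. F i) \<union> F n = (\<Union>i<Suc n. F i)" by (auto simp: lessThan_Suc)
        finally show ?case .
      qed (simp add: p0)
      then have "(\<Sum>i<n. p (F i)) \<le> p (\<Union>i. F i)" for n
        by (rule order_trans) (auto intro: pmono)
      then show "(\<Sum>i. p (F i)) \<le> p (\<Union>i. F i)"
        by (intro suminf_le_const) auto
      show "p (\<Union>i. F i) \<le> (\<Sum>i. p (F i))"
        unfolding p_def[of "\<Union>i. F i"]
      proof (rule SUP_least)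
        fix B assume "B \<in> {B \<in> sets borel. B \<subseteq> (\<Union>i. F i)}"
        then have B: "B \<in> sets borel" "B = (\<Union>i. B \<inter> F i)" by auto
        have "(\<lambda>n. r (B \<inter> F n)) sums r (\<Union>n. B \<inter> F n)"
          using B(1) Fb F(2) by (intro signed_measure_sums[OF r]) (auto simp: disjoint_family_on_def)
        then have "(\<lambda>n. r (B \<inter> F n)) sums r B" using B(2) by simp
        then have "(\<lambda>n. \<Sum>i<n. r (B \<inter> F i)) \<longlonglongrightarrow> r B" by (simp add: sums_def)
        then have "(\<lambda>n. ennreal (\<Sum>i<n. r (B \<inter> F i))) \<longlonglongrightarrow> ennreal (r B)" by (rule tendsto_ennrealI)
        moreover have "ennreal (\<Sum>i<n. r (B \<inter> F i)) \<le> (\<Sum>i. p (F i))" for n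
        proof -
          have "ennreal (\<Sum>i<n. r (B \<inter> F i)) \<le> ennreal (\<Sum>i<n. max 0 (r (B \<inter> F i)))"
            by (intro ennreal_leI sum_mono) auto
          also have "\<dots> = (\<Sum>i<n. ennreal (max 0 (r (B \<inter> F i))))" by (intro sum_ennreal[symmetric]) simp
          also have "\<dots> \<le> (\<Sum>i<n. p (F i))"
          proof (rule sum_mono)
            fix i
            have "ennreal (max 0 (r (B \<inter> F i))) = ennreal (r (B \<inter> F i))" by simp
            also have "\<dots> \<le> p (F i)"
              unfolding p_def using B(1) Fb by (intro SUP_upper) auto
            finally show "ennreal (max 0 (r (B \<inter> F i))) \<le> p (F i)" .
          qed
          also have "\<dots> \<le> (\<Sum>i. p (F i))" by (intro sum_le_suminf) auto
          finally show ?thesis .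
        qed
        ultimately show "ennreal (r B) \<le> (\<Sum>i. p (F i))"
          by (intro LIMSEQ_le_const2) auto
      qed
    qed
  qed
  then have "emeasure (measure_of UNIV (sets borel) p) A = p A"
    using A p0 sets.sigma_algebra_axioms[of "borel :: 'a measure"]
    by (intro emeasure_measure_of_sigma) (auto simp: positive_def)
  then show ?thesis unfolding pospart_def p_def .
qed

lemma finite_measure_pospart:
  assumes "signed_measure r"
  shows "finite_measure (pospart r)"
proof
  obtain c where c: "\<And>A. A \<in> sets borel \<Longrightarrow> \<bar>r A\<bar> \<le> c" using signed_measure_bounded[OF assms] by blast
  have "emeasure (pospart r) UNIV \<le> ennreal c"
    using c by (subst emeasure_pospart[OF assms]) (auto intro!: SUP_least ennreal_leI intro: order_trans[OF abs_ge_self])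
  then show "emeasure (pospart r) (space (pospart r)) \<noteq> \<infinity>"
    by (auto simp: top_unique)
qed

lemma measure_pospart_ge:
  assumes r: "signed_measure r" and "A \<in> sets borel" "B \<in> sets borel" "B \<subseteq> A"
  shows "r B \<le> measure (pospart r) A"
proof -
  interpret finite_measure "pospart r" by (rule finite_measure_pospart[OF r])
  have "ennreal (r B) \<le> emeasure (pospart r) A"
    using assms by (subst emeasure_pospart[OF r]) (auto intro: SUP_upper)
  then show ?thesis by (simp add: emeasure_eq_measure ennreal_le_iff)
qed

lemma measure_pospart_le:
  assumes r: "signed_measure r" and A: "A \<in> sets borel" and "0 \<le> c"
    and c: "\<And>B. B \<in> sets borel \<Longrightarrow> B \<subseteq> A \<Longrightarrow> r B \<le> c"
  shows "measure (pospart r) A \<le> c"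
proof -
  interpret finite_measure "pospart r" by (rule finite_measure_pospart[OF r])
  have "emeasure (pospart r) A \<le> ennreal c"
    using c by (subst emeasure_pospart[OF r A]) (auto intro!: SUP_least ennreal_leI)
  then show ?thesis using \<open>0 \<le> c\<close> by (simp add: emeasure_eq_measure ennreal_le_iff)
qed

text \<open>Jordan decomposition: for \<open>B \<subseteq> A\<close>, the value \<open>r B\<close>
  exceeds \<open>r A\<close> by exactly \<open>- r (A - B)\<close>, which the negative part bounds.
  Exchanging \<open>r\<close> and \<open>- r\<close> gives the reverse inequality.\<close>

lemma measure_pospart_diff:
  assumes r: "signed_measure r" and A: "A \<in> sets borel"
  shows "measure (pospart r) A - measure (pospart (\<lambda>A. - r A)) A = r A"
proof -
  have le: "measure (pospart s) A \<le> s A + measure (pospart (\<lambda>A. - s A)) A" if s: "signed_measure s" for s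
  proof (rule measure_pospart_le[OF s A])
    note s' = signed_measure_uminus[OF s]
    show "0 \<le> s A + measure (pospart (\<lambda>A. - s A)) A"
      using measure_pospart_ge[OF s' A A] by simp
    fix B assume B: "B \<in> sets borel" "B \<subseteq> A"
    show "s B \<le> s A + measure (pospart (\<lambda>A. - s A)) A"
      using measure_pospart_ge[OF s' A, of "A - B"] signed_measure_Diff[OF s A B] A B by auto
  qed
  show ?thesis using le[OF r] le[OF signed_measure_uminus[OF r]] by simp
qed

section \<open>Complex measures\<close>

text \<open>The four positive parts are indexed by the direction \<open>\<i> ^ k\<close> in which they are taken.\<close>

definition dirpart :: "('a::topological_space set \<Rightarrow> complex) \<Rightarrow> nat \<Rightarrow> 'a measure" where
  "dirpart \<mu> k = pospart (\<lambda>A. Re (cnj (\<i> ^ k) * \<mu> A))"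

text \<open>The Bochner integral is 0 off the integrable functions, so \<open>cint\<close> is linear
  only on a class that every finite Borel measure integrates.\<close>

definition bborel :: "('a::topological_space \<Rightarrow> complex) set" where
  "bborel = {f \<in> borel_measurable borel. \<exists>B. \<forall>x. norm (f x) \<le> B}"

lemma sum_four: "(\<Sum>k<4. f k) = f 0 + f 1 + f 2 + f (3::nat)"
  by (simp add: numeral_eq_Suc add.assoc)

lemma sets_dirpart [simp, measurable_cong]: "sets (dirpart \<mu> k) = sets borel"
  by (simp add: dirpart_def)

lemma space_dirpart [simp]: "space (dirpart \<mu> k) = UNIV"
  by (simp add: dirpart_def)

lemma cint_dirpart: "cint \<mu> f = (\<Sum>k<4. \<i> ^ k * (\<integral>x. f x \<partial>dirpart \<mu> k))"
  unfolding sum_four by (simp add: cint_def dirpart_def power3_eq_cube algebra_simps)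

lemma complex_measure_sums:
  assumes "complex_measure \<mu>" "\<And>n. F n \<in> sets borel" "disjoint_family F"
  shows "(\<lambda>n. \<mu> (F n)) sums \<mu> (\<Union>n. F n)"
  using assms unfolding complex_measure_def by (metis image_subsetI)

lemma signed_measure_Re:
  assumes "complex_measure \<mu>"
  shows "signed_measure (\<lambda>A. Re (c * \<mu> A))"
  unfolding signed_measure_def
proof (intro conjI allI impI)
  show "Re (c * \<mu> {}) = 0" using assms by (simp add: complex_measure_def)
  fix F :: "nat \<Rightarrow> 'a set" assume "range F \<subseteq> sets borel" "disjoint_family F"
  then show "(\<lambda>n. Re (c * \<mu> (F n))) sums Re (c * \<mu> (\<Union>n. F n))"
    by (intro sums_Re sums_mult complex_measure_sums[OF assms]) auto
qed

lemma finite_measure_dirpart: "complex_measure \<mu> \<Longrightarrow> finite_measure (dirpart \<mu> k)"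
  unfolding dirpart_def by (intro finite_measure_pospart signed_measure_Re)

lemma complex_measure_eq_parts:
  assumes "complex_measure \<mu>" "A \<in> sets borel"
  shows "\<mu> A = (\<Sum>k<4. \<i> ^ k * measure (dirpart \<mu> k) A)"
  unfolding sum_four
  using measure_pospart_diff[OF signed_measure_Re[OF assms(1), of 1] assms(2)]
    measure_pospart_diff[OF signed_measure_Re[OF assms(1), of "- \<i>"] assms(2)]
  by (simp add: dirpart_def power3_eq_cube complex_eq_iff)

lemma norm_le_parts:
  assumes "complex_measure \<mu>" "A \<in> sets borel"
  shows "norm (\<mu> A) \<le> (\<Sum>k<4. measure (dirpart \<mu> k) A)"
proof -
  have "norm (\<mu> A) = norm (\<Sum>k<4. \<i> ^ k * measure (dirpart \<mu> k) A)"
    using complex_measure_eq_parts[OF assms] by simp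
  also have "\<dots> \<le> (\<Sum>k<4. norm (\<i> ^ k * measure (dirpart \<mu> k) A))" by (rule norm_sum)
  finally show ?thesis by (simp add: norm_mult norm_power)
qed

section \<open>Total variation\<close>

lemma tvar_mono: "A \<subseteq> B \<Longrightarrow> tvar \<mu> A \<le> tvar \<mu> B"
  unfolding tvar_def by (intro SUP_subset_mono) auto

text \<open>\<open>tvar\<close> sums over sets of sets, where repetitions collapse. A disjoint
  indexed family repeats only the empty set, which contributes 0.\<close>

lemma tvar_ge_sum:
  assumes "\<mu> {} = 0" "finite I" "disjoint_family_on F I" "\<And>i. i \<in> I \<Longrightarrow> F i \<in> sets borel" "\<And>i. i \<in> I \<Longrightarrow> F i \<subseteq> A"
  shows "ennreal (\<Sum>i\<in>I. norm (\<mu> (F i))) \<le> tvar \<mu> A"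
proof -
  have "(\<Sum>B\<in>F ` I. ennreal (norm (\<mu> B))) = (\<Sum>i\<in>I. ennreal (norm (\<mu> (F i))))"
  proof (rule sum.reindex_nontrivial[OF assms(2), unfolded comp_def])
    fix i j assume "i \<in> I" "j \<in> I" "i \<noteq> j" "F i = F j"
    then have "F i = {}" using assms(3) by (auto simp: disjoint_family_on_def)
    then show "ennreal (norm (\<mu> (F i))) = 0" using assms(1) by simp
  qed
  moreover have "(\<Sum>B\<in>F ` I. ennreal (norm (\<mu> B))) \<le> tvar \<mu> A"
    unfolding tvar_def using assms(2-5)
    by (intro SUP_upper) (auto simp: disjoint_family_on_disjoint_image)
  ultimately show ?thesis by (simp add: sum_ennreal)
qed

lemma norm_le_tvar:
  assumes "\<mu> {} = 0" "B \<in> sets borel" "B \<subseteq> A"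
  shows "ennreal (norm (\<mu> B)) \<le> tvar \<mu> A"
  using tvar_ge_sum[of \<mu> "{()}" "\<lambda>_. B" A] assms by (simp add: disjoint_family_on_def)

text \<open>Partitions of \<open>A\<close> and of \<open>B\<close> combine to one of the union; the
  only set they can share is empty.\<close>

lemma tvar_superadditive:
  fixes A B :: "'a::topological_space set"
  assumes "\<mu> {} = 0" "A \<inter> B = {}"
  shows "tvar \<mu> A + tvar \<mu> B \<le> tvar \<mu> (A \<union> B)"
  unfolding tvar_def[of _ A] tvar_def[of _ B]
proof (rule SUP_add_SUP_le)
  let ?S = "\<lambda>A. {P. finite P \<and> disjoint P \<and> P \<subseteq> sets borel \<and> \<Union>P \<subseteq> A}"
  show "?S A \<noteq> {}" "?S B \<noteq> {}" by (auto intro!: exI[of _ "{}"])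
  fix P Q assume P: "P \<in> ?S A" and Q: "Q \<in> ?S B"
  have "disjoint (P \<union> Q)"
  proof (rule disjointI)
    fix C D assume "C \<in> P \<union> Q" "D \<in> P \<union> Q" "C \<noteq> D"
    moreover have "X \<subseteq> A" if "X \<in> P" for X using P that by auto
    moreover have "X \<subseteq> B" if "X \<in> Q" for X using Q that by auto
    moreover have "disjoint P" "disjoint Q" using P Q by auto
    ultimately consider "C \<subseteq> A" "D \<subseteq> B" | "C \<subseteq> B" "D \<subseteq> A" | "C \<inter> D = {}"
      by (elim UnE) (auto dest: disjointD)
    then show "C \<inter> D = {}" using assms(2) by cases auto
  qed
  have "(\<Sum>C\<in>P \<inter> Q. ennreal (norm (\<mu> C))) = 0"
  proof (rule sum.neutral, rule ballI)
    fix C assume "C \<in> P \<inter> Q"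
    then have "C \<subseteq> A" "C \<subseteq> B" using P Q by auto
    then have "C = {}" using assms(2) by auto
    then show "ennreal (norm (\<mu> C)) = 0" using assms(1) by simp
  qed
  then have "(\<Sum>C\<in>P. ennreal (norm (\<mu> C))) + (\<Sum>C\<in>Q. ennreal (norm (\<mu> C))) = (\<Sum>C\<in>P \<union> Q. ennreal (norm (\<mu> C)))"
    using P Q sum.union_inter[of P Q "\<lambda>C. ennreal (norm (\<mu> C))"] by simp
  also have "\<dots> \<le> tvar \<mu> (A \<union> B)"
    unfolding tvar_def using P Q \<open>disjoint (P \<union> Q)\<close> by (intro SUP_upper) auto
  finally show "(\<Sum>C\<in>P. ennreal (norm (\<mu> C))) + (\<Sum>C\<in>Q. ennreal (norm (\<mu> C))) \<le> tvar \<mu> (A \<union> B)" .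
qed

lemma tvar_le_dominating:
  fixes N :: "'i \<Rightarrow> 'a::topological_space measure"
  assumes I: "finite I" and N: "\<And>i. i \<in> I \<Longrightarrow> finite_measure (N i)" "\<And>i. i \<in> I \<Longrightarrow> sets (N i) = sets borel"
    and c: "\<And>i. i \<in> I \<Longrightarrow> 0 \<le> c i"
    and dom: "\<And>A. A \<in> sets borel \<Longrightarrow> norm (\<mu> A) \<le> (\<Sum>i\<in>I. c i * measure (N i) A)"
    and A: "A \<in> sets borel"
  shows "tvar \<mu> A \<le> ennreal (\<Sum>i\<in>I. c i * measure (N i) A)"
  unfolding tvar_def
proof (rule SUP_least)
  fix P assume "P \<in> {P. finite P \<and> disjoint P \<and> P \<subseteq> sets borel \<and> \<Union>P \<subseteq> A}"
  then have P: "finite P" "disjoint P" "P \<subseteq> sets borel" "\<Union>P \<subseteq> A" by auto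
  have "(\<Sum>B\<in>P. norm (\<mu> B)) \<le> (\<Sum>B\<in>P. \<Sum>i\<in>I. c i * measure (N i) B)"
    using P by (intro sum_mono dom) auto
  also have "\<dots> = (\<Sum>i\<in>I. c i * (\<Sum>B\<in>P. measure (N i) B))"
    by (subst sum.swap) (simp add: sum_distrib_left)
  also have "\<dots> \<le> (\<Sum>i\<in>I. c i * measure (N i) A)"
  proof (intro sum_mono mult_left_mono c)
    fix i assume i: "i \<in> I"
    interpret finite_measure "N i" by (rule N(1)[OF i])
    have "(\<Sum>B\<in>P. measure (N i) B) = measure (N i) (\<Union>B\<in>P. B)"
      using P N(2)[OF i] by (intro finite_measure_finite_Union[symmetric])
        (auto simp: disjoint_family_on_def disjoint_def)
    also have "\<dots> \<le> measure (N i) A"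
      using P A N(2)[OF i] by (intro finite_measure_mono) auto
    finally show "(\<Sum>B\<in>P. measure (N i) B) \<le> measure (N i) A" .
  qed
  finally show "(\<Sum>B\<in>P. ennreal (norm (\<mu> B))) \<le> ennreal (\<Sum>i\<in>I. c i * measure (N i) A)"
    by (simp add: sum_ennreal ennreal_leI)
qed

lemma tvar_finite:
  assumes "complex_measure \<mu>"
  shows "tvar \<mu> A < \<infinity>"
proof -
  have "tvar \<mu> UNIV \<le> ennreal (\<Sum>k<4. 1 * measure (dirpart \<mu> k) UNIV)"
    using norm_le_parts[OF assms] by (intro tvar_le_dominating finite_measure_dirpart[OF assms]) auto
  then show ?thesis using tvar_mono[of A UNIV \<mu>]
    by (metis ennreal_less_top infinity_ennreal_def order_le_less_trans subset_UNIV)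
qed

lemma MK_complex_measure: "\<mu> \<in> MK \<Longrightarrow> complex_measure \<mu>"
  by (simp add: MK_def)

lemma complex_measure_empty: "complex_measure \<mu> \<Longrightarrow> \<mu> {} = 0"
  by (simp add: complex_measure_def)

lemma measure_part_le_tvar:
  assumes "complex_measure \<mu>" "A \<in> sets borel"
  shows "measure (dirpart \<mu> k) A \<le> enn2real (tvar \<mu> A)"
  unfolding dirpart_def
proof (rule measure_pospart_le[OF signed_measure_Re[OF assms(1)] assms(2)])
  fix B assume B: "B \<in> sets borel" "B \<subseteq> A"
  have "Re (cnj (\<i> ^ k) * \<mu> B) \<le> norm (cnj (\<i> ^ k) * \<mu> B)" by (rule complex_Re_le_cmod)
  also have "\<dots> = norm (\<mu> B)" by (simp add: norm_mult norm_power)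
  also have "\<dots> \<le> enn2real (tvar \<mu> A)"
    using norm_le_tvar[of \<mu> B A, OF complex_measure_empty[OF assms(1)] B] tvar_finite[OF assms(1), of A]
    by (metis enn2real_ennreal enn2real_mono infinity_ennreal_def norm_ge_zero)
  finally show "Re (cnj (\<i> ^ k) * \<mu> B) \<le> enn2real (tvar \<mu> A)" .
qed simp

text \<open>A compact \<open>C\<close> whose variation almost reaches that of \<open>A\<close>
  leaves little variation on \<open>A - C\<close> by superadditivity, and the variation dominates
  each of the four parts.\<close>

lemma radon_finite_dirpart:
  fixes \<mu> :: "'a::t2_space set \<Rightarrow> complex"
  assumes \<mu>: "\<mu> \<in> MK"
  shows "radon_finite (dirpart \<mu> k)"
  unfolding radon_finite_def
proof (intro conjI ballI allI impI sets_dirpart finite_measure_dirpart MK_complex_measure[OF \<mu>])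
  fix A :: "'a set" and \<epsilon> :: real assume A: "A \<in> sets borel" and "0 < \<epsilon>"
  have cm: "complex_measure \<mu>" using \<mu> by (rule MK_complex_measure)
  have fin: "tvar \<mu> B < \<infinity>" for B by (rule tvar_finite[OF cm])
  have "\<exists>C. compact C \<and> C \<subseteq> A \<and> tvar \<mu> A < tvar \<mu> C + ennreal \<epsilon>"
  \<comment> \<open>Subtraction in \<open>ennreal\<close> truncates at 0, so
    \<open>tvar \<mu> A - \<epsilon> < tvar \<mu> A\<close> requires a positive variation.\<close>
  proof (cases "tvar \<mu> A = 0")
    case True
    then show ?thesis using \<open>0 < \<epsilon>\<close> by (intro exI[of _ "{}"]) (auto simp: add_nonneg_pos)
  next
    case False
    have "tvar \<mu> A - ennreal \<epsilon> < tvar \<mu> A"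
      using False fin[of A] \<open>0 < \<epsilon>\<close> by (intro ennreal_between) (auto simp: zero_less_iff_neq_zero)
    also have "tvar \<mu> A = (SUP C\<in>{C. compact C \<and> C \<subseteq> A}. tvar \<mu> C)"
      using \<mu> A by (simp add: MK_def)
    finally obtain C where C: "compact C" "C \<subseteq> A" "tvar \<mu> A - ennreal \<epsilon> < tvar \<mu> C"
      by (auto simp: less_SUP_iff)
    have "tvar \<mu> A < tvar \<mu> C + ennreal \<epsilon>"
    proof -
      obtain a b where ab: "tvar \<mu> A = ennreal a" "0 \<le> a" "tvar \<mu> C = ennreal b" "0 \<le> b"
        using fin[of A] fin[of C] by (auto simp: less_top_ennreal)
      then have "ennreal (a - \<epsilon>) < ennreal b" using C(3) \<open>0 < \<epsilon>\<close> by (simp add: ennreal_minus)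
      then have "a - \<epsilon> < b" using ennreal_leI[of b "a - \<epsilon>"] by (cases "a - \<epsilon> < b") auto
      then show ?thesis using ab \<open>0 < \<epsilon>\<close> by (simp add: ennreal_plus[symmetric] ennreal_less_iff del: ennreal_plus)
    qed
    with C show ?thesis by blast
  qed
  then obtain C where C: "compact C" "C \<subseteq> A" "tvar \<mu> A < tvar \<mu> C + ennreal \<epsilon>" by blast
  have "tvar \<mu> C + tvar \<mu> (A - C) \<le> tvar \<mu> A"
    using tvar_superadditive[of \<mu> C "A - C", OF complex_measure_empty[OF cm]] C(2) by (simp add: Un_absorb1)
  then have "tvar \<mu> C + tvar \<mu> (A - C) < tvar \<mu> C + ennreal \<epsilon>" using C(3) by (rule le_less_trans)
  then have "tvar \<mu> (A - C) < ennreal \<epsilon>" by (metis add_left_mono leD leI)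
  then have "enn2real (tvar \<mu> (A - C)) < \<epsilon>"
    using \<open>0 < \<epsilon>\<close> fin[of "A - C"] by (auto simp: less_top_ennreal ennreal_less_iff)
  moreover have "measure (dirpart \<mu> k) (A - C) \<le> enn2real (tvar \<mu> (A - C))"
    using A compact_borel[OF C(1)] by (intro measure_part_le_tvar[OF cm]) auto
  ultimately show "\<exists>C. compact C \<and> C \<subseteq> A \<and> measure (dirpart \<mu> k) (A - C) < \<epsilon>"
    using C by (intro exI[of _ C]) auto
qed

section \<open>Membership in the space of Radon measures\<close>

lemma radon_finite_common_compact:
  fixes N :: "'i \<Rightarrow> 'a::t2_space measure"
  assumes "finite I" "\<And>i. i \<in> I \<Longrightarrow> radon_finite (N i)" "A \<in> sets borel" "0 < \<epsilon>"
  shows "\<exists>C. compact C \<and> C \<subseteq> A \<and> (\<forall>i\<in>I. measure (N i) (A - C) < \<epsilon>)"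
proof -
  have "\<exists>C. compact C \<and> C \<subseteq> A \<and> measure (N i) (A - C) < \<epsilon>" if "i \<in> I" for i
    using assms(2)[OF that] assms(3,4) by (simp add: radon_finite_def)
  then obtain C where C: "\<And>i. i \<in> I \<Longrightarrow> compact (C i) \<and> C i \<subseteq> A \<and> measure (N i) (A - C i) < \<epsilon>" by metis
  show ?thesis
  proof (intro exI[of _ "\<Union>i\<in>I. C i"] conjI ballI)
    show "compact (\<Union>i\<in>I. C i)" using C assms(1) by (intro compact_UN) auto
    show "(\<Union>i\<in>I. C i) \<subseteq> A" using C by (intro UN_least) auto
    fix i assume i: "i \<in> I"
    then have "finite_measure (N i)" and s: "sets (N i) = sets borel"
      using assms(2) by (auto simp: radon_finite_def)
    then interpret finite_measure "N i" by simp
    have "measure (N i) (A - (\<Union>i\<in>I. C i)) \<le> measure (N i) (A - C i)"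
      using i C compact_borel assms(3) s by (intro finite_measure_mono) auto
    then show "measure (N i) (A - (\<Union>i\<in>I. C i)) < \<epsilon>" using C[OF i] by simp
  qed
qed

lemma complex_measure_Un:
  assumes \<mu>: "complex_measure \<mu>" and "A \<in> sets borel" "B \<in> sets borel" "A \<inter> B = {}"
  shows "\<mu> (A \<union> B) = \<mu> A + \<mu> B"
  using signed_measure_Un[OF signed_measure_Re[OF \<mu>, of 1] assms(2-4)]
    signed_measure_Un[OF signed_measure_Re[OF \<mu>, of "-\<i>"] assms(2-4)]
  by (simp add: complex_eq_iff)

text \<open>The converse of \<open>radon_finite_dirpart\<close>: domination by Radon measures
  suffices, since every piece of a finite partition can be replaced by a compact subset at small
  cost and the union of these is compact.\<close>

lemma MK_I:
  fixes N :: "'i \<Rightarrow> 'a::t2_space measure"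
  assumes \<mu>: "complex_measure \<mu>" and I: "finite I" and N: "\<And>i. i \<in> I \<Longrightarrow> radon_finite (N i)"
    and c: "\<And>i. i \<in> I \<Longrightarrow> 0 \<le> c i"
    and dom: "\<And>A. A \<in> sets borel \<Longrightarrow> norm (\<mu> A) \<le> (\<Sum>i\<in>I. c i * measure (N i) A)"
  shows "\<mu> \<in> MK"
  unfolding MK_def
proof (intro CollectI conjI ballI \<mu>)
  fix A :: "'a set" assume A: "A \<in> sets borel"
  show "tvar \<mu> A = (SUP C\<in>{C. compact C \<and> C \<subseteq> A}. tvar \<mu> C)"
  proof (rule antisym)
    show "(SUP C\<in>{C. compact C \<and> C \<subseteq> A}. tvar \<mu> C) \<le> tvar \<mu> A"
      by (intro SUP_least) (auto intro: tvar_mono)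
    show "tvar \<mu> A \<le> (SUP C\<in>{C. compact C \<and> C \<subseteq> A}. tvar \<mu> C)"
    proof (subst tvar_def, rule SUP_least)
      fix P assume "P \<in> {P. finite P \<and> disjoint P \<and> P \<subseteq> sets borel \<and> \<Union>P \<subseteq> A}"
      then have P: "finite P" "disjoint P" "P \<subseteq> sets borel" "\<Union>P \<subseteq> A" by auto
      show "(\<Sum>B\<in>P. ennreal (norm (\<mu> B))) \<le> (SUP C\<in>{C. compact C \<and> C \<subseteq> A}. tvar \<mu> C)"
      proof (rule ennreal_le_epsilon)
        fix \<epsilon> :: real assume "0 < \<epsilon>"
        define s where "s = (\<Sum>i\<in>I. c i)"
        have s0: "0 \<le> s" unfolding s_def by (rule sum_nonneg[OF c])
        \<comment> \<open>Each of the \<open>card P\<close> pieces loses at most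
          \<open>s * \<delta>\<close>; the added ones keep the denominator positive.\<close>
        define \<delta> where "\<delta> = \<epsilon> / ((s + 1) * (card P + 1))"
        have "0 < \<delta>" using \<open>0 < \<epsilon>\<close> s0 unfolding \<delta>_def by (intro divide_pos_pos mult_pos_pos) auto
        have "\<exists>C. compact C \<and> C \<subseteq> B \<and> (\<forall>i\<in>I. measure (N i) (B - C) < \<delta>)" if "B \<in> P" for B
          using that P(3) by (intro radon_finite_common_compact[OF I N _ \<open>0 < \<delta>\<close>]) auto
        then obtain C where C: "\<And>B. B \<in> P \<Longrightarrow> compact (C B) \<and> C B \<subseteq> B \<and> (\<forall>i\<in>I. measure (N i) (B - C B) < \<delta>)"
          by metis
        have Cb: "C B \<in> sets borel" if "B \<in> P" for B using C[OF that] compact_borel by auto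
        have le: "norm (\<mu> B) \<le> norm (\<mu> (C B)) + s * \<delta>" if B: "B \<in> P" for B
        proof -
          have Bb: "B \<in> sets borel" using B P(3) by auto
          have "\<mu> (C B \<union> (B - C B)) = \<mu> (C B) + \<mu> (B - C B)"
            using Cb[OF B] Bb by (intro complex_measure_Un[OF \<mu>]) auto
          moreover have "C B \<union> (B - C B) = B" using C[OF B] by auto
          moreover have "norm (\<mu> (B - C B)) \<le> (\<Sum>i\<in>I. c i * measure (N i) (B - C B))"
            using Cb[OF B] Bb by (intro dom) auto
          moreover have "\<dots> \<le> (\<Sum>i\<in>I. c i * \<delta>)"
            using C[OF B] by (intro sum_mono mult_left_mono c) (auto intro: less_imp_le)
          ultimately show ?thesis unfolding s_def sum_distrib_right
            using norm_triangle_ineq[of "\<mu> (C B)" "\<mu> (B - C B)"] by simp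
        qed
        have "(\<Sum>B\<in>P. norm (\<mu> B)) \<le> (\<Sum>B\<in>P. norm (\<mu> (C B)) + s * \<delta>)"
          by (rule sum_mono[OF le])
        also have "\<dots> = (\<Sum>B\<in>P. norm (\<mu> (C B))) + card P * (s * \<delta>)" by (simp add: sum.distrib)
        also have "card P * (s * \<delta>) \<le> (card P + 1) * ((s + 1) * \<delta>)"
          using s0 \<open>0 < \<delta>\<close> by (intro mult_mono) auto
        also have "(card P + 1) * ((s + 1) * \<delta>) = \<epsilon>"
        proof -
          have "(s + 1) * (real (card P) + 1) \<noteq> 0" using s0 by auto
          moreover have "real (card P + 1) * ((s + 1) * \<delta>) = (s + 1) * (real (card P) + 1) * \<delta>" by simp
          ultimately show ?thesis unfolding \<delta>_def by simp
        qed
        finally have "(\<Sum>B\<in>P. ennreal (norm (\<mu> B))) \<le> ennreal ((\<Sum>B\<in>P. norm (\<mu> (C B))) + \<epsilon>)"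
          by (simp add: sum_ennreal ennreal_leI)
        also have "\<dots> = ennreal (\<Sum>B\<in>P. norm (\<mu> (C B))) + ennreal \<epsilon>"
          using \<open>0 < \<epsilon>\<close> by (intro ennreal_plus sum_nonneg) auto
        also have "ennreal (\<Sum>B\<in>P. norm (\<mu> (C B))) \<le> tvar \<mu> (\<Union>B\<in>P. C B)"
        proof (rule tvar_ge_sum[of \<mu> P C, OF complex_measure_empty[OF \<mu>] P(1)])
          show "disjoint_family_on C P"
            unfolding disjoint_family_on_def
          proof (intro ballI impI)
            fix X Y assume "X \<in> P" "Y \<in> P" "X \<noteq> Y"
            then show "C X \<inter> C Y = {}" using C[of X] C[of Y] disjointD[OF P(2), of X Y] by auto
          qed
        qed (use Cb in auto)
        also have "tvar \<mu> (\<Union>B\<in>P. C B) \<le> (SUP C\<in>{C. compact C \<and> C \<subseteq> A}. tvar \<mu> C)"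
        proof (intro SUP_upper CollectI conjI compact_UN P(1))
          show "(\<Union>B\<in>P. C B) \<subseteq> A" using C P(4) by fastforce
        qed (use C in auto)
        finally show "(\<Sum>B\<in>P. ennreal (norm (\<mu> B))) \<le> (SUP C\<in>{C. compact C \<and> C \<subseteq> A}. tvar \<mu> C) + ennreal \<epsilon>"
          by (simp add: add_mono)
      qed
    qed
  qed
qed

lemma complex_measure_combination:
  fixes N :: "'i \<Rightarrow> 'a::t2_space measure" and c :: "'i \<Rightarrow> complex"
  assumes I: "finite I" and N: "\<And>i. i \<in> I \<Longrightarrow> finite_measure (N i)" "\<And>i. i \<in> I \<Longrightarrow> sets (N i) = sets borel"
  shows "complex_measure (\<lambda>A. \<Sum>i\<in>I. c i * measure (N i) A)"
  unfolding complex_measure_def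
proof (intro conjI allI impI)
  show "(\<Sum>i\<in>I. c i * complex_of_real (measure (N i) A)) = 0" if "A \<notin> sets borel" for A
    using that N(2) by (intro sum.neutral) (auto simp: measure_notin_sets)
  fix F :: "nat \<Rightarrow> 'a set" assume F: "range F \<subseteq> sets borel" "disjoint_family F"
  show "(\<lambda>n. \<Sum>i\<in>I. c i * complex_of_real (measure (N i) (F n))) sums
     (\<Sum>i\<in>I. c i * complex_of_real (measure (N i) (\<Union>n. F n)))"
  proof (intro sums_sum sums_mult sums_of_real)
    fix i assume i: "i \<in> I"
    interpret finite_measure "N i" by (rule N(1)[OF i])
    show "(\<lambda>n. measure (N i) (F n)) sums measure (N i) (\<Union>n. F n)"
      using F N(2)[OF i] by (intro finite_measure_UNION) auto
  qed
qed simp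

lemma MK_combination:
  fixes N :: "'i \<Rightarrow> 'a::t2_space measure" and c :: "'i \<Rightarrow> complex"
  assumes I: "finite I" and N: "\<And>i. i \<in> I \<Longrightarrow> radon_finite (N i)"
  shows "(\<lambda>A. \<Sum>i\<in>I. c i * measure (N i) A) \<in> MK"
proof (rule MK_I[OF _ I N])
  show "complex_measure (\<lambda>A. \<Sum>i\<in>I. c i * measure (N i) A)"
    using N by (intro complex_measure_combination[OF I]) (auto simp: radon_finite_def)
  fix A :: "'a set"
  show "norm (\<Sum>i\<in>I. c i * complex_of_real (measure (N i) A)) \<le> (\<Sum>i\<in>I. norm (c i) * measure (N i) A)"
    by (rule order_trans[OF norm_sum]) (simp add: norm_mult)
qed auto

lemma complex_measure_outside: "complex_measure \<mu> \<Longrightarrow> A \<notin> sets borel \<Longrightarrow> \<mu> A = 0"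
  by (simp add: complex_measure_def)

lemma MK_linear:
  fixes \<mu> \<nu> :: "'a::t2_space set \<Rightarrow> complex"
  assumes "\<mu> \<in> MK" "\<nu> \<in> MK"
  shows "(\<lambda>A. a * \<mu> A + b * \<nu> A) \<in> MK"
proof -
  note cm = MK_complex_measure[OF assms(1)] MK_complex_measure[OF assms(2)]
  \<comment> \<open>The parts of a linear combination are not combinations of the parts, so all
    eight parts enter as one family indexed by a disjoint sum.\<close>
  let ?I = "{..<4::nat} <+> {..<4::nat}"
  let ?c = "case_sum (\<lambda>k. a * \<i> ^ k) (\<lambda>k. b * \<i> ^ k)"
  let ?N = "case_sum (dirpart \<mu>) (dirpart \<nu>)"
  have "(\<lambda>A. \<Sum>i\<in>?I. ?c i * measure (?N i) A) \<in> MK"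
    by (rule MK_combination) (auto intro: radon_finite_dirpart[OF assms(1)] radon_finite_dirpart[OF assms(2)])
  moreover have "(\<Sum>i\<in>?I. ?c i * measure (?N i) A) = a * \<mu> A + b * \<nu> A" for A
  proof (cases "A \<in> sets borel")
    case True
    then show ?thesis
      by (simp add: sum.Plus complex_measure_eq_parts[OF cm(1)] complex_measure_eq_parts[OF cm(2)]
        sum_distrib_left mult.assoc)
  next
    case False
    then show ?thesis
      by (simp add: sum.Plus measure_notin_sets complex_measure_outside[OF cm(1)] complex_measure_outside[OF cm(2)])
  qed
  ultimately show ?thesis by simp
qed

section \<open>Integration against complex measures\<close>

lemma bborelI: "f \<in> borel_measurable borel \<Longrightarrow> (\<And>x. norm (f x) \<le> B) \<Longrightarrow> f \<in> bborel"
  by (auto simp: bborel_def)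

lemma bborel_of_real:
  "f \<in> borel_measurable borel \<Longrightarrow> (\<And>x. \<bar>f x\<bar> \<le> B) \<Longrightarrow> (\<lambda>x. complex_of_real (f x)) \<in> bborel"
  by (intro bborelI[where B=B]) auto

lemma bborel_mult: "f \<in> bborel \<Longrightarrow> (\<lambda>x. c * f x) \<in> bborel"
proof -
  assume f: "f \<in> bborel"
  then obtain B where "\<And>x. norm (f x) \<le> B" by (auto simp: bborel_def)
  then have "norm (c * f x) \<le> norm c * B" for x by (simp add: norm_mult mult_left_mono)
  then show "(\<lambda>x. c * f x) \<in> bborel"
    using f by (intro bborelI[where B="norm c * B"]) (auto simp: bborel_def)
qed

lemma bborel_add:
  assumes "f \<in> bborel" "g \<in> bborel"
  shows "(\<lambda>x. f x + g x) \<in> bborel"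
proof -
  obtain B C where "\<And>x. norm (f x) \<le> B" "\<And>x. norm (g x) \<le> C" using assms by (auto simp: bborel_def)
  then have "norm (f x + g x) \<le> B + C" for x by (meson add_mono norm_triangle_ineq order_trans)
  then show ?thesis using assms by (intro bborelI[where B="B + C"]) (auto simp: bborel_def)
qed

lemma bborel_diff: "f \<in> bborel \<Longrightarrow> g \<in> bborel \<Longrightarrow> (\<lambda>x. f x - g x) \<in> bborel"
proof -
  assume f: "f \<in> bborel" and "g \<in> bborel"
  then have "(\<lambda>x. f x + (-1) * g x) \<in> bborel" by (intro bborel_add[OF f] bborel_mult)
  then show ?thesis by simp
qed

lemma bborel_zero: "(\<lambda>x. 0) \<in> bborel"
  by (auto simp: bborel_def)

lemma bborel_sum: "(\<And>i. i \<in> I \<Longrightarrow> f i \<in> bborel) \<Longrightarrow> (\<lambda>x. \<Sum>i\<in>I. f i x) \<in> bborel"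
proof (induction I rule: infinite_finite_induct)
  case (insert i I)
  have "(\<lambda>x. f i x + (\<Sum>i\<in>I. f i x)) \<in> bborel" using insert by (intro bborel_add) auto
  then show ?case using insert by simp
qed (simp_all add: bborel_zero)

context
  fixes \<mu> :: "'a::topological_space set \<Rightarrow> complex"
  assumes \<mu>: "complex_measure \<mu>"
begin

lemma integrable_dirpart: "f \<in> bborel \<Longrightarrow> integrable (dirpart \<mu> k) f"
  using integrable_bounded_borel[OF finite_measure_dirpart[OF \<mu>] sets_dirpart, of f] unfolding bborel_def by blast

lemma cint_add: "f \<in> bborel \<Longrightarrow> g \<in> bborel \<Longrightarrow> cint \<mu> (\<lambda>x. f x + g x) = cint \<mu> f + cint \<mu> g"
  by (simp only: cint_dirpart integrable_dirpart Bochner_Integration.integral_add sum.distrib distrib_left)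

lemma cint_mult: "f \<in> bborel \<Longrightarrow> cint \<mu> (\<lambda>x. c * f x) = c * cint \<mu> f"
  by (simp add: cint_dirpart sum_distrib_left algebra_simps)

lemma cint_diff: "f \<in> bborel \<Longrightarrow> g \<in> bborel \<Longrightarrow> cint \<mu> (\<lambda>x. f x - g x) = cint \<mu> f - cint \<mu> g"
  by (simp only: cint_dirpart integrable_dirpart Bochner_Integration.integral_diff sum_subtractf right_diff_distrib)

lemma cint_zero: "cint \<mu> (\<lambda>x. 0) = 0"
  by (simp add: cint_dirpart)

lemma cint_sum: "(\<And>i. i \<in> I \<Longrightarrow> f i \<in> bborel) \<Longrightarrow> cint \<mu> (\<lambda>x. \<Sum>i\<in>I. f i x) = (\<Sum>i\<in>I. cint \<mu> (f i))"
proof (induction I rule: infinite_finite_induct)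
  case (insert i I)
  have "cint \<mu> (\<lambda>x. f i x + (\<Sum>i\<in>I. f i x)) = cint \<mu> (f i) + cint \<mu> (\<lambda>x. \<Sum>i\<in>I. f i x)"
    using insert by (intro cint_add bborel_sum) auto
  then show ?case using insert by simp
qed (simp_all add: cint_zero)

lemma cint_indicator: "A \<in> sets borel \<Longrightarrow> cint \<mu> (\<lambda>x. of_real (indicator A x)) = \<mu> A"
  by (simp add: cint_dirpart complex_measure_eq_parts[OF \<mu>])

lemma norm_cint_le_parts:
  assumes "f \<in> bborel"
  shows "norm (cint \<mu> f) \<le> (\<Sum>k<4. \<integral>x. norm (f x) \<partial>dirpart \<mu> k)"
proof -
  have "norm (cint \<mu> f) \<le> (\<Sum>k<4. norm (\<i> ^ k * (\<integral>x. f x \<partial>dirpart \<mu> k)))"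
    unfolding cint_dirpart by (rule norm_sum)
  also have "\<dots> \<le> (\<Sum>k<4. \<integral>x. norm (f x) \<partial>dirpart \<mu> k)"
    by (intro sum_mono) (auto simp: norm_mult norm_power)
  finally show ?thesis .
qed

text \<open>The level sets of a simple function form a partition, which the variation controls
  directly. Estimating the four parts separately could lose a factor, whereas a contraction needs
  the constant 1.\<close>

lemma norm_cint_le_simple:
  assumes f: "simple_function borel f" and B: "\<And>x. norm (f x) \<le> B"
  shows "norm (cint \<mu> f) \<le> B * enn2real (mnorm \<mu>)"
proof -
  have fin: "finite (range f)" and ms: "f -` {v} \<in> sets borel" for v
    using f by (auto simp: simple_function_def) (metis simple_functionD(2) f Int_UNIV_right space_borel)
  have "0 \<le> B" using B[of undefined] norm_ge_zero order_trans by blast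
  have fx: "f = (\<lambda>x. \<Sum>v\<in>range f. v * of_real (indicator (f -` {v}) x))"
  proof
    fix x
    have "(\<Sum>v\<in>range f. v * of_real (indicator (f -` {v}) x)) = (\<Sum>v\<in>range f. if v = f x then v else 0)"
      by (intro sum.cong) (auto simp: indicator_def)
    then show "f x = (\<Sum>v\<in>range f. v * of_real (indicator (f -` {v}) x))" using fin by simp
  qed
  have bi: "(\<lambda>x. complex_of_real (indicator (f -` {v}) x)) \<in> bborel" for v
    using ms[of v] by (intro bborel_of_real[where B=1] borel_measurable_indicator) (auto split: split_indicator)
  have "cint \<mu> f = (\<Sum>v\<in>range f. v * \<mu> (f -` {v}))"
    by (subst fx) (simp add: cint_sum cint_mult bborel_mult bi cint_indicator ms)
  also have "norm \<dots> \<le> (\<Sum>v\<in>range f. norm (v * \<mu> (f -` {v})))" by (rule norm_sum)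
  also have "\<dots> \<le> (\<Sum>v\<in>range f. B * norm (\<mu> (f -` {v})))"
    using B by (intro sum_mono) (auto simp: norm_mult intro!: mult_right_mono)
  also have "\<dots> = B * (\<Sum>v\<in>range f. norm (\<mu> (f -` {v})))" by (simp add: sum_distrib_left)
  also have "(\<Sum>v\<in>range f. norm (\<mu> (f -` {v}))) \<le> enn2real (mnorm \<mu>)"
  proof -
    have "ennreal (\<Sum>v\<in>range f. norm (\<mu> (f -` {v}))) \<le> mnorm \<mu>"
      unfolding mnorm_def using ms
      by (intro tvar_ge_sum complex_measure_empty[OF \<mu>] fin) (auto simp: disjoint_family_on_def)
    then have "enn2real (ennreal (\<Sum>v\<in>range f. norm (\<mu> (f -` {v})))) \<le> enn2real (mnorm \<mu>)"
      using tvar_finite[OF \<mu>, of UNIV] by (intro enn2real_mono) (auto simp: mnorm_def)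
    then show ?thesis by (simp add: sum_nonneg)
  qed
  finally show ?thesis using \<open>0 \<le> B\<close> by (simp add: mult_left_mono)
qed

text \<open>Projecting simple approximations of \<open>f\<close> onto the ball of radius \<open>B\<close> keeps the optimal constant.\<close>

lemma norm_cint_le:
  assumes f: "f \<in> borel_measurable borel" and B: "\<And>x. norm (f x) \<le> B"
  shows "norm (cint \<mu> f) \<le> B * enn2real (mnorm \<mu>)"
proof -
  obtain F where F: "\<And>i. simple_function borel (F i)" "\<And>x. (\<lambda>i. F i x) \<longlonglongrightarrow> f x"
    using borel_measurable_implies_sequence_metric[OF f, of 0] by auto
  have "0 \<le> B" using B[of undefined] norm_ge_zero order_trans by blast
  then have ne: "cball (0::complex) B \<noteq> {}" by auto
  define G where "G i x = closest_point (cball 0 B) (F i x)" for i x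
  have sG: "simple_function borel (G i)" for i
    unfolding G_def[abs_def] by (rule simple_function_compose1[OF F(1)])
  have bG: "norm (G i x) \<le> B" for i x
    using closest_point_in_set[OF closed_cball ne, of "F i x"] by (simp add: G_def)
  have "(\<lambda>i. G i x) \<longlonglongrightarrow> closest_point (cball 0 B) (f x)" for x
    unfolding G_def by (intro isCont_tendsto_compose[OF _ F(2)] continuous_at_closest_point ne) auto
  moreover have "closest_point (cball 0 B) (f x) = f x" for x
    using B[of x] by (intro closest_point_self) simp
  ultimately have lG: "(\<lambda>i. G i x) \<longlonglongrightarrow> f x" for x by metis
  have "(\<lambda>i. cint \<mu> (G i)) \<longlonglongrightarrow> cint \<mu> f"
    unfolding cint_dirpart
  proof (intro tendsto_sum tendsto_mult_left)
    fix k
    interpret finite_measure "dirpart \<mu> k" by (rule finite_measure_dirpart[OF \<mu>])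
    show "(\<lambda>i. \<integral>x. G i x \<partial>dirpart \<mu> k) \<longlonglongrightarrow> (\<integral>x. f x \<partial>dirpart \<mu> k)"
    proof (rule integral_dominated_convergence[where w="\<lambda>_. B"])
      show "G i \<in> borel_measurable (dirpart \<mu> k)" for i
        using borel_measurable_simple_function[OF sG] by (simp cong: measurable_cong_sets)
      show "f \<in> borel_measurable (dirpart \<mu> k)" using f by (simp cong: measurable_cong_sets)
    qed (use lG bG in auto)
  qed
  then have "(\<lambda>i. norm (cint \<mu> (G i))) \<longlonglongrightarrow> norm (cint \<mu> f)" by (rule tendsto_norm)
  then show ?thesis
    using norm_cint_le_simple[OF sG bG] by (intro LIMSEQ_le_const2) auto
qed

end

section \<open>Linearity of integration in the measure\<close>

lemma layer_sum_tendsto: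
  fixes f :: "'a::topological_space \<Rightarrow> real"
  assumes M: "finite_measure M" "sets M = sets borel" and f: "f \<in> borel_measurable borel"
    and r: "\<And>x. 0 \<le> f x" "\<And>x. f x \<le> 1"
  shows "(\<lambda>n. (\<Sum>k=1..n. measure M {x. real k / real n < f x}) / n) \<longlonglongrightarrow> (\<integral>x. f x \<partial>M)"
proof (rule tendsto_sandwich)
  have "(\<lambda>n. (\<integral>x. f x \<partial>M) - measure M UNIV / n) \<longlonglongrightarrow> (\<integral>x. f x \<partial>M) - 0"
    by (intro tendsto_diff tendsto_const lim_const_over_n)
  then show "(\<lambda>n. (\<integral>x. f x \<partial>M) - measure M UNIV / n) \<longlonglongrightarrow> (\<integral>x. f x \<partial>M)" by simp
  show "\<forall>\<^sub>F n in sequentially. (\<integral>x. f x \<partial>M) - measure M UNIV / n \<le> (\<Sum>k=1..n. measure M {x. real k / real n < f x}) / n"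
    using eventually_gt_at_top[of 0]
    by eventually_elim (use integral_layer_bounds(2)[OF M f r] in \<open>simp add: algebra_simps\<close>)
  show "\<forall>\<^sub>F n in sequentially. (\<Sum>k=1..n. measure M {x. real k / real n < f x}) / n \<le> (\<integral>x. f x \<partial>M)"
    using eventually_gt_at_top[of 0]
    by eventually_elim (rule integral_layer_bounds(1)[OF M f r])
qed simp

lemma complex_layer_sum_tendsto:
  fixes N :: "'i \<Rightarrow> 'a::topological_space measure" and c :: "'i \<Rightarrow> complex"
  assumes I: "finite I"
    and N: "\<And>i. i \<in> I \<Longrightarrow> finite_measure (N i)" "\<And>i. i \<in> I \<Longrightarrow> sets (N i) = sets borel"
    and eq: "\<And>A. A \<in> sets borel \<Longrightarrow> \<mu> A = (\<Sum>i\<in>I. c i * measure (N i) A)"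
    and f: "f \<in> borel_measurable borel" and r: "\<And>x. 0 \<le> f x" "\<And>x. f x \<le> 1"
  shows "(\<lambda>n. (\<Sum>k=1..n. \<mu> {x. real k / real n < f x}) / n) \<longlonglongrightarrow> (\<Sum>i\<in>I. c i * of_real (\<integral>x. f x \<partial>N i))"
proof -
  have "(\<Sum>k=1..n. \<mu> {x. real k / real n < f x}) / n =
      (\<Sum>i\<in>I. c i * of_real ((\<Sum>k=1..n. measure (N i) {x. real k / real n < f x}) / n))" for n
  proof -
    have "(\<Sum>k=1..n. \<mu> {x. real k / real n < f x}) = (\<Sum>k=1..n. \<Sum>i\<in>I. c i * measure (N i) {x. real k / real n < f x})"
      by (intro sum.cong refl eq level_set_borel f)
    also have "\<dots> = (\<Sum>i\<in>I. c i * of_real (\<Sum>k=1..n. measure (N i) {x. real k / real n < f x}))"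
      by (subst sum.swap) (simp add: sum_distrib_left)
    finally have "(\<Sum>k=1..n. \<mu> {x. real k / real n < f x}) / n =
        (\<Sum>i\<in>I. c i * of_real (\<Sum>k=1..n. measure (N i) {x. real k / real n < f x})) / n" by simp
    then show ?thesis by (simp only: sum_divide_distrib[of _ I] of_real_divide of_real_of_nat_eq times_divide_eq_right)
  qed
  then show ?thesis
    by (simp only:) (intro tendsto_sum tendsto_mult_left tendsto_of_real layer_sum_tendsto N f r)
qed

text \<open>The \<open>N i\<close> need not be the four parts of \<open>\<mu>\<close>. Layer sums
  use only the values of \<open>\<mu>\<close> on level sets, so both sides are limits of the same
  sequence.\<close>

lemma cint_eq_combination:
  fixes N :: "'i \<Rightarrow> 'a::topological_space measure" and c :: "'i \<Rightarrow> complex"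
  assumes \<mu>: "complex_measure \<mu>" and I: "finite I"
    and N: "\<And>i. i \<in> I \<Longrightarrow> finite_measure (N i)" "\<And>i. i \<in> I \<Longrightarrow> sets (N i) = sets borel"
    and eq: "\<And>A. A \<in> sets borel \<Longrightarrow> \<mu> A = (\<Sum>i\<in>I. c i * measure (N i) A)"
    and f: "f \<in> borel_measurable borel" and r: "\<And>x. 0 \<le> f x" "\<And>x. f x \<le> 1"
  shows "cint \<mu> (\<lambda>x. of_real (f x)) = (\<Sum>i\<in>I. c i * of_real (\<integral>x. f x \<partial>N i))"
proof -
  have "cint \<mu> (\<lambda>x. of_real (f x)) = (\<Sum>k<4. \<i> ^ k * of_real (\<integral>x. f x \<partial>dirpart \<mu> k))"
    by (simp add: cint_dirpart)
  moreover have lim: "(\<lambda>n. (\<Sum>k=1..n. \<mu> {x. real k / real n < f x}) / n) \<longlonglongrightarrow> (\<Sum>k<4. \<i> ^ k * of_real (\<integral>x. f x \<partial>dirpart \<mu> k))"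
    by (rule complex_layer_sum_tendsto[OF _ _ _ _ f r])
       (auto intro: finite_measure_dirpart[OF \<mu>] complex_measure_eq_parts[OF \<mu>])
  ultimately show ?thesis
    using LIMSEQ_unique[OF lim complex_layer_sum_tendsto[OF I N eq f r]] by simp
qed

lemma cint_linear_measure:
  fixes \<mu> \<nu> :: "'a::t2_space set \<Rightarrow> complex"
  assumes cm: "complex_measure \<mu>" "complex_measure \<nu>" "complex_measure (\<lambda>A. a * \<mu> A + b * \<nu> A)"
    and f: "f \<in> borel_measurable borel" and r: "\<And>x. 0 \<le> f x" "\<And>x. f x \<le> 1"
  shows "cint (\<lambda>A. a * \<mu> A + b * \<nu> A) (\<lambda>x. of_real (f x)) =
    a * cint \<mu> (\<lambda>x. of_real (f x)) + b * cint \<nu> (\<lambda>x. of_real (f x))"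
proof -
  let ?I = "{..<4::nat} <+> {..<4::nat}"
  let ?c = "case_sum (\<lambda>k. a * \<i> ^ k) (\<lambda>k. b * \<i> ^ k)"
  let ?N = "case_sum (dirpart \<mu>) (dirpart \<nu>)"
  have "cint (\<lambda>A. a * \<mu> A + b * \<nu> A) (\<lambda>x. of_real (f x)) = (\<Sum>i\<in>?I. ?c i * of_real (\<integral>x. f x \<partial>?N i))"
  proof (rule cint_eq_combination[OF cm(3) _ _ _ _ f r])
    show "a * \<mu> A + b * \<nu> A = (\<Sum>i\<in>?I. ?c i * measure (?N i) A)" if "A \<in> sets borel" for A
      using that by (simp add: sum.Plus complex_measure_eq_parts[OF cm(1)] complex_measure_eq_parts[OF cm(2)]
        sum_distrib_left mult.assoc)
  qed (auto intro: finite_measure_dirpart[OF cm(1)] finite_measure_dirpart[OF cm(2)])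
  also have "\<dots> = a * cint \<mu> (\<lambda>x. of_real (f x)) + b * cint \<nu> (\<lambda>x. of_real (f x))"
    by (simp add: sum.Plus cint_dirpart sum_distrib_left mult.assoc)
  finally show ?thesis .
qed

section \<open>Weak limits of bounded families of measures\<close>

text \<open>A limit of measures along an ultrafilter, taken setwise, is only finitely additive. Its values on
  compact sets determine a Radon measure that has the same integrals of compactly supported functions.\<close>

lemma regularization:
  fixes m :: "'a::t2_space set \<Rightarrow> real"
  assumes m0: "\<And>A. A \<in> sets borel \<Longrightarrow> 0 \<le> m A"
    and madd: "\<And>A B. A \<in> sets borel \<Longrightarrow> B \<in> sets borel \<Longrightarrow> A \<inter> B = {} \<Longrightarrow> m (A \<union> B) = m A + m B"
  shows "\<exists>\<rho>. radon_finite \<rho> \<and> (\<forall>C. compact C \<longrightarrow> m C \<le> measure \<rho> C) \<and> (\<forall>U. open U \<longrightarrow> measure \<rho> U \<le> m U)"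
proof -
  have mE: "m {} = 0" using madd[of "{}" "{}"] by simp
  have mmono: "m A \<le> m B" if "A \<subseteq> B" "A \<in> sets borel" "B \<in> sets borel" for A B
    using madd[of A "B - A"] m0[of "B - A"] that by (simp add: Un_absorb1)
  have msub: "m (A \<union> B) \<le> m A + m B" if "A \<in> sets borel" "B \<in> sets borel" for A B
    using madd[of A "B - A"] mmono[of "B - A" B] that by simp
  \<comment> \<open>The classical passage from a content to a Radon measure: \<open>q\<close> is the
    inner content of open sets, \<open>ou\<close> the induced outer measure. Mass of
    \<open>m\<close> that no compact set sees is discarded here.\<close>
  define q where "q U = (SUP C\<in>{C. compact C \<and> C \<subseteq> U}. ennreal (m C))" for U
  define ou where "ou A = (INF U\<in>{U. open U \<and> A \<subseteq> U}. q U)" for A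
  have ne: "{C. compact C \<and> C \<subseteq> U} \<noteq> {}" for U :: "'a set" by auto
  have qmono: "q U \<le> q V" if "U \<subseteq> V" for U V
    unfolding q_def using that by (intro SUP_subset_mono) auto
  have qge: "ennreal (m C) \<le> q U" if "compact C" "C \<subseteq> U" for C U
    unfolding q_def using that by (intro SUP_upper) auto
  have qle: "q U \<le> ennreal (m U)" if "open U" for U
    unfolding q_def using that by (intro SUP_least ennreal_leI mmono) (auto intro: compact_borel)
  have q0: "q {} = 0" using qle[of "{}"] mE by simp
  have ouopen: "ou U = q U" if "open U" for U
    unfolding ou_def using that by (intro antisym INF_greatest INF_lower2[of U] qmono) auto
  have ole: "ou A \<le> q U" if "open U" "A \<subseteq> U" for A U
    unfolding ou_def using that by (intro INF_lower) auto
  have ofin: "ou A \<noteq> \<infinity>" for A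
    using ole[of UNIV A] qle[of UNIV] by (auto simp: top_unique)
  have omono: "ou A \<le> ou B" if "A \<subseteq> B" for A B
    unfolding ou_def using that by (intro INF_superset_mono) auto
  have qUn: "q (U \<union> V) \<le> q U + q V" if UV: "open U" "open V" for U V
    unfolding q_def[of "U \<union> V"]
  proof (rule SUP_least)
    fix C assume "C \<in> {C. compact C \<and> C \<subseteq> U \<union> V}"
    then have "compact C" "C \<subseteq> U \<union> V" by auto
    then obtain C1 C2 where C: "compact C1" "compact C2" "C1 \<subseteq> U" "C2 \<subseteq> V" "C = C1 \<union> C2"
      using compact_split[OF _ UV] by metis
    have "ennreal (m C) \<le> ennreal (m C1 + m C2)"
      using C by (intro ennreal_leI) (auto intro: msub compact_borel)
    also have "\<dots> = ennreal (m C1) + ennreal (m C2)" using C by (intro ennreal_plus m0 compact_borel)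
    also have "\<dots> \<le> q U + q V" using C by (intro add_mono qge)
    finally show "ennreal (m C) \<le> q U + q V" .
  qed
  have qfin: "q (\<Union>i<n. U i) \<le> (\<Sum>i<n. q (U i))" if "\<And>i. open (U i)" for U :: "nat \<Rightarrow> 'a set" and n
  proof (induction n)
    case (Suc n)
    have "q ((\<Union>i<n. U i) \<union> U n) \<le> q (\<Union>i<n. U i) + q (U n)" using that by (intro qUn) auto
    also have "\<dots> \<le> (\<Sum>i<n. q (U i)) + q (U n)" using Suc by (intro add_mono) auto
    finally show ?case by (simp add: lessThan_Suc Un_commute add.commute)
  qed (simp add: q0)
  \<comment> \<open>Since \<open>m\<close> is only finitely additive, countability has to come from
    compactness: a compact subset meets the requirement with finitely many
    \<open>U i\<close>.\<close>
  have qcount: "q (\<Union>i. U i) \<le> (\<Sum>i. q (U i))" if U: "\<And>i. open (U i)" for U :: "nat \<Rightarrow> 'a set"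
    unfolding q_def[of "\<Union>i. U i"]
  proof (rule SUP_least)
    fix C assume "C \<in> {C. compact C \<and> C \<subseteq> (\<Union>i. U i)}"
    then have C: "compact C" "C \<subseteq> (\<Union>i. U i)" by auto
    obtain D where D: "finite D" "C \<subseteq> (\<Union>i\<in>D. U i)"
      using compactE_image[OF C(1), of UNIV U] C(2) U by auto
    obtain n where "D \<subseteq> {..<n}" using finite_nat_bounded[OF D(1)] by blast
    then have "C \<subseteq> (\<Union>i<n. U i)" using D(2) by (meson UN_mono order_refl order_trans)
    then have "ennreal (m C) \<le> q (\<Union>i<n. U i)" using C(1) by (intro qge)
    also have "\<dots> \<le> (\<Sum>i<n. q (U i))" by (rule qfin[OF U])
    also have "\<dots> \<le> (\<Sum>i. q (U i))" by (intro sum_le_suminf) auto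
    finally show "ennreal (m C) \<le> (\<Sum>i. q (U i))" .
  qed
  have ocount: "ou (\<Union>i. A i) \<le> (\<Sum>i. ou (A i))" for A :: "nat \<Rightarrow> 'a set"
  proof (rule ennreal_le_epsilon)
    fix \<epsilon> :: real assume "0 < \<epsilon>"
    have "\<exists>U\<in>{U. open U \<and> A i \<subseteq> U}. q U < ou (A i) + ennreal (\<epsilon> * (1/2)^Suc i)" for i
      using \<open>0 < \<epsilon>\<close> ofin[of "A i"] by (intro INF_approx_ennreal) (auto simp: ou_def)
    then obtain U where U: "\<And>i. open (U i)" "\<And>i. A i \<subseteq> U i" "\<And>i. q (U i) < ou (A i) + ennreal (\<epsilon> * (1/2)^Suc i)"
      by (simp del: power_Suc) metis
    have "ou (\<Union>i. A i) \<le> q (\<Union>i. U i)" using U by (intro ole) auto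
    also have "\<dots> \<le> (\<Sum>i. q (U i))" by (rule qcount[OF U(1)])
    also have "\<dots> \<le> (\<Sum>i. ou (A i) + ennreal (\<epsilon> * (1/2)^Suc i))"
      using U(3) by (intro suminf_le) (auto intro: less_imp_le)
    also have "\<dots> = (\<Sum>i. ou (A i)) + (\<Sum>i. ennreal (\<epsilon> * (1/2)^Suc i))" by (intro suminf_add[symmetric]) auto
    also have "(\<Sum>i. ennreal (\<epsilon> * (1/2)^Suc i)) = ennreal \<epsilon>"
      using sums_mult[OF power_half_series, of \<epsilon>] \<open>0 < \<epsilon>\<close> by (intro suminf_ennreal_eq) auto
    finally show "ou (\<Union>i. A i) \<le> (\<Sum>i. ou (A i)) + ennreal \<epsilon>" .
  qed
  have o0: "ou {} = 0" using ouopen[of "{}"] q0 by simp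
  have oms: "outer_measure_space UNIV ou"
    unfolding outer_measure_space_def positive_def increasing_def countably_subadditive_def
    using o0 omono ocount by auto
  have oUn: "ou (A \<union> B) \<le> ou A + ou B" for A B
  proof -
    have "ou (\<Union>i. binaryset A B i) \<le> (\<Sum>i. ou (binaryset A B i))" by (rule ocount)
    then show ?thesis using o0 by (simp add: UN_binaryset_eq suminf_binaryset_eq)
  qed
  \<comment> \<open>Caratheodory's test for an open \<open>V\<close>: choose a compact
    \<open>C\<close> in \<open>V \<inter> U\<close> first and then a compact \<open>D\<close> in
    \<open>U - C\<close>. They are disjoint, so \<open>m\<close> adds over them.\<close>
  have olam: "V \<in> lambda_system UNIV UNIV ou" if V: "open V" for V
  proof -
    have "ou (V \<inter> X) + ou ((UNIV - V) \<inter> X) = ou X" for X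
    proof (rule antisym)
      have "ou X = ou ((V \<inter> X) \<union> ((UNIV - V) \<inter> X))" by (intro arg_cong[where f=ou]) auto
      also have "\<dots> \<le> ou (V \<inter> X) + ou ((UNIV - V) \<inter> X)" by (rule oUn)
      finally show "ou X \<le> ou (V \<inter> X) + ou ((UNIV - V) \<inter> X)" .
      show "ou (V \<inter> X) + ou ((UNIV - V) \<inter> X) \<le> ou X"
        unfolding ou_def[of X]
      proof (rule INF_greatest)
        fix U assume "U \<in> {U. open U \<and> X \<subseteq> U}"
        then have U: "open U" "X \<subseteq> U" by auto
        have "ou (V \<inter> X) + ou ((UNIV - V) \<inter> X) \<le> q (V \<inter> U) + ou ((UNIV - V) \<inter> X)"
          using U V by (intro add_right_mono ole) auto
        also have "\<dots> \<le> q U"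
          unfolding q_def[of "V \<inter> U"]
        proof (subst ennreal_SUP_add_left[OF ne, symmetric], rule SUP_least)
          fix C assume "C \<in> {C. compact C \<and> C \<subseteq> V \<inter> U}"
          then have C: "compact C" "C \<subseteq> V" "C \<subseteq> U" by auto
          have "ou ((UNIV - V) \<inter> X) \<le> q (U - C)"
            using C U by (intro ole open_Diff compact_imp_closed) auto
          then have "ennreal (m C) + ou ((UNIV - V) \<inter> X) \<le> ennreal (m C) + q (U - C)"
            by (rule add_left_mono)
          also have "\<dots> \<le> q U"
            unfolding q_def[of "U - C"]
          proof (subst ennreal_SUP_add_right[OF ne], rule SUP_least)
            fix D assume "D \<in> {D. compact D \<and> D \<subseteq> U - C}"
            then have D: "compact D" "D \<subseteq> U - C" by auto
            have "ennreal (m C) + ennreal (m D) = ennreal (m C + m D)"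
              using C D by (intro ennreal_plus[symmetric] m0 compact_borel)
            also have "m C + m D = m (C \<union> D)"
              using C D by (intro madd[symmetric] compact_borel) auto
            also have "ennreal (m (C \<union> D)) \<le> q U" using C D by (intro qge compact_Un) auto
            finally show "ennreal (m C) + ennreal (m D) \<le> q U" .
          qed
          finally show "ennreal (m C) + ou ((UNIV - V) \<inter> X) \<le> q U" .
        qed
        finally show "ou (V \<inter> X) + ou ((UNIV - V) \<inter> X) \<le> q U" .
      qed
    qed
    then show ?thesis by (simp add: lambda_system_def)
  qed
  have ms: "measure_space UNIV (lambda_system UNIV UNIV ou) ou"
    using sigma_algebra.caratheodory_lemma[OF sigma_algebra_Pow[of UNIV, unfolded Pow_UNIV] oms] .
  have "sets borel \<subseteq> lambda_system UNIV UNIV ou"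
  proof -
    have "sigma_sets UNIV {S. open S} \<subseteq> lambda_system UNIV UNIV ou"
      using ms olam by (intro sigma_algebra.sigma_sets_subset) (auto simp: measure_space_def)
    then show ?thesis by (simp add: borel_def)
  qed
  then have ms': "measure_space UNIV (sets borel) ou"
    using sets.sigma_algebra_axioms[of "borel :: 'a measure"] by (intro measure_down[OF ms]) auto
  define \<rho> where "\<rho> = measure_of UNIV (sets borel) ou"
  have s\<rho>: "sets \<rho> = sets borel" unfolding \<rho>_def using sets.sigma_sets_eq[of "borel :: 'a measure"] by simp
  have e\<rho>: "emeasure \<rho> A = ou A" if "A \<in> sets borel" for A
    unfolding \<rho>_def using ms' that by (intro emeasure_measure_of_sigma) (auto simp: measure_space_def)
  have fin: "finite_measure \<rho>"
    using e\<rho>[of UNIV] ofin[of UNIV] sets_eq_imp_space_eq[OF s\<rho>] by (intro finite_measureI) simp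
  then interpret finite_measure \<rho> .
  have le: "measure \<rho> U \<le> m U" if "open U" for U
  proof -
    have "ennreal (measure \<rho> U) \<le> ennreal (m U)"
      using e\<rho>[of U] ouopen[OF that] qle[OF that] that by (simp add: emeasure_eq_measure)
    then show ?thesis using m0[of U] that by (simp add: ennreal_le_iff)
  qed
  have ge: "m C \<le> measure \<rho> C" if C: "compact C" for C
  proof -
    have "ennreal (m C) \<le> ou C" unfolding ou_def using C by (intro INF_greatest qge) auto
    then have "ennreal (m C) \<le> ennreal (measure \<rho> C)"
      using e\<rho>[OF compact_borel[OF C]] by (simp add: emeasure_eq_measure)
    then show ?thesis by (simp add: ennreal_le_iff)
  qed
  have "radon_finite \<rho>"
  proof (rule radon_finiteI_open[OF fin s\<rho>])
    fix U :: "'a set" and \<epsilon> :: real assume U: "open U" and "0 < \<epsilon>"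
    have "\<exists>C. compact C \<and> C \<subseteq> U \<and> measure \<rho> U - \<epsilon> < m C"
    proof (rule ccontr)
      assume "\<not> ?thesis"
      then have "m C \<le> measure \<rho> U - \<epsilon>" if "compact C" "C \<subseteq> U" for C using that by auto
      then have "q U \<le> ennreal (measure \<rho> U - \<epsilon>)"
        unfolding q_def by (intro SUP_least ennreal_leI) auto
      then have "ennreal (measure \<rho> U) \<le> ennreal (measure \<rho> U - \<epsilon>)"
        using e\<rho>[of U] ouopen[OF U] U by (simp add: emeasure_eq_measure)
      moreover have "0 \<le> measure \<rho> U - \<epsilon>"
        using \<open>\<And>C. compact C \<Longrightarrow> C \<subseteq> U \<Longrightarrow> m C \<le> measure \<rho> U - \<epsilon>\<close>[of "{}"] mE by simp
      ultimately show False using \<open>0 < \<epsilon>\<close> by (simp add: ennreal_le_iff)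
    qed
    then obtain C where C: "compact C" "C \<subseteq> U" "measure \<rho> U - \<epsilon> < m C" by blast
    have "measure \<rho> (U - C) = measure \<rho> U - measure \<rho> C"
      using C U s\<rho> by (intro finite_measure_Diff) (auto intro: compact_borel)
    then have "measure \<rho> (U - C) < \<epsilon>" using C(3) ge[OF C(1)] by simp
    then show "\<exists>C. compact C \<and> C \<subseteq> U \<and> measure \<rho> (U - C) < \<epsilon>" using C by blast
  qed
  then show ?thesis using le ge by blast
qed

text \<open>The regularised measure lies below the setwise limit on open level sets and above it on
  compact ones. For a continuous function of compact support both kinds occur at every positive
  height, so the layer sums of the two agree up to a multiple of \<open>1/N\<close>.\<close>

lemma ultralimit_positive:
  fixes \<rho> :: "nat \<Rightarrow> 'a::t2_space measure"
  assumes G: "G \<noteq> bot" "\<And>P. eventually P G \<or> eventually (\<lambda>x. \<not> P x) G"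
    and \<rho>: "\<And>n. finite_measure (\<rho> n)" "\<And>n. sets (\<rho> n) = sets borel" "\<And>n. measure (\<rho> n) UNIV \<le> c"
  shows "\<exists>R. radon_finite R \<and> (\<forall>f\<in>Cc01. ((\<lambda>n. \<integral>x. f x \<partial>\<rho> n) \<longlongrightarrow> (\<integral>x. f x \<partial>R)) G)"
proof -
  have mle: "measure (\<rho> n) A \<le> c" for n A
  proof -
    interpret finite_measure "\<rho> n" by (rule \<rho>(1))
    have "measure (\<rho> n) A \<le> measure (\<rho> n) (space (\<rho> n))" by (rule bounded_measure)
    then show ?thesis using \<rho>(3)[of n] sets_eq_imp_space_eq[OF \<rho>(2)[of n]] by simp
  qed
  have c0: "0 \<le> c" using mle[of 0 "{}"] by simp
  have "\<exists>l. ((\<lambda>n. measure (\<rho> n) A) \<longlongrightarrow> l) G" for A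
  proof -
    have "norm (measure (\<rho> n) A) \<le> c" for n using mle[of n A] by simp
    then show ?thesis using ultrafilter_tendsto_bounded[OF G, of "\<lambda>n. measure (\<rho> n) A" c] by metis
  qed
  then obtain m where m: "\<And>A. ((\<lambda>n. measure (\<rho> n) A) \<longlongrightarrow> m A) G" by metis
  have m0: "0 \<le> m A" for A by (rule tendsto_lowerbound[OF m]) (auto simp: G(1))
  have madd: "m (A \<union> B) = m A + m B" if "A \<in> sets borel" "B \<in> sets borel" "A \<inter> B = {}" for A B
  proof (rule tendsto_unique[OF G(1) m])
    have "measure (\<rho> n) (A \<union> B) = measure (\<rho> n) A + measure (\<rho> n) B" for n
      using that \<rho>(1)[of n] \<rho>(2)[of n] by (intro finite_measure.finite_measure_Union) auto
    then show "((\<lambda>n. measure (\<rho> n) (A \<union> B)) \<longlongrightarrow> m A + m B) G" by (simp add: tendsto_add m)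
  qed
  have mmono: "m A \<le> m B" if "A \<subseteq> B" "B \<in> sets borel" for A B
    by (rule tendsto_le[OF G(1) m m])
       (use that \<rho> in \<open>auto intro!: always_eventually finite_measure.finite_measure_mono\<close>)
  obtain R where R: "radon_finite R" "\<And>C. compact C \<Longrightarrow> m C \<le> measure R C" "\<And>U. open U \<Longrightarrow> measure R U \<le> m U"
    using regularization[of m] m0 madd by blast
  have fR: "finite_measure R" and sR: "sets R = sets borel" using R(1) by (auto simp: radon_finite_def)
  interpret R: finite_measure R by fact
  have "((\<lambda>n. \<integral>x. f x \<partial>\<rho> n) \<longlongrightarrow> (\<integral>x. f x \<partial>R)) G" if f: "f \<in> Cc01" for f
  proof -
    note fD = Cc01D[OF f]
    have "norm (\<integral>x. f x \<partial>\<rho> n) \<le> c" for n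
    proof -
      have "0 \<le> (\<integral>x. f x \<partial>\<rho> n)" using fD(3) by (intro integral_nonneg_AE) auto
      moreover have "(\<integral>x. f x \<partial>\<rho> n) \<le> (\<Sum>k=1..1. measure (\<rho> n) {x. real k / real 1 < f x}) / 1 + measure (\<rho> n) UNIV / 1"
        using integral_layer_bounds(2)[OF \<rho>(1,2) fD(2,3,4), of 1 n] by simp
      moreover have "{x. 1 < f x} = {}" using fD(4) by (auto simp: not_less)
      ultimately show ?thesis using \<rho>(3)[of n] by simp
    qed
    then obtain l where l: "((\<lambda>n. \<integral>x. f x \<partial>\<rho> n) \<longlongrightarrow> l) G"
      using ultrafilter_tendsto_bounded[OF G, of "\<lambda>n. \<integral>x. f x \<partial>\<rho> n" c] by metis
    define s where "s N \<phi> = (\<Sum>k=1..N. \<phi> {x. real k / real N < f x}) / N" for N :: nat and \<phi> :: "'a set \<Rightarrow> real"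
    define d where "d = measure R UNIV + c"
    have est: "\<bar>l - (\<integral>x. f x \<partial>R)\<bar> \<le> d / N" if N: "0 < N" for N :: nat
    proof -
      have sl: "((\<lambda>n. s N (measure (\<rho> n))) \<longlongrightarrow> s N m) G"
        unfolding s_def by (intro tendsto_divide tendsto_sum m tendsto_const) (use N in auto)
      have 1: "s N m \<le> l"
        unfolding s_def
        by (rule tendsto_le[OF G(1) l sl[unfolded s_def]])
           (intro always_eventually allI integral_layer_bounds(1)[OF \<rho>(1,2) fD(2,3,4) N])
      have "l \<le> s N m + c / N"
      proof (rule tendsto_le[OF G(1) tendsto_add[OF sl tendsto_const] l], intro always_eventually allI)
        fix n
        have "measure (\<rho> n) UNIV / N \<le> c / N" using \<rho>(3) by (intro divide_right_mono) auto
        then show "(\<integral>x. f x \<partial>\<rho> n) \<le> s N (measure (\<rho> n)) + c / N"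
          using integral_layer_bounds(2)[OF \<rho>(1,2) fD(2,3,4) N, of n] unfolding s_def by linarith
      qed
      moreover have 3: "s N (measure R) \<le> s N m"
      proof -
        have "open {x. t < f x}" for t using fD(1) by (intro open_Collect_less continuous_intros) auto
        then show ?thesis unfolding s_def by (intro divide_right_mono sum_mono R(3)) auto
      qed
      moreover have 4: "s N m \<le> s N (measure R) + measure R UNIV / N"
      proof -
        \<comment> \<open>\<open>R\<close> dominates \<open>m\<close> only on the compact set
          \<open>{x. k/N \<le> f x}\<close>, which fits into the open level set one step lower. The
          shift adds a single term, at most \<open>measure R UNIV\<close>, before division by
          \<open>N\<close>.\<close>
        have "m {x. real k / N < f x} \<le> measure R {x. real (k - 1) / N < f x}" if k: "k \<in> {1..N}" for k
        proof -
          have cl: "closed {x. real k / N \<le> f x}"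
            using fD(1) by (intro closed_Collect_le continuous_intros) auto
          have pos: "0 < real k / N" using k N by auto
          have "{x. real k / N \<le> f x} \<subseteq> {x. f x \<noteq> 0}" using pos by auto
          then have "{x. real k / N \<le> f x} \<subseteq> closure {x. f x \<noteq> 0}" using closure_subset by blast
          then have cp: "compact {x. real k / N \<le> f x}"
            using compact_Int_closed[OF fD(7) cl] by (simp add: inf.absorb2)
          have "m {x. real k / N < f x} \<le> m {x. real k / N \<le> f x}"
            using cl by (intro mmono) auto
          also have "\<dots> \<le> measure R {x. real k / N \<le> f x}" by (rule R(2)[OF cp])
          also have "\<dots> \<le> measure R {x. real (k - 1) / N < f x}"
          proof (rule R.finite_measure_mono)
            have "real (k - 1) / N < real k / N" using k N by (intro divide_strict_right_mono) auto
            then show "{x. real k / N \<le> f x} \<subseteq> {x. real (k - 1) / N < f x}" by auto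
          qed (use level_set_borel[OF fD(2)] sR in auto)
          finally show ?thesis .
        qed
        then have "(\<Sum>k=1..N. m {x. real k / N < f x}) \<le> (\<Sum>k=1..N. measure R {x. real (k - 1) / N < f x})"
          by (rule sum_mono)
        also have "\<dots> = (\<Sum>k<N. measure R {x. real k / N < f x})"
          by (rule sum.reindex_bij_witness[of _ Suc "\<lambda>k. k - 1"]) auto
        also have "\<dots> \<le> (\<Sum>k\<le>N. measure R {x. real k / N < f x})"
          by (intro sum_mono2) auto
        also have "\<dots> = measure R {x. 0 < f x} + (\<Sum>k=1..N. measure R {x. real k / N < f x})"
          by (simp add: atMost_atLeast0 sum.atLeast_Suc_atMost)
        also have "measure R {x. 0 < f x} \<le> measure R UNIV"
          using R.bounded_measure[of "{x. 0 < f x}"] sets_eq_imp_space_eq[OF sR] by simp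
        finally have "(\<Sum>k=1..N. m {x. real k / N < f x}) / N \<le>
            (measure R UNIV + (\<Sum>k=1..N. measure R {x. real k / N < f x})) / N"
          by (intro divide_right_mono) auto
        then show ?thesis unfolding s_def by (simp add: add_divide_distrib)
      qed
      moreover have "s N (measure R) \<le> (\<integral>x. f x \<partial>R)" "(\<integral>x. f x \<partial>R) \<le> s N (measure R) + measure R UNIV / N"
        using integral_layer_bounds[OF fR sR fD(2,3,4) N] unfolding s_def by auto
      moreover have "0 \<le> c / N" "0 \<le> measure R UNIV / N" using c0 by auto
      ultimately show ?thesis using 1 unfolding d_def add_divide_distrib by linarith
    qed
    have "(\<lambda>N. d / real N) \<longlonglongrightarrow> 0" by (rule lim_const_over_n)
    then have "\<bar>l - (\<integral>x. f x \<partial>R)\<bar> \<le> 0"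
      using est by (intro LIMSEQ_le_const[of "\<lambda>N. d / real N" 0]) (auto intro!: exI[of _ 1])
    then show ?thesis using l by simp
  qed
  with R(1) show ?thesis by blast
qed

lemma measure_dirpart_le_mnorm:
  assumes "complex_measure \<mu>" "mnorm \<mu> \<le> ennreal c" "0 \<le> c"
  shows "measure (dirpart \<mu> k) UNIV \<le> c"
proof -
  have "enn2real (tvar \<mu> UNIV) \<le> c" using assms by (simp add: mnorm_def enn2real_leI)
  then show ?thesis using measure_part_le_tvar[OF assms(1), of UNIV k] by simp
qed

text \<open>Each of the four parts has its own limit \<open>R k\<close>. These need not be the parts
  of the limit measure, so its integrals are computed by \<open>cint_eq_combination\<close>.\<close>

lemma ultralimit_MK:
  fixes \<nu> :: "nat \<Rightarrow> 'a::t2_space set \<Rightarrow> complex"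
  assumes G: "G \<noteq> bot" "\<And>P. eventually P G \<or> eventually (\<lambda>x. \<not> P x) G"
    and \<nu>: "\<And>n. \<nu> n \<in> MK" "\<And>n. mnorm (\<nu> n) \<le> ennreal c" and "0 \<le> c"
  shows "\<exists>\<kappa>\<in>MK. \<forall>f\<in>Cc01. ((\<lambda>n. cint (\<nu> n) (\<lambda>x. of_real (f x))) \<longlongrightarrow> cint \<kappa> (\<lambda>x. of_real (f x))) G"
proof -
  note cm = MK_complex_measure[OF \<nu>(1)]
  have "\<exists>R. radon_finite R \<and> (\<forall>f\<in>Cc01. ((\<lambda>n. \<integral>x. f x \<partial>dirpart (\<nu> n) k) \<longlongrightarrow> (\<integral>x. f x \<partial>R)) G)" for k
    by (rule ultralimit_positive[OF G])
       (auto intro: finite_measure_dirpart[OF cm] measure_dirpart_le_mnorm[OF cm \<nu>(2) \<open>0 \<le> c\<close>])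
  then obtain R where R: "\<And>k. radon_finite (R k)"
    "\<And>k f. f \<in> Cc01 \<Longrightarrow> ((\<lambda>n. \<integral>x. f x \<partial>dirpart (\<nu> n) k) \<longlongrightarrow> (\<integral>x. f x \<partial>R k)) G" by metis
  define \<kappa> where "\<kappa> = (\<lambda>A. \<Sum>k<(4::nat). \<i> ^ k * measure (R k) A)"
  have \<kappa>: "\<kappa> \<in> MK" unfolding \<kappa>_def by (rule MK_combination) (auto intro: R)
  have "((\<lambda>n. cint (\<nu> n) (\<lambda>x. of_real (f x))) \<longlongrightarrow> cint \<kappa> (\<lambda>x. of_real (f x))) G" if f: "f \<in> Cc01" for f
  proof -
    have "cint \<kappa> (\<lambda>x. of_real (f x)) = (\<Sum>k<4. \<i> ^ k * of_real (\<integral>x. f x \<partial>R k))"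
      by (rule cint_eq_combination[OF MK_complex_measure[OF \<kappa>]])
         (use R(1) Cc01D[OF f] in \<open>auto simp: \<kappa>_def radon_finite_def\<close>)
    moreover have "cint (\<nu> n) (\<lambda>x. of_real (f x)) = (\<Sum>k<4. \<i> ^ k * of_real (\<integral>x. f x \<partial>dirpart (\<nu> n) k))" for n
      by (simp add: cint_dirpart)
    moreover have "((\<lambda>n. \<Sum>k<4. \<i> ^ k * complex_of_real (\<integral>x. f x \<partial>dirpart (\<nu> n) k)) \<longlongrightarrow>
        (\<Sum>k<4. \<i> ^ k * of_real (\<integral>x. f x \<partial>R k))) G"
      by (intro tendsto_sum tendsto_mult_left tendsto_of_real R(2) f)
    ultimately show ?thesis by simp
  qed
  with \<kappa> show ?thesis by blast
qed

section \<open>The norm is determined by compactly supported functions\<close>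

lemma disjoint_compact_nbhds:
  fixes C :: "'i \<Rightarrow> 'a::t2_space set"
  assumes P: "finite P" and C: "\<And>i. i \<in> P \<Longrightarrow> compact (C i)"
    and dis: "\<And>i j. i \<in> P \<Longrightarrow> j \<in> P \<Longrightarrow> i \<noteq> j \<Longrightarrow> C i \<inter> C j = {}"
  shows "\<exists>U. (\<forall>i\<in>P. open (U i) \<and> C i \<subseteq> U i) \<and> (\<forall>i\<in>P. \<forall>j\<in>P. i \<noteq> j \<longrightarrow> U i \<inter> U j = {})"
proof -
  have "\<exists>V W. open V \<and> open W \<and> C i \<subseteq> V \<and> C j \<subseteq> W \<and> V \<inter> W = {}"
    if "i \<in> P" "j \<in> P" "i \<noteq> j" for i j
    using compact_separation_t2[OF C[OF that(1)] C[OF that(2)] dis[OF that]] by metis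
  then obtain V W where VW: "\<And>i j. i \<in> P \<Longrightarrow> j \<in> P \<Longrightarrow> i \<noteq> j \<Longrightarrow>
      open (V i j) \<and> open (W i j) \<and> C i \<subseteq> V i j \<and> C j \<subseteq> W i j \<and> V i j \<inter> W i j = {}"
    by metis
  \<comment> \<open>Separating sets are chosen for ordered pairs, so \<open>i\<close> occurs once as
    first and once as second index; disjointness then uses \<open>V i j\<close> for \<open>i\<close>
    and \<open>W i j\<close> for \<open>j\<close>.\<close>
  define U where "U i = (\<Inter>j\<in>P - {i}. V i j \<inter> W j i)" for i
  show ?thesis
  proof (intro exI[of _ U] conjI ballI impI)
    fix i assume i: "i \<in> P"
    show "open (U i)" unfolding U_def using P i VW by (intro open_INT ballI open_Int) auto
    show "C i \<subseteq> U i" unfolding U_def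
    proof (rule INT_greatest)
      fix j assume "j \<in> P - {i}"
      then show "C i \<subseteq> V i j \<inter> W j i" using VW[of i j] VW[of j i] i by auto
    qed
    fix j assume j: "j \<in> P" "i \<noteq> j"
    have "U i \<subseteq> V i j" "U j \<subseteq> W i j" using i j unfolding U_def by auto
    then show "U i \<inter> U j = {}" using VW[OF i j] by auto
  qed
qed

lemma radon_finite_common_open:
  fixes N :: "'i \<Rightarrow> 'a::t2_space measure"
  assumes "finite I" "\<And>i. i \<in> I \<Longrightarrow> radon_finite (N i)" "A \<in> sets borel" "0 < \<epsilon>"
  shows "\<exists>U. open U \<and> A \<subseteq> U \<and> (\<forall>i\<in>I. measure (N i) (U - A) < \<epsilon>)"
proof -
  have "\<exists>U. open U \<and> A \<subseteq> U \<and> measure (N i) (U - A) < \<epsilon>" if "i \<in> I" for i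
    using radon_finite_outer[OF assms(2)[OF that] assms(3,4)] by metis
  then obtain U where U: "\<And>i. i \<in> I \<Longrightarrow> open (U i) \<and> A \<subseteq> U i \<and> measure (N i) (U i - A) < \<epsilon>" by metis
  show ?thesis
  proof (intro exI[of _ "\<Inter>i\<in>I. U i"] conjI ballI)
    show "open (\<Inter>i\<in>I. U i)" using U assms(1) by (intro open_INT) auto
    show "A \<subseteq> (\<Inter>i\<in>I. U i)" using U by (intro INT_greatest) auto
    fix i assume i: "i \<in> I"
    then have "finite_measure (N i)" and s: "sets (N i) = sets borel"
      using assms(2) by (auto simp: radon_finite_def)
    then interpret finite_measure "N i" by simp
    have "measure (N i) ((\<Inter>i\<in>I. U i) - A) \<le> measure (N i) (U i - A)"
      using i U[OF i] assms(3) s by (intro finite_measure_mono) auto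
    then show "measure (N i) ((\<Inter>i\<in>I. U i) - A) < \<epsilon>" using U[OF i] by simp
  qed
qed

text \<open>The difference between \<open>f\<close> and the indicator of \<open>C\<close> lives on
  \<open>U - C\<close> and is at most 1 there; the factor 4 counts the parts.\<close>

lemma cint_urysohn_approx:
  fixes \<kappa> :: "'a::t2_space set \<Rightarrow> complex"
  assumes cm: "complex_measure \<kappa>" and C: "compact C" and U: "open U" "C \<subseteq> U"
    and d: "\<And>k. k < 4 \<Longrightarrow> measure (dirpart \<kappa> k) (U - C) < \<delta>"
    and f: "f \<in> Cc01" "\<And>x. x \<in> C \<Longrightarrow> f x = 1" "\<And>x. x \<notin> U \<Longrightarrow> f x = 0"
  shows "norm (cint \<kappa> (\<lambda>x. of_real (f x)) - \<kappa> C) \<le> 4 * \<delta>"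
proof -
  note fD = Cc01D[OF f(1)]
  have Cb: "C \<in> sets borel" "U - C \<in> sets borel" using C U compact_borel by auto
  have b1: "(\<lambda>x. complex_of_real (f x)) \<in> bborel" using fD(2,5) by (rule bborel_of_real)
  have b2: "(\<lambda>x. complex_of_real (indicator C x)) \<in> bborel"
    using Cb by (intro bborel_of_real[where B=1] borel_measurable_indicator) (auto split: split_indicator)
  have "norm (cint \<kappa> (\<lambda>x. of_real (f x)) - \<kappa> C) = norm (cint \<kappa> (\<lambda>x. of_real (f x) - of_real (indicator C x)))"
    using cint_diff[OF cm b1 b2] cint_indicator[OF cm Cb(1)] by simp
  also have "\<dots> \<le> (\<Sum>k<4. \<integral>x. norm (complex_of_real (f x) - of_real (indicator C x)) \<partial>dirpart \<kappa> k)"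
    by (rule norm_cint_le_parts[OF cm bborel_diff[OF b1 b2]])
  also have "\<dots> \<le> (\<Sum>k<(4::nat). \<delta>)"
  proof (rule sum_mono)
    fix k :: nat assume "k \<in> {..<4}"
    interpret finite_measure "dirpart \<kappa> k" by (rule finite_measure_dirpart[OF cm])
    have le: "norm (complex_of_real (f x) - of_real (indicator C x)) \<le> indicator (U - C) x" for x
    proof -
      have "norm (complex_of_real (f x) - of_real (indicator C x)) = \<bar>f x - indicator C x\<bar>"
        by (metis norm_of_real of_real_diff)
      also have "\<dots> \<le> indicator (U - C) x"
        using fD(3,4)[of x] f(2,3)[of x] U(2) by (auto split: split_indicator)
      finally show ?thesis .
    qed
    have "(\<integral>x. norm (complex_of_real (f x) - of_real (indicator C x)) \<partial>dirpart \<kappa> k) \<le> (\<integral>x. indicator (U - C) x \<partial>dirpart \<kappa> k)"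
      using le Cb(2) by (intro integral_mono integrable_norm integrable_dirpart[OF cm] bborel_diff b1 b2)
        (auto intro!: integrable_real_indicator simp: emeasure_eq_measure)
    also have "\<dots> \<le> \<delta>" using d[of k] \<open>k \<in> {..<4}\<close> by simp
    finally show "(\<integral>x. norm (complex_of_real (f x) - of_real (indicator C x)) \<partial>dirpart \<kappa> k) \<le> \<delta>" .
  qed
  finally show ?thesis by simp
qed

text \<open>Partition members shrink to disjoint compact sets, which have disjoint neighbourhoods
  and hence Urysohn functions with disjoint supports. Sums with complex weights keep every test
  function in \<open>[0,1]\<close>, and such bounds are inherited by weak limits.\<close>

lemma mnorm_le_Cc01:
  fixes \<kappa> :: "'a::t2_space set \<Rightarrow> complex"
  assumes lc: "locally_compact_space (euclidean :: 'a topology)"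
    and \<kappa>: "\<kappa> \<in> MK" and "0 \<le> c"
    and bound: "\<And>(P::'a set set) f z. finite P \<Longrightarrow> (\<And>B. B \<in> P \<Longrightarrow> f B \<in> Cc01) \<Longrightarrow> (\<And>B. B \<in> P \<Longrightarrow> norm (z B) \<le> 1) \<Longrightarrow>
      (\<And>B B' x. B \<in> P \<Longrightarrow> B' \<in> P \<Longrightarrow> B \<noteq> B' \<Longrightarrow> f B x = 0 \<or> f B' x = 0) \<Longrightarrow>
      norm (\<Sum>B\<in>P. z B * cint \<kappa> (\<lambda>x. of_real (f B x))) \<le> c"
  shows "mnorm \<kappa> \<le> ennreal c"
  unfolding mnorm_def tvar_def
proof (rule SUP_least)
  note cm = MK_complex_measure[OF \<kappa>]
  fix P :: "'a set set" assume "P \<in> {P. finite P \<and> disjoint P \<and> P \<subseteq> sets borel \<and> \<Union>P \<subseteq> UNIV}"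
  then have P: "finite P" "disjoint P" "P \<subseteq> sets borel" by auto
  have "(\<Sum>B\<in>P. norm (\<kappa> B)) \<le> c"
  proof (rule field_le_epsilon)
    fix \<epsilon> :: real assume "0 < \<epsilon>"
    \<comment> \<open>Per member, \<open>4 * \<delta>\<close> is lost by shrinking \<open>B\<close>
      to \<open>C B\<close> and another \<open>4 * \<delta>\<close> by replacing the indicator with
      \<open>f B\<close>.\<close>
    define \<delta> where "\<delta> = \<epsilon> / (8 * (card P + 1))"
    have "0 < \<delta>" using \<open>0 < \<epsilon>\<close> unfolding \<delta>_def by (intro divide_pos_pos) auto
    have "\<exists>C. compact C \<and> C \<subseteq> B \<and> (\<forall>k\<in>{..<4::nat}. measure (dirpart \<kappa> k) (B - C) < \<delta>)" if "B \<in> P" for B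
      using that P(3) \<open>0 < \<delta>\<close> by (intro radon_finite_common_compact radon_finite_dirpart \<kappa>) auto
    then obtain C where C: "\<And>B. B \<in> P \<Longrightarrow> compact (C B) \<and> C B \<subseteq> B \<and> (\<forall>k\<in>{..<4::nat}. measure (dirpart \<kappa> k) (B - C B) < \<delta>)"
      by metis
    have "\<exists>U. (\<forall>B\<in>P. open (U B) \<and> C B \<subseteq> U B) \<and> (\<forall>B\<in>P. \<forall>B'\<in>P. B \<noteq> B' \<longrightarrow> U B \<inter> U B' = {})"
    proof (rule disjoint_compact_nbhds[OF P(1)])
      fix B B' assume "B \<in> P" "B' \<in> P" "B \<noteq> B'"
      then show "C B \<inter> C B' = {}" using C[of B] C[of B'] disjointD[OF P(2), of B B'] by auto
    qed (use C in auto)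
    then obtain U where U: "\<And>B. B \<in> P \<Longrightarrow> open (U B) \<and> C B \<subseteq> U B"
      "\<And>B B'. B \<in> P \<Longrightarrow> B' \<in> P \<Longrightarrow> B \<noteq> B' \<Longrightarrow> U B \<inter> U B' = {}" by metis
    have "\<exists>V. open V \<and> C B \<subseteq> V \<and> (\<forall>k\<in>{..<4::nat}. measure (dirpart \<kappa> k) (V - C B) < \<delta>)" if "B \<in> P" for B
      using C[OF that] \<open>0 < \<delta>\<close> by (intro radon_finite_common_open radon_finite_dirpart \<kappa> compact_borel) auto
    then obtain V where V: "\<And>B. B \<in> P \<Longrightarrow> open (V B) \<and> C B \<subseteq> V B \<and> (\<forall>k\<in>{..<4::nat}. measure (dirpart \<kappa> k) (V B - C B) < \<delta>)"
      by metis
    have "\<exists>f. f \<in> Cc01 \<and> (\<forall>x\<in>C B. f x = 1) \<and> (\<forall>x. x \<notin> U B \<inter> V B \<longrightarrow> f x = 0)" if B: "B \<in> P" for B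
    proof -
      have "compact (C B)" "C B \<subseteq> U B \<inter> V B" "open (U B \<inter> V B)" using C[OF B] U(1)[OF B] V[OF B] by auto
      from urysohn_Cc01[OF lc this] show ?thesis by metis
    qed
    then obtain f where f: "\<And>B. B \<in> P \<Longrightarrow> f B \<in> Cc01 \<and> (\<forall>x\<in>C B. f B x = 1) \<and> (\<forall>x. x \<notin> U B \<inter> V B \<longrightarrow> f B x = 0)"
      by metis
    have e1: "norm (cint \<kappa> (\<lambda>x. of_real (f B x)) - \<kappa> (C B)) \<le> 4 * \<delta>" if B: "B \<in> P" for B
      by (rule cint_urysohn_approx[OF cm, where U="V B"]) (use C[OF B] V[OF B] f[OF B] in auto)
    have e2: "norm (\<kappa> B) \<le> norm (\<kappa> (C B)) + 4 * \<delta>" if B: "B \<in> P" for B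
    proof -
      have Bb: "B \<in> sets borel" "C B \<in> sets borel" using B P(3) C[OF B] compact_borel by auto
      have "\<kappa> (C B \<union> (B - C B)) = \<kappa> (C B) + \<kappa> (B - C B)"
        using Bb by (intro complex_measure_Un[OF cm]) auto
      moreover have "C B \<union> (B - C B) = B" using C[OF B] by auto
      moreover have "norm (\<kappa> (B - C B)) \<le> (\<Sum>k<4. measure (dirpart \<kappa> k) (B - C B))"
        using Bb by (intro norm_le_parts[OF cm]) auto
      moreover have "\<dots> \<le> (\<Sum>k<(4::nat). \<delta>)" using C[OF B] by (intro sum_mono) (auto intro: less_imp_le)
      ultimately show ?thesis using norm_triangle_ineq[of "\<kappa> (C B)" "\<kappa> (B - C B)"] by simp
    qed
    \<comment> \<open>Weights that turn all values into their moduli; \<open>sgn 0 = 0\<close>, so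
      the modulus is at most 1 rather than equal to 1.\<close>
    define z where "z B = cnj (sgn (\<kappa> (C B)))" for B
    have z1: "norm (z B) \<le> 1" for B unfolding z_def by (simp add: norm_sgn)
    have zk: "z B * \<kappa> (C B) = of_real (norm (\<kappa> (C B)))" for B
    proof -
      have "z B * \<kappa> (C B) = (\<kappa> (C B) * cnj (\<kappa> (C B))) / norm (\<kappa> (C B))"
        unfolding z_def sgn_eq by simp
      then show ?thesis by (simp add: complex_norm_square[symmetric] power2_eq_square)
    qed
    have "(\<Sum>B\<in>P. norm (\<kappa> (C B))) = norm (\<Sum>B\<in>P. z B * \<kappa> (C B))"
      unfolding zk of_real_sum[symmetric] norm_of_real by (simp add: sum_nonneg)
    also have "(\<Sum>B\<in>P. z B * \<kappa> (C B)) = (\<Sum>B\<in>P. z B * cint \<kappa> (\<lambda>x. of_real (f B x))) -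
        (\<Sum>B\<in>P. z B * (cint \<kappa> (\<lambda>x. of_real (f B x)) - \<kappa> (C B)))"
      by (simp add: sum_subtractf[symmetric] algebra_simps)
    also have "norm \<dots> \<le> norm (\<Sum>B\<in>P. z B * cint \<kappa> (\<lambda>x. of_real (f B x))) +
        norm (\<Sum>B\<in>P. z B * (cint \<kappa> (\<lambda>x. of_real (f B x)) - \<kappa> (C B)))" by (rule norm_triangle_ineq4)
    also have "norm (\<Sum>B\<in>P. z B * cint \<kappa> (\<lambda>x. of_real (f B x))) \<le> c"
    proof (rule bound[OF P(1) _ z1])
      fix B B' x assume B: "B \<in> P" "B' \<in> P" "B \<noteq> B'"
      then show "f B x = 0 \<or> f B' x = 0" using f[of B] f[of B'] U(2)[of B B'] by (metis IntD1 IntI empty_iff)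
    qed (use f in auto)
    also have "norm (\<Sum>B\<in>P. z B * (cint \<kappa> (\<lambda>x. of_real (f B x)) - \<kappa> (C B))) \<le> (\<Sum>B\<in>P. 4 * \<delta>)"
    proof (rule sum_norm_le)
      fix B assume B: "B \<in> P"
      have "norm (z B) * norm (cint \<kappa> (\<lambda>x. of_real (f B x)) - \<kappa> (C B)) \<le> 1 * (4 * \<delta>)"
        using z1[of B] e1[OF B] by (intro mult_mono) auto
      then show "norm (z B * (cint \<kappa> (\<lambda>x. of_real (f B x)) - \<kappa> (C B))) \<le> 4 * \<delta>" by (simp add: norm_mult)
    qed
    finally have "(\<Sum>B\<in>P. norm (\<kappa> (C B))) \<le> c + card P * (4 * \<delta>)" by simp
    moreover have "(\<Sum>B\<in>P. norm (\<kappa> B)) \<le> (\<Sum>B\<in>P. norm (\<kappa> (C B)) + 4 * \<delta>)" by (rule sum_mono[OF e2])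
    moreover have "card P * (8 * \<delta>) \<le> \<epsilon>"
    proof -
      have "card P * (8 * \<delta>) \<le> (card P + 1) * (8 * \<delta>)" using \<open>0 < \<delta>\<close> by (intro mult_right_mono) auto
      also have "\<dots> = \<epsilon>" unfolding \<delta>_def by (simp add: field_simps)
      finally show ?thesis .
    qed
    ultimately show "(\<Sum>B\<in>P. norm (\<kappa> B)) \<le> c + \<epsilon>" by (simp add: sum.distrib algebra_simps)
  qed
  then show "(\<Sum>B\<in>P. ennreal (norm (\<kappa> B))) \<le> ennreal c" by (simp add: sum_ennreal ennreal_leI)
qed

text \<open>The dual estimate of the norm with \<open>c = 0\<close>, applied to the difference. It
  provides the uniqueness of weak limits.\<close>

lemma MK_eqI:
  fixes \<mu> \<nu> :: "'a::t2_space set \<Rightarrow> complex"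
  assumes lc: "locally_compact_space (euclidean :: 'a topology)"
    and \<mu>: "\<mu> \<in> MK" and \<nu>: "\<nu> \<in> MK"
    and eq: "\<And>f. f \<in> Cc01 \<Longrightarrow> cint \<mu> (\<lambda>x. of_real (f x)) = cint \<nu> (\<lambda>x. of_real (f x))"
  shows "\<mu> = \<nu>"
proof -
  define \<kappa> where "\<kappa> = (\<lambda>A. 1 * \<mu> A + (-1) * \<nu> A)"
  have \<kappa>: "\<kappa> \<in> MK" unfolding \<kappa>_def by (rule MK_linear[OF \<mu> \<nu>])
  note cm = MK_complex_measure[OF \<mu>] MK_complex_measure[OF \<nu>] MK_complex_measure[OF \<kappa>]
  have "cint \<kappa> (\<lambda>x. of_real (f x)) = 0" if f: "f \<in> Cc01" for f
    unfolding \<kappa>_def using cint_linear_measure[OF cm[unfolded \<kappa>_def] Cc01D(2,3,4)[OF f]] eq[OF f] by simp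
  then have "mnorm \<kappa> \<le> ennreal 0"
    by (intro mnorm_le_Cc01[OF lc \<kappa>]) auto
  then have z: "mnorm \<kappa> = 0" by simp
  have "\<kappa> A = 0" for A
  proof (cases "A \<in> sets borel")
    case True
    then have "ennreal (norm (\<kappa> A)) \<le> mnorm \<kappa>"
      unfolding mnorm_def by (intro norm_le_tvar complex_measure_empty cm) auto
    then show ?thesis using z by simp
  qed (rule complex_measure_outside[OF cm(3)])
  then show ?thesis unfolding \<kappa>_def by (auto simp: fun_eq_iff)
qed

section \<open>Mixtures of measures\<close>

definition mix :: "'a::topological_space measure \<Rightarrow> ('a \<Rightarrow> 'a measure) \<Rightarrow> 'a measure" where
  "mix M k = measure_of UNIV (sets borel) (\<lambda>A. \<integral>\<^sup>+y. emeasure (k y) A \<partial>M)"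

text \<open>A kernel is assumed lower semicontinuous on open sets: this implies measurability on all
  Borel sets and, through \<open>tau_additive\<close>, regularity of the mixture. Positivity of
  \<open>c\<close> permits scaling the kernel into \<open>[0,1]\<close>.\<close>

locale mixture =
  fixes M :: "'a::t2_space measure" and k :: "'a \<Rightarrow> 'a measure" and c :: real
  assumes M: "radon_finite M"
    and k: "\<And>y. radon_finite (k y)" "\<And>y. measure (k y) UNIV \<le> c" and c: "0 < c"
    and lsc: "\<And>U t. open U \<Longrightarrow> open {y. t < measure (k y) U}"
begin

lemma fM: "finite_measure M" and sM: "sets M = sets borel"
  using M by (auto simp: radon_finite_def)

lemma fk: "finite_measure (k y)" and sk: "sets (k y) = sets borel"
  using k(1)[of y] by (auto simp: radon_finite_def)

lemma measure_k_le: "measure (k y) A \<le> c"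
proof -
  interpret finite_measure "k y" by (rule fk)
  have "measure (k y) A \<le> measure (k y) (space (k y))" by (rule bounded_measure)
  then show ?thesis using k(2)[of y] sets_eq_imp_space_eq[OF sk[of y]] by simp
qed

lemma measurable_measure_k: "A \<in> sets borel \<Longrightarrow> (\<lambda>y. measure (k y) A) \<in> borel_measurable borel"
proof -
  assume "A \<in> sets borel"
  then have A: "A \<in> sigma_sets UNIV {S. open S}" by (simp add: borel_def)
  \<comment> \<open>Dynkin induction from the open sets; the complement step uses that the total
    mass, being the measure of an open set, is itself measurable in \<open>y\<close>.\<close>
  have "Int_stable {S :: 'a set. open S}" "{S :: 'a set. open S} \<subseteq> Pow UNIV" by (auto simp: Int_stable_def)
  then have "A \<in> sets borel \<and> (\<lambda>y. measure (k y) A) \<in> borel_measurable borel"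
    using A
  proof (induction rule: sigma_sets_induct_disjoint)
    case (basic A)
    then show ?case using lsc by (auto intro: lsc_borel)
  next
    case (compl A)
    have "measure (k y) (UNIV - A) = measure (k y) UNIV - measure (k y) A" for y
      using fk[of y] sk[of y] compl by (intro finite_measure.finite_measure_Diff) auto
    moreover have "(\<lambda>y. measure (k y) UNIV) \<in> borel_measurable borel" using lsc[of UNIV] by (intro lsc_borel) auto
    ultimately show ?case using compl by auto
  next
    case (union F)
    have "(\<lambda>n. measure (k y) (F n)) sums measure (k y) (\<Union>n. F n)" for y
      using union fk[of y] sk[of y] by (intro finite_measure.finite_measure_UNION) auto
    then have "measure (k y) (\<Union>n. F n) = (\<Sum>n. measure (k y) (F n))" for y by (simp add: sums_iff)
    then show ?case using union by (auto intro!: borel_measurable_suminf)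
  qed auto
  then show ?thesis by simp
qed

lemma integrable_measure_k: "A \<in> sets borel \<Longrightarrow> integrable M (\<lambda>y. measure (k y) A)"
  using measure_k_le by (intro integrable_bounded_borel[OF fM sM measurable_measure_k, of _ c]) auto

lemma sets_mix: "sets (mix M k) = sets borel"
  unfolding mix_def using sets.sigma_sets_eq[of "borel :: 'a measure"] by simp

lemma emeasure_mix:
  assumes A: "A \<in> sets borel"
  shows "emeasure (mix M k) A = ennreal (\<integral>y. measure (k y) A \<partial>M)"
proof -
  have em: "emeasure (k y) A = ennreal (measure (k y) A)" for y A
    using fk[of y] by (rule finite_measure.emeasure_eq_measure)
  have ek: "(\<lambda>y. emeasure (k y) A) \<in> borel_measurable M" if "A \<in> sets borel" for A
    unfolding em using measurable_measure_k[OF that] sM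
    by (intro measurable_compose[OF _ measurable_ennreal]) (simp cong: measurable_cong_sets)
  have "countably_additive (sets borel) (\<lambda>A. \<integral>\<^sup>+y. emeasure (k y) A \<partial>M)"
  proof (rule countably_additiveI)
    fix F :: "nat \<Rightarrow> 'a set" assume F: "range F \<subseteq> sets borel" "disjoint_family F"
    have "(\<Sum>i. \<integral>\<^sup>+y. emeasure (k y) (F i) \<partial>M) = (\<integral>\<^sup>+y. (\<Sum>i. emeasure (k y) (F i)) \<partial>M)"
      using F by (intro nn_integral_suminf[symmetric] ek) auto
    also have "\<dots> = (\<integral>\<^sup>+y. emeasure (k y) (\<Union>i. F i) \<partial>M)"
      using F sk by (intro nn_integral_cong suminf_emeasure) auto
    finally show "(\<Sum>i. \<integral>\<^sup>+y. emeasure (k y) (F i) \<partial>M) = (\<integral>\<^sup>+y. emeasure (k y) (\<Union>i. F i) \<partial>M)" .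
  qed
  then have "emeasure (mix M k) A = (\<integral>\<^sup>+y. emeasure (k y) A \<partial>M)"
    unfolding mix_def using A sets.sigma_algebra_axioms[of "borel :: 'a measure"]
    by (intro emeasure_measure_of_sigma) (auto simp: positive_def)
  also have "\<dots> = ennreal (\<integral>y. measure (k y) A \<partial>M)"
    unfolding em using integrable_measure_k[OF A] by (intro nn_integral_eq_integral) auto
  finally show ?thesis .
qed

lemma finite_measure_mix: "finite_measure (mix M k)"
  using emeasure_mix[of UNIV] sets_eq_imp_space_eq[OF sets_mix] by (intro finite_measureI) simp

lemma measure_mix: "A \<in> sets borel \<Longrightarrow> measure (mix M k) A = (\<integral>y. measure (k y) A \<partial>M)"
  unfolding measure_def[of "mix M k"] by (simp add: emeasure_mix)

text \<open>The relatively compact open sets with closure in \<open>U\<close> are directed under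
  union, and by regularity of each kernel measure they exhaust \<open>U\<close> for every
  \<open>y\<close>. \<open>tau_additive\<close> moves this supremum outside the integral.\<close>

lemma radon_finite_mix:
  assumes lc: "locally_compact_space (euclidean :: 'a topology)"
  shows "radon_finite (mix M k)"
proof (rule radon_finiteI_open[OF finite_measure_mix sets_mix])
  fix U :: "'a set" and \<epsilon> :: real assume U: "open U" and "0 < \<epsilon>"
  let ?I = "{V. open V \<and> compact (closure V) \<and> closure V \<subseteq> U}"
  have Ib: "V \<in> sets borel" if "V \<in> ?I" for V using that by auto
  have mono: "measure (k y) A \<le> measure (k y) B" if "A \<subseteq> B" "B \<in> sets borel" for A B y
    using that fk[of y] sk[of y] by (intro finite_measure.finite_measure_mono) auto
  \<comment> \<open>Dividing by \<open>c\<close> brings the integrands below 1; an error of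
    \<open>\<epsilon> / (2 * c)\<close> becomes \<open>\<epsilon> / 2\<close> when the scaling is
    undone.\<close>
  have "\<exists>V\<in>?I. (\<integral>y. measure (k y) U / c \<partial>M) - \<epsilon> / (2 * c) \<le> (\<integral>y. measure (k y) V / c \<partial>M)"
  proof (rule tau_additive[OF M, where G="\<lambda>V y. measure (k y) V / c"])
    show "?I \<noteq> {}" by (auto intro!: exI[of _ "{}"])
    fix V W assume VW: "V \<in> ?I" "W \<in> ?I"
    show "\<exists>X\<in>?I. \<forall>y. measure (k y) V / c \<le> measure (k y) X / c \<and> measure (k y) W / c \<le> measure (k y) X / c"
      using VW c by (intro bexI[of _ "V \<union> W"]) (auto intro!: divide_right_mono mono)
  next
    fix V t assume "V \<in> ?I"
    then have "open {y. t * c < measure (k y) V}" by (intro lsc) auto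
    then show "open {y. t < measure (k y) V / c}" using c by (simp add: pos_less_divide_eq)
  next
    fix V y assume "V \<in> ?I"
    then have "V \<subseteq> U" using closure_subset[of V] by auto
    then show "0 \<le> measure (k y) V / c" "measure (k y) V / c \<le> measure (k y) U / c"
      using c U by (auto intro!: divide_right_mono mono)
  next
    fix y
    show "measure (k y) U / c \<le> 1" using measure_k_le[of y U] c by simp
  next
    fix y t assume "t < measure (k y) U / c"
    then have "0 < measure (k y) U - t * c" using c by (simp add: pos_less_divide_eq)
    then obtain C where C: "compact C" "C \<subseteq> U" "measure (k y) (U - C) < measure (k y) U - t * c"
      using k(1)[of y] U unfolding radon_finite_def by (meson borel_open)
    obtain V where V: "open V" "C \<subseteq> V" "compact (closure V)" "closure V \<subseteq> U"
      using compact_closure_nbhd[OF lc C(1,2) U] by metis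
    have "measure (k y) (U - C) = measure (k y) U - measure (k y) C"
      using C U fk[of y] sk[of y] by (intro finite_measure.finite_measure_Diff) (auto intro: compact_borel)
    then have "t * c < measure (k y) V" using mono[OF V(2), of y] V(1) C(3) by simp
    then show "\<exists>V\<in>?I. t < measure (k y) V / c" using V c by (intro bexI[of _ V]) (auto simp: pos_less_divide_eq)
  next
    show "0 < \<epsilon> / (2 * c)" using \<open>0 < \<epsilon>\<close> c by simp
  qed
  then obtain V where V: "V \<in> ?I" "(\<integral>y. measure (k y) U / c \<partial>M) - \<epsilon> / (2 * c) \<le> (\<integral>y. measure (k y) V / c \<partial>M)"
    by (elim bexE)
  then have "measure (mix M k) U / c - \<epsilon> / (2 * c) \<le> measure (mix M k) V / c"
    using measure_mix[of U] measure_mix[OF Ib[OF V(1)]] U by simp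
  then have "measure (mix M k) U - \<epsilon> / 2 \<le> measure (mix M k) V"
  proof -
    assume "measure (mix M k) U / c - \<epsilon> / (2 * c) \<le> measure (mix M k) V / c"
    then have "(measure (mix M k) U - \<epsilon> / 2) / c \<le> measure (mix M k) V / c" by (simp add: diff_divide_distrib)
    then show ?thesis using c by (simp only: divide_le_cancel)
  qed
  moreover have "measure (mix M k) V \<le> measure (mix M k) (closure V)"
    using V sets_mix by (intro finite_measure.finite_measure_mono[OF finite_measure_mix] closure_subset) auto
  moreover have "measure (mix M k) (U - closure V) = measure (mix M k) U - measure (mix M k) (closure V)"
    using V U sets_mix by (intro finite_measure.finite_measure_Diff[OF finite_measure_mix]) auto
  ultimately show "\<exists>C. compact C \<and> C \<subseteq> U \<and> measure (mix M k) (U - C) < \<epsilon>"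
    using V \<open>0 < \<epsilon>\<close> by (intro exI[of _ "closure V"]) auto
qed

text \<open>Layer sums reduce the integrand to level sets, where the mixture is known by
  \<open>measure_mix\<close>; dominated convergence, with the constant \<open>c\<close> as majorant,
  does the rest.\<close>

lemma integral_mix:
  fixes f :: "'a \<Rightarrow> real"
  assumes f: "f \<in> borel_measurable borel" and r: "\<And>x. 0 \<le> f x" "\<And>x. f x \<le> 1"
  shows "(\<lambda>y. \<integral>x. f x \<partial>k y) \<in> borel_measurable borel"
    and "(\<integral>x. f x \<partial>mix M k) = (\<integral>y. (\<integral>x. f x \<partial>k y) \<partial>M)"
proof -
  define S where "S n N = (\<Sum>j=1..n. measure N {x. real j / real n < f x}) / n" for n :: nat and N :: "'a measure"
  have lim: "(\<lambda>n. S n N) \<longlonglongrightarrow> (\<integral>x. f x \<partial>N)" if "finite_measure N" "sets N = sets borel" for N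
    unfolding S_def by (rule layer_sum_tendsto[OF that f r])
  have mS: "(\<lambda>y. S n (k y)) \<in> borel_measurable borel" for n
    unfolding S_def by (intro borel_measurable_divide borel_measurable_sum measurable_measure_k level_set_borel f) auto
  show meas: "(\<lambda>y. \<integral>x. f x \<partial>k y) \<in> borel_measurable borel"
    by (rule borel_measurable_LIMSEQ_real[where u="\<lambda>n y. S n (k y)"]) (auto intro: lim[OF fk sk] mS)
  have bS: "\<bar>S n (k y)\<bar> \<le> c" for n y
  proof -
    have "(\<Sum>j=1..n. measure (k y) {x. real j / real n < f x}) \<le> (\<Sum>j=1..n. c)"
      by (intro sum_mono measure_k_le)
    then have "S n (k y) \<le> c"
      unfolding S_def using c by (cases "n = 0") (auto simp: divide_le_eq mult.commute)
    moreover have "0 \<le> S n (k y)" unfolding S_def by (intro divide_nonneg_nonneg sum_nonneg) auto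
    ultimately show ?thesis by simp
  qed
  interpret M: finite_measure M by (rule fM)
  have "(\<lambda>n. \<integral>y. S n (k y) \<partial>M) \<longlonglongrightarrow> (\<integral>y. (\<integral>x. f x \<partial>k y) \<partial>M)"
  proof (rule integral_dominated_convergence[where w="\<lambda>_. c"])
    show "(\<lambda>y. \<integral>x. f x \<partial>k y) \<in> borel_measurable M" using meas sM by (simp cong: measurable_cong_sets)
    show "(\<lambda>y. S n (k y)) \<in> borel_measurable M" for n using mS[of n] sM by (simp cong: measurable_cong_sets)
  qed (use bS lim[OF fk sk] in auto)
  moreover have "(\<integral>y. S n (k y) \<partial>M) = S n (mix M k)" for n
  proof -
    have "(\<integral>y. S n (k y) \<partial>M) = (\<Sum>j=1..n. \<integral>y. measure (k y) {x. real j / real n < f x} \<partial>M) / n"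
      unfolding S_def
      by (subst Bochner_Integration.integral_divide_zero, subst Bochner_Integration.integral_sum)
         (auto intro!: integrable_measure_k level_set_borel f)
    then show ?thesis unfolding S_def by (simp add: measure_mix level_set_borel f)
  qed
  ultimately have "(\<lambda>n. S n (mix M k)) \<longlonglongrightarrow> (\<integral>y. (\<integral>x. f x \<partial>k y) \<partial>M)" by simp
  then show "(\<integral>x. f x \<partial>mix M k) = (\<integral>y. (\<integral>x. f x \<partial>k y) \<partial>M)"
    using LIMSEQ_unique lim[OF finite_measure_mix sets_mix] by blast
qed

end

section \<open>Convolution on a hypergroup\<close>

locale hypergroup_space =
  fixes conv :: "'a::t2_space \<Rightarrow> 'a \<Rightarrow> 'a measure" and iv :: "'a \<Rightarrow> 'a" and e :: 'a
  assumes hyp: "hypergroup conv iv e"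
begin

lemma lc: "locally_compact_space (euclidean :: 'a topology)"
  and prob_conv: "prob_space (conv x y)"
  and radon_pos_conv: "radon_pos (conv x y)"
  and compact_msupp: "compact (msupp (conv x y))"
  and conv_assoc: "A \<in> sets borel \<Longrightarrow>
        (\<integral>u. measure (conv u z) A \<partial>conv x y) = (\<integral>v. measure (conv x v) A \<partial>conv y z)"
  and conv_continuous: "f \<in> Cc \<Longrightarrow> continuous_on UNIV (\<lambda>(x,y). \<integral>t. f t \<partial>conv x y)"
  and msupp_upper: "open U \<Longrightarrow> open {(x,y). msupp (conv x y) \<subseteq> U}"
  and iv_continuous: "continuous_on UNIV iv"
  and iv_iv: "iv (iv x) = x"
  and conv_iv: "conv (iv y) (iv x) = distr (conv x y) borel iv"
  and e_msupp: "e \<in> msupp (conv x y) \<longleftrightarrow> y = iv x"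
proof -
  note r1 = hyp[unfolded hypergroup_def]
  note r2 = r1[THEN conjunct2]
  note r3 = r2[THEN conjunct2]
  note r4 = r3[THEN conjunct2]
  note r5 = r4[THEN conjunct2]
  note r7 = r5[THEN conjunct2, THEN conjunct2]
  note r8 = r7[THEN conjunct2]
  note r9 = r8[THEN conjunct2]
  show "locally_compact_space (euclidean :: 'a topology)" using r1 by (rule conjunct1)
  show "prob_space (conv x y)" "radon_pos (conv x y)" "compact (msupp (conv x y))"
    using r2[THEN conjunct1] by simp_all
  show "(\<integral>u. measure (conv u z) A \<partial>conv x y) = (\<integral>v. measure (conv x v) A \<partial>conv y z)" if "A \<in> sets borel"
    using r3[THEN conjunct1] that by simp
  show "continuous_on UNIV (\<lambda>(x,y). \<integral>t. f t \<partial>conv x y)" if "f \<in> Cc"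
    using r4[THEN conjunct1] that by simp
  show "open {(x,y). msupp (conv x y) \<subseteq> U}" if "open U"
    using r5[THEN conjunct1] that by simp
  show "continuous_on UNIV iv" using r7 by (rule conjunct1)
  show "iv (iv x) = x" using r8[THEN conjunct1] by simp
  show "conv (iv y) (iv x) = distr (conv x y) borel iv" using r9[THEN conjunct1] by simp
  show "e \<in> msupp (conv x y) \<longleftrightarrow> y = iv x" using r9[THEN conjunct2] by simp
qed

lemma sets_conv: "sets (conv x y) = sets borel"
  using radon_pos_conv by (simp add: radon_pos_def)

lemma space_conv: "space (conv x y) = UNIV"
  using sets_eq_imp_space_eq[OF sets_conv] by simp

lemma finite_measure_conv: "finite_measure (conv x y)"
  using prob_conv by (rule prob_space.finite_measure)

lemma measure_conv_UNIV: "measure (conv x y) UNIV = 1"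
  using prob_space.prob_space[OF prob_conv] by (simp add: space_conv)

lemma measure_conv_le: "measure (conv x y) A \<le> 1"
  by (rule prob_space.prob_le_1[OF prob_conv])

lemma radon_finite_conv: "radon_finite (conv x y)"
proof (rule radon_finiteI_open[OF finite_measure_conv sets_conv])
  interpret finite_measure "conv x y" by (rule finite_measure_conv)
  fix U :: "'a set" and \<epsilon> :: real assume U: "open U" and "0 < \<epsilon>"
  have eq: "emeasure (conv x y) U = (SUP C\<in>{C. compact C \<and> C \<subseteq> U}. emeasure (conv x y) C)"
    using radon_pos_conv U unfolding radon_pos_def by blast
  have "\<exists>C. compact C \<and> C \<subseteq> U \<and> measure (conv x y) U - \<epsilon> < measure (conv x y) C"
  proof (rule ccontr)
    assume "\<not> ?thesis"
    then have le: "measure (conv x y) C \<le> measure (conv x y) U - \<epsilon>" if "compact C" "C \<subseteq> U" for C using that by auto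
    then have "emeasure (conv x y) U \<le> ennreal (measure (conv x y) U - \<epsilon>)"
      unfolding eq by (intro SUP_least) (auto simp: emeasure_eq_measure intro: ennreal_leI)
    moreover have "0 \<le> measure (conv x y) U - \<epsilon>" using le[of "{}"] by simp
    ultimately show False using \<open>0 < \<epsilon>\<close> by (simp add: emeasure_eq_measure ennreal_le_iff)
  qed
  then obtain C where C: "compact C" "C \<subseteq> U" "measure (conv x y) U - \<epsilon> < measure (conv x y) C" by blast
  have "measure (conv x y) (U - C) = measure (conv x y) U - measure (conv x y) C"
    using C U sets_conv by (intro finite_measure_Diff) (auto intro: compact_borel)
  then show "\<exists>C. compact C \<and> C \<subseteq> U \<and> measure (conv x y) (U - C) < \<epsilon>" using C by (intro exI[of _ C]) auto
qed

lemma integrable_conv: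
  fixes f :: "'a \<Rightarrow> real"
  assumes "f \<in> borel_measurable borel" "\<And>x. \<bar>f x\<bar> \<le> B"
  shows "integrable (conv x y) f"
  using assms by (intro integrable_bounded_borel[OF finite_measure_conv sets_conv]) auto

text \<open>A Urysohn function between a large compact subset and \<open>U\<close> has an integral
  that depends continuously on \<open>(x,y)\<close>, exceeds \<open>t\<close> at the given point,
  and never exceeds the measure of \<open>U\<close>.\<close>

lemma lsc_conv:
  assumes U: "open U"
  shows "open {(x,y). t < measure (conv x y) U}"
proof (subst open_subopen, safe)
  fix x0 y0 assume t: "t < measure (conv x0 y0) U"
  then have "0 < measure (conv x0 y0) U - t" by simp
  then obtain C where C: "compact C" "C \<subseteq> U" "measure (conv x0 y0) (U - C) < measure (conv x0 y0) U - t"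
    using radon_finite_conv[of x0 y0] U unfolding radon_finite_def by (meson borel_open)
  have "measure (conv x0 y0) (U - C) = measure (conv x0 y0) U - measure (conv x0 y0) C"
    using C U sets_conv by (intro finite_measure.finite_measure_Diff[OF finite_measure_conv]) (auto intro: compact_borel)
  then have tC: "t < measure (conv x0 y0) C" using C(3) by simp
  obtain f where f: "f \<in> Cc01" "\<And>x. x \<in> C \<Longrightarrow> f x = 1" "\<And>x. x \<notin> U \<Longrightarrow> f x = 0"
    using urysohn_Cc01[OF lc C(1,2) U] by metis
  note fD = Cc01D[OF f(1)]
  have ind: "integrable (conv x y) (indicator A :: 'a \<Rightarrow> real)" if "A \<in> sets borel" for A x y
    using that by (intro integrable_conv[where B=1]) (auto split: split_indicator)
  have I: "(\<integral>z. indicator A z \<partial>conv x y) = measure (conv x y) A" for A x y by (simp add: space_conv)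
  have "measure (conv x0 y0) C \<le> (\<integral>z. f z \<partial>conv x0 y0)"
    unfolding I[symmetric] using fD C f(2)
    by (intro integral_mono ind integrable_conv[where B=1]) (auto split: split_indicator intro: compact_borel)
  moreover have "(\<integral>z. f z \<partial>conv x y) \<le> measure (conv x y) U" for x y
    unfolding I[symmetric] using fD U f(3)
    by (intro integral_mono ind integrable_conv[where B=1]) (auto split: split_indicator)
  moreover have "open {p. t < (case p of (x,y) \<Rightarrow> \<integral>z. f z \<partial>conv x y)}"
    by (intro open_Collect_less continuous_intros conv_continuous fD(6))
  ultimately show "\<exists>T. open T \<and> (x0, y0) \<in> T \<and> T \<subseteq> {(x,y). t < measure (conv x y) U}"
    using tC by (intro exI[of _ "{p. t < (case p of (x,y) \<Rightarrow> \<integral>z. f z \<partial>conv x y)}"]) (auto intro: less_le_trans)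
qed

lemma lsc_conv_right: "open U \<Longrightarrow> open {y. t < measure (conv x y) U}"
  using open_vimage[OF lsc_conv[of U t], of "\<lambda>y. (x, y)"] by (simp add: continuous_on_Pair vimage_def)

lemma lsc_conv_left: "open U \<Longrightarrow> open {x. t < measure (conv x y) U}"
  using open_vimage[OF lsc_conv[of U t], of "\<lambda>x. (x, y)"] by (simp add: continuous_on_Pair vimage_def)

section \<open>Convolution of positive measures\<close>

lemma mixture_conv: "radon_finite m \<Longrightarrow> mixture m (conv x) 1"
  by unfold_locales (auto intro: radon_finite_conv lsc_conv_right simp: measure_conv_UNIV)

definition posconv :: "'a measure \<Rightarrow> 'a measure \<Rightarrow> 'a measure" where
  "posconv s m = mix s (\<lambda>x. mix m (conv x))"

text \<open>Every inner mixture has the mass of \<open>m\<close>; adding 1 to the bound keeps it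
  positive when \<open>m = 0\<close>. Lower semicontinuity in \<open>x\<close> is that of parametric
  integrals, because \<open>lsc_conv\<close> holds in both variables jointly.\<close>

lemma mixture_posconv:
  assumes s: "radon_finite s" and m: "radon_finite m"
  shows "mixture s (\<lambda>x. mix m (conv x)) (measure m UNIV + 1)"
proof unfold_locales
  have mm: "measure (mix m (conv x)) A = (\<integral>y. measure (conv x y) A \<partial>m)" if "A \<in> sets borel" for x A
    using that by (rule mixture.measure_mix[OF mixture_conv[OF m]])
  show "radon_finite (mix m (conv x))" for x by (rule mixture.radon_finite_mix[OF mixture_conv[OF m] lc])
  show "measure (mix m (conv x)) UNIV \<le> measure m UNIV + 1" for x
    using radon_finite_space[OF m] by (simp add: mm measure_conv_UNIV)
  show "0 < measure m UNIV + 1" by (simp add: add_nonneg_pos)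
  show "open {x. t < measure (mix m (conv x)) U}" if "open U" for U t
    using lsc_integral_parametric[OF m lsc_conv[OF that], of t] measure_conv_le that by (simp add: mm)
qed (rule s)

lemma radon_finite_posconv: "radon_finite s \<Longrightarrow> radon_finite m \<Longrightarrow> radon_finite (posconv s m)"
  unfolding posconv_def by (rule mixture.radon_finite_mix[OF mixture_posconv lc])

lemma measurable_integral_conv:
  fixes f :: "'a \<Rightarrow> real"
  assumes "f \<in> borel_measurable borel" "\<And>x. 0 \<le> f x" "\<And>x. f x \<le> 1"
  shows "(\<lambda>y. \<integral>t. f t \<partial>conv x y) \<in> borel_measurable borel"
proof -
  \<comment> \<open>The mixing measure does not occur in the conclusion, so any Radon measure
    serves; \<open>conv x x\<close> is one at hand.\<close>
  have "radon_finite (conv x x)" by (rule radon_finite_conv)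
  from mixture.integral_mix(1)[OF mixture_conv[OF this] assms] show ?thesis .
qed

lemma integral_conv_bounds:
  fixes f :: "'a \<Rightarrow> real"
  assumes "f \<in> borel_measurable borel" "\<And>x. 0 \<le> f x" "\<And>x. f x \<le> 1"
  shows "0 \<le> (\<integral>t. f t \<partial>conv x y)" "(\<integral>t. f t \<partial>conv x y) \<le> 1"
proof -
  show "0 \<le> (\<integral>t. f t \<partial>conv x y)" using assms(2) by (intro integral_nonneg_AE) auto
  have "(\<integral>t. f t \<partial>conv x y) \<le> (\<integral>t. 1 \<partial>conv x y)"
    using assms by (intro integral_mono integrable_conv[where B=1]) auto
  then show "(\<integral>t. f t \<partial>conv x y) \<le> 1" by (simp add: space_conv measure_conv_UNIV)
qed

lemma integral_posconv:
  fixes f :: "'a \<Rightarrow> real"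
  assumes s: "radon_finite s" and m: "radon_finite m"
    and f: "f \<in> borel_measurable borel" "\<And>x. 0 \<le> f x" "\<And>x. f x \<le> 1"
  shows "(\<lambda>x. \<integral>y. (\<integral>t. f t \<partial>conv x y) \<partial>m) \<in> borel_measurable borel"
    and "(\<integral>t. f t \<partial>posconv s m) = (\<integral>x. (\<integral>y. (\<integral>t. f t \<partial>conv x y) \<partial>m) \<partial>s)"
  using mixture.integral_mix[OF mixture_posconv[OF s m] f] mixture.integral_mix(2)[OF mixture_conv[OF m] f]
  by (simp_all add: posconv_def)

lemma abs_integral_integral_conv_le:
  fixes f :: "'a \<Rightarrow> real"
  assumes m: "finite_measure m" "sets m = sets borel"
    and f: "f \<in> borel_measurable borel" "\<And>x. 0 \<le> f x" "\<And>x. f x \<le> 1"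
  shows "\<bar>\<integral>y. (\<integral>t. f t \<partial>conv x y) \<partial>m\<bar> \<le> measure m UNIV"
proof -
  interpret finite_measure m by fact
  have sp: "space m = UNIV" using sets_eq_imp_space_eq[OF m(2)] by simp
  have "(\<integral>y. (\<integral>t. f t \<partial>conv x y) \<partial>m) \<le> (\<integral>y. 1 \<partial>m)"
    using integral_conv_bounds[OF f]
    by (intro integral_mono integrable_bounded_borel[OF m measurable_integral_conv[OF f], of _ 1]) auto
  moreover have "0 \<le> (\<integral>y. (\<integral>t. f t \<partial>conv x y) \<partial>m)"
    using integral_conv_bounds(1)[OF f] by (intro integral_nonneg_AE) auto
  ultimately show ?thesis by (simp add: sp)
qed

section \<open>Convolution of complex measures\<close>

context
  fixes \<sigma> \<nu> :: "'a set \<Rightarrow> complex"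
  assumes \<sigma>: "\<sigma> \<in> MK" and \<nu>: "\<nu> \<in> MK"
begin

lemma integral_conv_bborel:
  fixes f :: "'a \<Rightarrow> real"
  assumes f: "f \<in> borel_measurable borel" "\<And>x. 0 \<le> f x" "\<And>x. f x \<le> 1"
  shows "(\<lambda>x. complex_of_real (\<integral>y. (\<integral>t. f t \<partial>conv x y) \<partial>dirpart \<nu> k)) \<in> bborel"
proof (rule bborel_of_real)
  note rf = radon_finite_dirpart[OF \<nu>, of k]
  show "(\<lambda>x. \<integral>y. (\<integral>t. f t \<partial>conv x y) \<partial>dirpart \<nu> k) \<in> borel_measurable borel"
    by (rule integral_posconv(1)[OF rf rf f])
  show "\<bar>\<integral>y. (\<integral>t. f t \<partial>conv x y) \<partial>dirpart \<nu> k\<bar> \<le> measure (dirpart \<nu> k) UNIV" for x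
    by (rule abs_integral_integral_conv_le[OF finite_measure_dirpart[OF MK_complex_measure[OF \<nu>]] sets_dirpart f])
qed

lemma cint_conv_bborel:
  fixes f :: "'a \<Rightarrow> real"
  assumes f: "f \<in> borel_measurable borel" "\<And>x. 0 \<le> f x" "\<And>x. f x \<le> 1"
  shows "(\<lambda>x. cint \<nu> (\<lambda>y. of_real (\<integral>t. f t \<partial>conv x y))) \<in> bborel"
proof -
  have eq: "(\<lambda>x. cint \<nu> (\<lambda>y. of_real (\<integral>t. f t \<partial>conv x y))) =
      (\<lambda>x. \<Sum>k<4. \<i> ^ k * of_real (\<integral>y. (\<integral>t. f t \<partial>conv x y) \<partial>dirpart \<nu> k))"
    by (simp add: cint_dirpart fun_eq_iff)
  show ?thesis unfolding eq by (intro bborel_sum bborel_mult integral_conv_bborel f)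
qed

lemma cint_cint_conv:
  fixes f :: "'a \<Rightarrow> real"
  assumes f: "f \<in> borel_measurable borel" "\<And>x. 0 \<le> f x" "\<And>x. f x \<le> 1"
  shows "cint \<sigma> (\<lambda>x. cint \<nu> (\<lambda>y. of_real (\<integral>t. f t \<partial>conv x y))) =
    (\<Sum>(j,k)\<in>{..<4}\<times>{..<4}. \<i> ^ j * \<i> ^ k * of_real (\<integral>t. f t \<partial>posconv (dirpart \<sigma> j) (dirpart \<nu> k)))"
proof -
  let ?h = "\<lambda>k x. \<integral>y. (\<integral>t. f t \<partial>conv x y) \<partial>dirpart \<nu> k"
  have int: "integrable (dirpart \<sigma> j) (\<lambda>x. \<i> ^ k * complex_of_real (?h k x))" for j k
    by (intro integrable_dirpart[OF MK_complex_measure[OF \<sigma>]] bborel_mult integral_conv_bborel f)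
  have "cint \<sigma> (\<lambda>x. cint \<nu> (\<lambda>y. of_real (\<integral>t. f t \<partial>conv x y))) =
      (\<Sum>j<4. \<i> ^ j * (\<integral>x. (\<Sum>k<4. \<i> ^ k * complex_of_real (?h k x)) \<partial>dirpart \<sigma> j))"
    by (simp add: cint_dirpart)
  also have "\<dots> = (\<Sum>j<4. \<i> ^ j * (\<Sum>k<4. \<i> ^ k * of_real (\<integral>x. ?h k x \<partial>dirpart \<sigma> j)))"
    by (subst Bochner_Integration.integral_sum) (auto intro: int)
  also have "\<dots> = (\<Sum>j<4. \<Sum>k<4. \<i> ^ j * \<i> ^ k * of_real (\<integral>t. f t \<partial>posconv (dirpart \<sigma> j) (dirpart \<nu> k)))"
    by (simp add: sum_distrib_left mult.assoc integral_posconv(2)[OF radon_finite_dirpart[OF \<sigma>] radon_finite_dirpart[OF \<nu>] f])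
  finally show ?thesis by (simp add: sum.cartesian_product)
qed

text \<open>The pointwise formula for \<open>mconv\<close> says nothing yet about additivity or
  regularity. Written as a combination of sixteen positive convolutions, it inherits both.\<close>

lemma mconv_eq:
  "mconv conv \<sigma> \<nu> = (\<lambda>A. \<Sum>p\<in>{..<4}\<times>{..<4}. \<i> ^ fst p * \<i> ^ snd p *
     measure (posconv (dirpart \<sigma> (fst p)) (dirpart \<nu> (snd p))) A)"
proof
  fix A :: "'a set"
  have rf: "radon_finite (posconv (dirpart \<sigma> j) (dirpart \<nu> k))" for j k
    by (intro radon_finite_posconv radon_finite_dirpart \<sigma> \<nu>)
  show "mconv conv \<sigma> \<nu> A = (\<Sum>p\<in>{..<4}\<times>{..<4}. \<i> ^ fst p * \<i> ^ snd p *
     measure (posconv (dirpart \<sigma> (fst p)) (dirpart \<nu> (snd p))) A)"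
  proof (cases "A \<in> sets borel")
    case True
    have I: "(\<integral>z. indicator A z \<partial>conv x y) = measure (conv x y) A" for x y by (simp add: space_conv)
    have I': "(\<integral>t. indicator A t \<partial>posconv (dirpart \<sigma> j) (dirpart \<nu> k)) = measure (posconv (dirpart \<sigma> j) (dirpart \<nu> k)) A" for j k
      using radon_finite_space[OF rf] by simp
    show ?thesis
      unfolding mconv_def I[symmetric]
      by (subst cint_cint_conv) (use True in \<open>auto simp: I' case_prod_beta radon_finite_space[OF rf] split: split_indicator\<close>)
  next
    case False
    then have "measure (conv x y) A = 0" "measure (posconv (dirpart \<sigma> j) (dirpart \<nu> k)) A = 0" for x y j k
      using sets_conv rf[of j k] by (auto intro!: measure_notin_sets simp: radon_finite_def)
    then show ?thesis by (simp add: mconv_def cint_dirpart)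
  qed
qed

lemma mconv_MK: "mconv conv \<sigma> \<nu> \<in> MK"
  unfolding mconv_eq
  by (intro MK_combination) (auto intro: radon_finite_posconv[OF radon_finite_dirpart[OF \<sigma>] radon_finite_dirpart[OF \<nu>]])

text \<open>Extends the defining formula from indicators to functions. The sixteen convolutions are
  not the parts of \<open>mconv conv \<sigma> \<nu>\<close>, hence
  \<open>cint_eq_combination\<close>.\<close>

lemma cint_mconv:
  fixes f :: "'a \<Rightarrow> real"
  assumes f: "f \<in> borel_measurable borel" "\<And>x. 0 \<le> f x" "\<And>x. f x \<le> 1"
  shows "cint (mconv conv \<sigma> \<nu>) (\<lambda>t. of_real (f t)) = cint \<sigma> (\<lambda>x. cint \<nu> (\<lambda>y. of_real (\<integral>t. f t \<partial>conv x y)))"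
proof -
  have rf: "radon_finite (posconv (dirpart \<sigma> j) (dirpart \<nu> k))" for j k
    by (intro radon_finite_posconv radon_finite_dirpart \<sigma> \<nu>)
  have "cint (mconv conv \<sigma> \<nu>) (\<lambda>t. of_real (f t)) = (\<Sum>p\<in>{..<4}\<times>{..<4}. \<i> ^ fst p * \<i> ^ snd p *
      of_real (\<integral>t. f t \<partial>posconv (dirpart \<sigma> (fst p)) (dirpart \<nu> (snd p))))"
    by (rule cint_eq_combination[OF MK_complex_measure[OF mconv_MK] _ _ _ _ f])
       (use rf in \<open>auto simp: mconv_eq radon_finite_def\<close>)
  then show ?thesis using cint_cint_conv[OF f] by (simp add: case_prod_beta)
qed

lemma mconv_cint_indicator:
  "A \<in> sets borel \<Longrightarrow> (\<lambda>x. cint \<nu> (\<lambda>y. of_real (measure (conv x y) A))) \<in> bborel"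
  using cint_conv_bborel[of "indicator A"] by (simp add: space_conv)

text \<open>The phases of a partition sum are moved inside both integrals. The innermost sum has
  modulus at most 1, because \<open>conv x y\<close> is a probability measure and the sets are
  disjoint; the sharp bound \<open>norm_cint_le\<close> is then used for \<open>\<nu>\<close> and
  for \<open>\<sigma>\<close>.\<close>

lemma mnorm_mconv_le: "mnorm (mconv conv \<sigma> \<nu>) \<le> ennreal (enn2real (mnorm \<sigma>) * enn2real (mnorm \<nu>))"
  unfolding mnorm_def[of "mconv conv \<sigma> \<nu>"] tvar_def
proof (rule SUP_least)
  note cm = MK_complex_measure[OF \<sigma>] MK_complex_measure[OF \<nu>]
  fix P :: "'a set set" assume "P \<in> {P. finite P \<and> disjoint P \<and> P \<subseteq> sets borel \<and> \<Union>P \<subseteq> UNIV}"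
  then have P: "finite P" "disjoint P" "P \<subseteq> sets borel" by auto
  define z where "z B = cnj (sgn (mconv conv \<sigma> \<nu> B))" for B
  have z1: "norm (z B) \<le> 1" for B unfolding z_def by (simp add: norm_sgn)
  have zk: "z B * mconv conv \<sigma> \<nu> B = of_real (norm (mconv conv \<sigma> \<nu> B))" for B
  proof -
    have "z B * mconv conv \<sigma> \<nu> B = (mconv conv \<sigma> \<nu> B * cnj (mconv conv \<sigma> \<nu> B)) / norm (mconv conv \<sigma> \<nu> B)"
      unfolding z_def sgn_eq by simp
    then show ?thesis by (simp add: complex_norm_square[symmetric] power2_eq_square)
  qed
  have mb: "(\<lambda>y. complex_of_real (measure (conv x y) B)) \<in> bborel" if "B \<in> P" for x B
    using that P(3) measure_conv_le
    by (intro bborel_of_real[where B=1] mixture.measurable_measure_k[OF mixture_conv[OF radon_finite_conv]]) auto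
  define F where "F x = (\<Sum>B\<in>P. z B * cint \<nu> (\<lambda>y. of_real (measure (conv x y) B)))" for x
  have "norm (F x) \<le> 1 * enn2real (mnorm \<nu>)" for x
  proof -
    have "F x = cint \<nu> (\<lambda>y. \<Sum>B\<in>P. z B * of_real (measure (conv x y) B))"
      unfolding F_def by (simp add: cint_sum[OF cm(2)] cint_mult[OF cm(2)] bborel_mult mb)
    moreover have "norm (cint \<nu> (\<lambda>y. \<Sum>B\<in>P. z B * of_real (measure (conv x y) B))) \<le> 1 * enn2real (mnorm \<nu>)"
    proof (rule norm_cint_le[OF cm(2)])
      show "(\<lambda>y. \<Sum>B\<in>P. z B * complex_of_real (measure (conv x y) B)) \<in> borel_measurable borel"
        using bborel_sum[of P "\<lambda>B y. z B * complex_of_real (measure (conv x y) B)"] bborel_mult[OF mb]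
        by (auto simp: bborel_def)
      fix y
      interpret finite_measure "conv x y" by (rule finite_measure_conv)
      have "norm (\<Sum>B\<in>P. z B * complex_of_real (measure (conv x y) B)) \<le> (\<Sum>B\<in>P. measure (conv x y) B)"
        using z1 by (intro sum_norm_le) (auto simp: norm_mult intro: mult_left_le_one_le)
      also have "\<dots> = measure (conv x y) (\<Union>B\<in>P. B)"
        using P sets_conv by (intro finite_measure_finite_Union[symmetric])
          (auto simp: disjoint_family_on_def disjoint_def)
      also have "\<dots> \<le> 1" by (rule measure_conv_le)
      finally show "norm (\<Sum>B\<in>P. z B * complex_of_real (measure (conv x y) B)) \<le> 1" .
    qed
    ultimately show ?thesis by simp
  qed
  then have Fb: "norm (F x) \<le> enn2real (mnorm \<nu>)" for x by simp
  have Hb: "(\<lambda>x. cint \<nu> (\<lambda>y. of_real (measure (conv x y) B))) \<in> bborel" if "B \<in> P" for B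
    using that P(3) by (intro mconv_cint_indicator) auto
  have Fm: "F \<in> borel_measurable borel"
    unfolding F_def[abs_def]
    using bborel_sum[of P "\<lambda>B x. z B * cint \<nu> (\<lambda>y. of_real (measure (conv x y) B))"] bborel_mult[OF Hb]
    by (auto simp: bborel_def)
  have "(\<Sum>B\<in>P. norm (mconv conv \<sigma> \<nu> B)) = norm (\<Sum>B\<in>P. z B * mconv conv \<sigma> \<nu> B)"
    unfolding zk of_real_sum[symmetric] norm_of_real by (simp add: sum_nonneg)
  also have "(\<Sum>B\<in>P. z B * mconv conv \<sigma> \<nu> B) = cint \<sigma> F"
    unfolding F_def[abs_def] mconv_def by (simp add: cint_sum[OF cm(1)] cint_mult[OF cm(1)] bborel_mult Hb)
  also have "norm \<dots> \<le> enn2real (mnorm \<nu>) * enn2real (mnorm \<sigma>)"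
    by (rule norm_cint_le[OF cm(1) Fm Fb])
  finally show "(\<Sum>B\<in>P. ennreal (norm (mconv conv \<sigma> \<nu> B))) \<le> ennreal (enn2real (mnorm \<sigma>) * enn2real (mnorm \<nu>))"
    by (simp add: sum_ennreal ennreal_leI mult.commute)
qed

end

lemma mconv_linear:
  assumes \<sigma>: "\<sigma> \<in> MK" and \<mu>: "\<mu> \<in> MK" and \<nu>: "\<nu> \<in> MK"
  shows "mconv conv \<sigma> (\<lambda>A. a * \<mu> A + b * \<nu> A) = (\<lambda>A. a * mconv conv \<sigma> \<mu> A + b * mconv conv \<sigma> \<nu> A)"
proof
  fix A :: "'a set"
  note cm = MK_complex_measure[OF \<mu>] MK_complex_measure[OF \<nu>] MK_complex_measure[OF MK_linear[OF \<mu> \<nu>, of a b]]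
  show "mconv conv \<sigma> (\<lambda>A. a * \<mu> A + b * \<nu> A) A = a * mconv conv \<sigma> \<mu> A + b * mconv conv \<sigma> \<nu> A"
  proof (cases "A \<in> sets borel")
    case True
    have ms: "(\<lambda>y. measure (conv x y) A) \<in> borel_measurable borel" for x
      by (rule mixture.measurable_measure_k[OF mixture_conv[OF radon_finite_conv] True])
    have "cint (\<lambda>A. a * \<mu> A + b * \<nu> A) (\<lambda>y. of_real (measure (conv x y) A)) =
        a * cint \<mu> (\<lambda>y. of_real (measure (conv x y) A)) + b * cint \<nu> (\<lambda>y. of_real (measure (conv x y) A))" for x
      by (rule cint_linear_measure[OF cm ms]) (auto intro: measure_conv_le)
    then show ?thesis
      unfolding mconv_def
      by (simp add: cint_add[OF MK_complex_measure[OF \<sigma>]] cint_mult[OF MK_complex_measure[OF \<sigma>]]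
        bborel_mult mconv_cint_indicator[OF \<sigma> \<mu> True] mconv_cint_indicator[OF \<sigma> \<nu> True])
  next
    case False
    then have "measure (conv x y) A = 0" for x y
      using sets_conv by (auto intro!: measure_notin_sets)
    then show ?thesis by (simp add: mconv_def cint_dirpart)
  qed
qed

end

section \<open>Supports\<close>

text \<open>An uncountable union of open null sets may fail to be null in general. Here a compact
  subset is covered by finitely many of them, and inner regularity passes from compact subsets to
  \<open>U\<close>.\<close>

lemma measure_disjoint_msupp:
  fixes M :: "'a::t2_space measure"
  assumes M: "radon_finite M" and U: "open U" "U \<inter> msupp M = {}"
  shows "measure M U = 0"
proof -
  have fM: "finite_measure M" and sM: "sets M = sets borel" using M by (auto simp: radon_finite_def)
  interpret finite_measure M by fact
  have zero: "measure M C = 0" if C: "compact C" "C \<subseteq> U" for C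
  proof -
    have "\<exists>V. open V \<and> x \<in> V \<and> emeasure M V = 0" if "x \<in> C" for x
      using that C(2) U(2) unfolding msupp_def by (auto simp: zero_less_iff_neq_zero)
    then obtain V where V: "\<And>x. x \<in> C \<Longrightarrow> open (V x) \<and> x \<in> V x \<and> emeasure M (V x) = 0" by metis
    obtain D where D: "D \<subseteq> C" "finite D" "C \<subseteq> (\<Union>x\<in>D. V x)"
      using compactE_image[OF C(1), of C V] V by blast
    have oV: "open (V x)" if "x \<in> D" for x using D(1) V that by auto
    have "measure M C \<le> measure M (\<Union>x\<in>D. V x)"
      using D(3) borel_open[OF open_UN[of D V]] oV sM by (intro finite_measure_mono) auto
    also have "\<dots> \<le> (\<Sum>x\<in>D. measure M (V x))"
      using D(2) borel_open[OF oV] sM by (intro measure_UNION_le) auto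
    also have "\<dots> = 0" using D V by (intro sum.neutral) (auto simp: measure_def)
    finally show ?thesis using measure_nonneg[of M C] by linarith
  qed
  show ?thesis
  proof (rule ccontr)
    assume "measure M U \<noteq> 0"
    then have pos: "0 < measure M U" using measure_nonneg[of M U] by linarith
    then obtain C where C: "compact C" "C \<subseteq> U" "measure M (U - C) < measure M U"
      using M U(1) unfolding radon_finite_def by (meson borel_open)
    have "measure M (U - C) = measure M U - measure M C"
      using C U sM by (intro finite_measure_Diff) (auto intro: compact_borel)
    then show False using C(3) zero[OF C(1,2)] by simp
  qed
qed

lemma measure_pos_iff_msupp:
  fixes M :: "'a::t2_space measure"
  assumes M: "radon_finite M" and U: "open U"
  shows "0 < measure M U \<longleftrightarrow> msupp M \<inter> U \<noteq> {}"
proof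
  show "msupp M \<inter> U \<noteq> {}" if "0 < measure M U"
    using measure_disjoint_msupp[OF M U] that by (auto simp: Int_commute)
  assume "msupp M \<inter> U \<noteq> {}"
  then have "0 < emeasure M U" using U by (auto simp: msupp_def)
  moreover have "emeasure M U = ennreal (measure M U)"
    using M by (intro finite_measure.emeasure_eq_measure) (simp add: radon_finite_def)
  ultimately show "0 < measure M U" by simp
qed

text \<open>Lower semicontinuity makes \<open>{y. 0 < g y}\<close> open, and an open set has
  positive measure exactly when it meets the support.\<close>

lemma integral_pos_iff_msupp:
  fixes g :: "'a::t2_space \<Rightarrow> real"
  assumes M: "radon_finite M" and lsc: "\<And>t. open {y. t < g y}" and r: "\<And>y. 0 \<le> g y" "\<And>y. g y \<le> 1"
  shows "0 < (\<integral>y. g y \<partial>M) \<longleftrightarrow> (\<exists>y\<in>msupp M. 0 < g y)"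
proof -
  have fM: "finite_measure M" and sM: "sets M = sets borel" using M by (auto simp: radon_finite_def)
  interpret finite_measure M by fact
  have sp: "space M = UNIV" by (rule radon_finite_space[OF M])
  have gi: "integrable M g" using r by (intro integrable_bounded_borel[OF fM sM lsc_borel[OF lsc], of 1]) auto
  have ms: "{y. 0 < g y} \<in> sets M" using lsc[of 0] sM by simp
  have "(\<integral>y. g y \<partial>M) = 0 \<longleftrightarrow> (AE y in M. g y = 0)"
    using r by (intro integral_nonneg_eq_0_iff_AE[OF gi]) auto
  also have "\<dots> \<longleftrightarrow> (AE y in M. y \<notin> {y. 0 < g y})"
    using r(1) by (intro AE_cong) (auto simp: less_le)
  also have "\<dots> \<longleftrightarrow> emeasure M {y. 0 < g y} = 0"
    using AE_iff_measurable[OF ms, of "\<lambda>y. y \<notin> {y. 0 < g y}"] sp by simp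
  also have "\<dots> \<longleftrightarrow> measure M {y. 0 < g y} = 0" by (simp add: emeasure_eq_measure)
  also have "\<dots> \<longleftrightarrow> \<not> 0 < measure M {y. 0 < g y}" by (simp add: zero_less_measure_iff)
  also have "\<dots> \<longleftrightarrow> \<not> (\<exists>y\<in>msupp M. 0 < g y)"
    unfolding measure_pos_iff_msupp[OF M lsc] by auto
  finally have "(\<integral>y. g y \<partial>M) = 0 \<longleftrightarrow> \<not> (\<exists>y\<in>msupp M. 0 < g y)" .
  moreover have "0 \<le> (\<integral>y. g y \<partial>M)" using r by (intro integral_nonneg_AE) auto
  ultimately show ?thesis by (metis less_le)
qed

context hypergroup_space
begin

text \<open>The support map is compact-valued and upper semicontinuous: a finite cover of one
  support also covers those of all nearby pairs.\<close>

lemma compact_UN_msupp: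
  assumes K: "compact K"
  shows "compact (\<Union>p\<in>K. msupp (conv (fst p) (snd p)))"
  unfolding compact_eq_Heine_Borel
proof (intro allI impI, elim conjE)
  fix \<C> :: "'a set set" assume op: "\<forall>T\<in>\<C>. open T" and cov: "(\<Union>p\<in>K. msupp (conv (fst p) (snd p))) \<subseteq> \<Union>\<C>"
  have "\<exists>\<D>\<subseteq>\<C>. finite \<D> \<and> msupp (conv (fst p) (snd p)) \<subseteq> \<Union>\<D>" if "p \<in> K" for p
  proof -
    have "msupp (conv (fst p) (snd p)) \<subseteq> \<Union>\<C>" using cov that by (simp add: UN_subset_iff)
    from compactE[OF compact_msupp this] op show ?thesis by metis
  qed
  then obtain \<D> where D: "\<And>p. p \<in> K \<Longrightarrow> \<D> p \<subseteq> \<C> \<and> finite (\<D> p) \<and> msupp (conv (fst p) (snd p)) \<subseteq> \<Union>(\<D> p)"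
    by metis
  define W where "W p = {(x,y). msupp (conv x y) \<subseteq> \<Union>(\<D> p)}" for p
  have oW: "open (W p)" if "p \<in> K" for p
    unfolding W_def using D[OF that] op by (intro msupp_upper open_Union) auto
  have "p \<in> W p" if "p \<in> K" for p using D[OF that] by (simp add: W_def case_prod_beta)
  then have "K \<subseteq> (\<Union>p\<in>K. W p)" by auto
  from compactE_image[OF K oW this] obtain L where L: "L \<subseteq> K" "finite L" "K \<subseteq> (\<Union>p\<in>L. W p)"
    by metis
  show "\<exists>\<C>'\<subseteq>\<C>. finite \<C>' \<and> (\<Union>p\<in>K. msupp (conv (fst p) (snd p))) \<subseteq> \<Union>\<C>'"
  proof (intro exI[of _ "\<Union>p\<in>L. \<D> p"] conjI)
    show "(\<Union>p\<in>L. \<D> p) \<subseteq> \<C>" using D L(1) by (intro UN_least) auto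
    show "finite (\<Union>p\<in>L. \<D> p)" using D L by (intro finite_UN_I) auto
    show "(\<Union>p\<in>K. msupp (conv (fst p) (snd p))) \<subseteq> \<Union>(\<Union>p\<in>L. \<D> p)"
    proof (rule UN_least)
      fix p assume "p \<in> K"
      then obtain p' where p': "p' \<in> L" "p \<in> W p'" using L(3) by auto
      then have "msupp (conv (fst p) (snd p)) \<subseteq> \<Union>(\<D> p')" by (auto simp: W_def case_prod_beta)
      then show "msupp (conv (fst p) (snd p)) \<subseteq> \<Union>(\<Union>p\<in>L. \<D> p)" using p'(1) by blast
    qed
  qed
qed

text \<open>Associativity of measures says that the two unions of supports meet the same open sets,
  as an open set is met exactly when the corresponding integral is positive. Both unions are
  compact, hence closed, so they coincide.\<close>

lemma msupp_assoc:
  "(\<exists>u\<in>msupp (conv x y). w \<in> msupp (conv u z)) \<longleftrightarrow> (\<exists>v\<in>msupp (conv y z). w \<in> msupp (conv x v))"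
proof -
  define S1 where "S1 = (\<Union>u\<in>msupp (conv x y). msupp (conv u z))"
  define S2 where "S2 = (\<Union>v\<in>msupp (conv y z). msupp (conv x v))"
  have "S1 = (\<Union>p\<in>msupp (conv x y) \<times> {z}. msupp (conv (fst p) (snd p)))"
    "S2 = (\<Union>p\<in>{x} \<times> msupp (conv y z). msupp (conv (fst p) (snd p)))" by (auto simp: S1_def S2_def)
  then have cl: "closed S1" "closed S2"
    by (simp_all only:) (intro compact_imp_closed compact_UN_msupp compact_Times compact_msupp; simp)+
  have eq: "S1 \<inter> U \<noteq> {} \<longleftrightarrow> S2 \<inter> U \<noteq> {}" if U: "open U" for U
  proof -
    have "S1 \<inter> U \<noteq> {} \<longleftrightarrow> (\<exists>u\<in>msupp (conv x y). 0 < measure (conv u z) U)"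
      unfolding measure_pos_iff_msupp[OF radon_finite_conv U] S1_def S2_def by blast
    also have "\<dots> \<longleftrightarrow> 0 < (\<integral>u. measure (conv u z) U \<partial>conv x y)"
      using U by (intro integral_pos_iff_msupp[symmetric] radon_finite_conv lsc_conv_left measure_conv_le) auto
    also have "\<dots> \<longleftrightarrow> 0 < (\<integral>v. measure (conv x v) U \<partial>conv y z)" using U by (simp add: conv_assoc)
    also have "\<dots> \<longleftrightarrow> (\<exists>v\<in>msupp (conv y z). 0 < measure (conv x v) U)"
      using U by (intro integral_pos_iff_msupp radon_finite_conv lsc_conv_right measure_conv_le) auto
    also have "\<dots> \<longleftrightarrow> S2 \<inter> U \<noteq> {}"
      unfolding measure_pos_iff_msupp[OF radon_finite_conv U] S1_def S2_def by blast
    finally show ?thesis .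
  qed
  have "S1 \<inter> - S2 = {}" using eq[of "- S2"] cl(2) by (auto simp: open_Compl)
  moreover have "S2 \<inter> - S1 = {}" using eq[of "- S1"] cl(1) by (auto simp: open_Compl)
  ultimately have "S1 = S2" by auto
  then have "w \<in> S1 \<longleftrightarrow> w \<in> S2" by simp
  then show ?thesis by (simp add: S1_def S2_def)
qed

lemma msupp_conv_iv:
  assumes "u \<in> msupp (conv x y)"
  shows "iv u \<in> msupp (conv (iv y) (iv x))"
  unfolding msupp_def conv_iv
proof safe
  fix U assume U: "open U" "iv u \<in> U"
  have "open (iv -` U)" using U(1) iv_continuous by (intro open_vimage)
  then have "0 < emeasure (conv x y) (iv -` U)" using assms U(2) by (auto simp: msupp_def)
  moreover have "iv \<in> measurable (conv x y) borel"
    using borel_measurable_continuous_onI[OF iv_continuous] sets_conv by (simp cong: measurable_cong_sets)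
  ultimately show "0 < emeasure (distr (conv x y) borel iv) U"
    using U(1) by (simp add: emeasure_distr space_conv)
qed

text \<open>The identity lies in the support of \<open>iv z * z\<close>, hence in that of
  \<open>iv z * (x * y)\<close>. Reassociating gives \<open>u\<close> in the support of
  \<open>iv z * x\<close> with \<open>e\<close> in that of \<open>u * y\<close>; so
  \<open>y = iv u\<close>, and the involution puts \<open>iv u\<close> in the support of
  \<open>iv x * z\<close>.\<close>

lemma msupp_conv_swap:
  assumes "z \<in> msupp (conv x y)"
  shows "y \<in> msupp (conv (iv x) z)"
proof -
  have "e \<in> msupp (conv (iv z) z)" by (simp add: e_msupp iv_iv)
  then obtain u where u: "u \<in> msupp (conv (iv z) x)" "e \<in> msupp (conv u y)"
    using assms msupp_assoc[of "iv z" x e y] by blast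
  then have "y = iv u" by (simp add: e_msupp)
  then show ?thesis using msupp_conv_iv[OF u(1)] by (simp add: iv_iv)
qed

lemma integral_conv_compact_support:
  assumes f: "f \<in> Cc01" and C: "compact C"
  obtains D where "compact D" "\<And>x y. x \<in> C \<Longrightarrow> y \<notin> D \<Longrightarrow> (\<integral>t. f t \<partial>conv x y) = 0"
proof -
  note fD = Cc01D[OF f]
  let ?F = "closure {x. f x \<noteq> 0}"
  \<comment> \<open>By \<open>msupp_conv_swap\<close>, \<open>f\<close> can be nonzero on the
    support of \<open>x * y\<close> only if \<open>y\<close> lies in the product set of
    \<open>iv x\<close> and the support of \<open>f\<close>.\<close>
  let ?D = "\<Union>p\<in>iv ` C \<times> ?F. msupp (conv (fst p) (snd p))"
  have D: "compact ?D"
    using C fD(7) continuous_on_subset[OF iv_continuous]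
    by (intro compact_UN_msupp compact_Times compact_continuous_image) auto
  have "(\<integral>t. f t \<partial>conv x y) = 0" if x: "x \<in> C" and y: "y \<notin> ?D" for x y
  proof -
    have no: "z \<notin> msupp (conv x y)" if "f z \<noteq> 0" for z
    proof
      assume "z \<in> msupp (conv x y)"
      then have "y \<in> msupp (conv (iv x) z)" by (rule msupp_conv_swap)
      moreover have "z \<in> ?F" using that closure_subset[of "{x. f x \<noteq> 0}"] by auto
      ultimately have "y \<in> ?D" using x by (intro UN_I[of "(iv x, z)"]) auto
      then show False using y by simp
    qed
    have lsc: "open {z. t < f z}" for t using fD(1) by (intro open_Collect_less continuous_intros) auto
    have "\<not> 0 < (\<integral>t. f t \<partial>conv x y)"
      using no by (subst integral_pos_iff_msupp[OF radon_finite_conv lsc fD(3,4)]) auto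
    moreover have "0 \<le> (\<integral>t. f t \<partial>conv x y)" using fD(3) by (intro integral_nonneg_AE) auto
    ultimately show ?thesis by simp
  qed
  with D show ?thesis by (rule that)
qed

lemma continuous_integral_conv: "f \<in> Cc01 \<Longrightarrow> continuous_on UNIV (\<lambda>y. \<integral>t. f t \<partial>conv x y)"
proof -
  assume f: "f \<in> Cc01"
  have "continuous_on UNIV ((\<lambda>(x,y). \<integral>t. f t \<partial>conv x y) \<circ> (\<lambda>y. (x, y)))"
    by (intro continuous_on_compose continuous_on_subset[OF conv_continuous[OF Cc01D(6)[OF f]]]
        continuous_intros) auto
  then show ?thesis by (simp add: comp_def)
qed

lemma integral_conv_Cc01:
  assumes f: "f \<in> Cc01"
  shows "(\<lambda>y. \<integral>t. f t \<partial>conv x y) \<in> Cc01"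
proof -
  note fD = Cc01D[OF f]
  obtain D where D: "compact D" "\<And>x' y. x' \<in> {x} \<Longrightarrow> y \<notin> D \<Longrightarrow> (\<integral>t. f t \<partial>conv x' y) = 0"
    using integral_conv_compact_support[OF f, of "{x}"] by auto
  have "{y. (\<integral>t. f t \<partial>conv x y) \<noteq> 0} \<subseteq> D" using D(2) by auto
  then have "closure {y. (\<integral>t. f t \<partial>conv x y) \<noteq> 0} \<subseteq> D"
    using compact_imp_closed[OF D(1)] by (rule closure_minimal)
  then have "compact (closure {y. (\<integral>t. f t \<partial>conv x y) \<noteq> 0})"
    using compact_Int_closed[OF D(1) closed_closure[of "{y. (\<integral>t. f t \<partial>conv x y) \<noteq> 0}"]] by (simp add: inf.absorb2)
  then show ?thesis
    unfolding Cc01_def Cc_def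
    using continuous_integral_conv[OF f] integral_conv_bounds[OF fD(2,3,4)] by auto
qed

text \<open>Uniformity in \<open>y\<close> needs attention only on the common compact set
  \<open>D\<close>, where the tube lemma applies; off \<open>D\<close> both integrals
  vanish.\<close>

lemma integral_conv_uniform:
  assumes f: "f \<in> Cc01" and C: "compact C" and "0 < \<epsilon>"
  shows "\<exists>W. (\<forall>a\<in>C. open (W a) \<and> a \<in> W a \<and>
    (\<forall>x\<in>W a \<inter> C. \<forall>y. \<bar>(\<integral>t. f t \<partial>conv x y) - (\<integral>t. f t \<partial>conv a y)\<bar> \<le> \<epsilon>))"
proof -
  obtain D where D: "compact D" "\<And>x y. x \<in> C \<Longrightarrow> y \<notin> D \<Longrightarrow> (\<integral>t. f t \<partial>conv x y) = 0"
    using integral_conv_compact_support[OF f C] by metis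
  have "\<exists>W. open W \<and> a \<in> W \<and> (\<forall>x\<in>W \<inter> C. \<forall>y. \<bar>(\<integral>t. f t \<partial>conv x y) - (\<integral>t. f t \<partial>conv a y)\<bar> \<le> \<epsilon>)"
    if a: "a \<in> C" for a
  proof -
    let ?O = "{p. \<bar>(case p of (x,y) \<Rightarrow> \<integral>t. f t \<partial>conv x y) - (\<integral>t. f t \<partial>conv a (snd p))\<bar> < \<epsilon>}"
    have "open ?O"
      by (intro open_Collect_less continuous_intros conv_continuous Cc01D(6)[OF f]
          continuous_on_compose2[OF continuous_integral_conv[OF f]]) auto
    moreover have "{a} \<times> D \<subseteq> ?O" using \<open>0 < \<epsilon>\<close> by auto
    ultimately have "\<exists>W. a \<in> W \<and> open W \<and> W \<times> D \<subseteq> ?O"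
      by (rule Elementary_Topology.tube_lemma[OF D(1)])
    then obtain W where W: "a \<in> W" "open W" "W \<times> D \<subseteq> ?O"
      by (elim exE conjE)
    show ?thesis
    proof (intro exI[of _ W] conjI ballI allI W(1,2))
      fix x y assume x: "x \<in> W \<inter> C"
      show "\<bar>(\<integral>t. f t \<partial>conv x y) - (\<integral>t. f t \<partial>conv a y)\<bar> \<le> \<epsilon>"
      proof (cases "y \<in> D")
        case True
        then have "(x, y) \<in> ?O" using x W(3) by auto
        then show ?thesis by simp
      next
        case False
        then show ?thesis using D(2)[OF _ False] x a \<open>0 < \<epsilon>\<close> by simp
      qed
    qed
  qed
  then show ?thesis by metis
qed

text \<open>Weak continuity of \<open>\<nu> \<mapsto> \<sigma> * \<nu>\<close> on bounded sets: on a compact set carrying most of \<open>\<sigma>\<close> the functions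
  \<open>y \<mapsto> f(x * y)\<close> are uniformly close to finitely many of them.\<close>

lemma cint_mconv_approx:
  assumes \<sigma>: "\<sigma> \<in> MK" and f: "f \<in> Cc01" and "0 < \<epsilon>"
  shows "\<exists>(n::nat) a b. \<forall>\<nu>\<in>MK. norm (cint (mconv conv \<sigma> \<nu>) (\<lambda>t. of_real (f t)) -
    (\<Sum>i<n. b i * cint \<nu> (\<lambda>y. of_real (\<integral>t. f t \<partial>conv (a i) y)))) \<le> \<epsilon> * enn2real (mnorm \<nu>)"
proof -
  note fD = Cc01D[OF f] and c\<sigma> = MK_complex_measure[OF \<sigma>]
  define s where "s = (\<Sum>k<(4::nat). measure (dirpart \<sigma> k) UNIV)"
  have s0: "0 \<le> s" unfolding s_def by (intro sum_nonneg) auto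
  \<comment> \<open>With \<open>q\<close> the norm of \<open>\<nu>\<close>, the error is
    \<open>q * \<delta> * s\<close> from the oscillation on \<open>C\<close> plus
    \<open>q * \<delta>\<close> for each of the four parts off \<open>C\<close>.\<close>
  define \<delta> where "\<delta> = \<epsilon> / (s + 4)"
  have \<delta>: "0 < \<delta>" "\<delta> * (s + 4) = \<epsilon>" unfolding \<delta>_def using s0 \<open>0 < \<epsilon>\<close> by auto
  have "\<exists>C. compact C \<and> C \<subseteq> UNIV \<and> (\<forall>k\<in>{..<4::nat}. measure (dirpart \<sigma> k) (UNIV - C) < \<delta>)"
    using \<delta>(1) by (intro radon_finite_common_compact radon_finite_dirpart \<sigma>) auto
  then obtain C where C: "compact C" "\<And>k. k < 4 \<Longrightarrow> measure (dirpart \<sigma> k) (UNIV - C) < \<delta>" by auto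
  obtain W where W: "\<forall>a\<in>C. open (W a) \<and> a \<in> W a \<and>
    (\<forall>x\<in>W a \<inter> C. \<forall>y. \<bar>(\<integral>t. f t \<partial>conv x y) - (\<integral>t. f t \<partial>conv a y)\<bar> \<le> \<delta>)"
    using integral_conv_uniform[OF f C(1) \<delta>(1)] by (elim exE)
  obtain X where X: "X \<subseteq> C" "finite X" "C \<subseteq> (\<Union>a\<in>X. W a)"
    using compactE_image[OF C(1), of C W] W by blast
  obtain a and n :: nat where a: "X = a ` {i. i < n}"
    using finite_imp_nat_seg_image_inj_on[OF X(2)] by blast
  \<comment> \<open>Each point of \<open>C\<close> is assigned to the first \<open>W (a i)\<close>
    containing it. Neither the \<open>a i\<close> nor the weights \<open>\<sigma> (B i)\<close>
    depend on \<open>\<nu>\<close>, which is what makes the approximation usable along the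
    averages.\<close>
  define B where "B i = (W (a i) \<inter> C) - (\<Union>j<i. W (a j))" for i
  have aC: "a i \<in> C" if "i < n" for i using that a X(1) by auto
  have Cb: "C \<in> sets borel" by (rule compact_borel[OF C(1)])
  have Bb: "B i \<in> sets borel" if "i < n" for i
    unfolding B_def using that aC W Cb by (intro sets.Diff sets.Int sets.finite_UN) auto
  have Bex: "\<exists>i<n. x \<in> B i" if "x \<in> C" for x
  proof -
    have "\<exists>i. i < n \<and> x \<in> W (a i)" using that X(3) a by auto
    then obtain i where i: "i < n \<and> x \<in> W (a i)" "\<And>j. j < i \<Longrightarrow> \<not> (j < n \<and> x \<in> W (a j))"
      using exists_least_iff[of "\<lambda>i. i < n \<and> x \<in> W (a i)"] by auto
    then show ?thesis using that by (intro exI[of _ i]) (auto simp: B_def)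
  qed
  have Bun: "i = j" if "x \<in> B i" "x \<in> B j" for x i j
  proof (rule ccontr)
    assume "i \<noteq> j"
    then consider "i < j" | "j < i" by linarith
    then show False using that by cases (auto simp: B_def)
  qed
  have "norm (cint (mconv conv \<sigma> \<nu>) (\<lambda>t. of_real (f t)) -
      (\<Sum>i<n. \<sigma> (B i) * cint \<nu> (\<lambda>y. of_real (\<integral>t. f t \<partial>conv (a i) y)))) \<le> \<epsilon> * enn2real (mnorm \<nu>)"
    if \<nu>: "\<nu> \<in> MK" for \<nu>
  proof -
    note c\<nu> = MK_complex_measure[OF \<nu>]
    define q where "q = enn2real (mnorm \<nu>)"
    have q0: "0 \<le> q" unfolding q_def by simp
    define H where "H x = cint \<nu> (\<lambda>y. of_real (\<integral>t. f t \<partial>conv x y))" for x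
    have Gb: "(\<lambda>y. complex_of_real (\<integral>t. f t \<partial>conv x y)) \<in> bborel" for x
      using Cc01D[OF integral_conv_Cc01[OF f]] by (intro bborel_of_real[where B=1]) auto
    have Hb: "H \<in> bborel" unfolding H_def[abs_def] by (rule cint_conv_bborel[OF \<sigma> \<nu> fD(2,3,4)])
    have Hle: "norm (H x) \<le> q" for x
    proof -
      have "norm (H x) \<le> 1 * q" unfolding H_def q_def
        using Gb[of x] Cc01D(5)[OF integral_conv_Cc01[OF f]] by (intro norm_cint_le[OF c\<nu>]) (auto simp: bborel_def)
      then show ?thesis by simp
    qed
    have Hd: "norm (H x - H (a i)) \<le> \<delta> * q" if i: "i < n" and x: "x \<in> W (a i) \<inter> C" for x i
    proof -
      have "H x - H (a i) = cint \<nu> (\<lambda>y. of_real (\<integral>t. f t \<partial>conv x y) - of_real (\<integral>t. f t \<partial>conv (a i) y))"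
        unfolding H_def by (rule cint_diff[OF c\<nu> Gb Gb, symmetric])
      moreover have "norm (cint \<nu> (\<lambda>y. of_real (\<integral>t. f t \<partial>conv x y) - of_real (\<integral>t. f t \<partial>conv (a i) y))) \<le> \<delta> * q"
        unfolding q_def
      proof (rule norm_cint_le[OF c\<nu>])
        show "(\<lambda>y. complex_of_real (\<integral>t. f t \<partial>conv x y) - of_real (\<integral>t. f t \<partial>conv (a i) y)) \<in> borel_measurable borel"
          using bborel_diff[OF Gb Gb] by (simp add: bborel_def)
        fix y
        have "\<bar>(\<integral>t. f t \<partial>conv x y) - (\<integral>t. f t \<partial>conv (a i) y)\<bar> \<le> \<delta>" using W aC[OF i] x by simp
        then show "norm (complex_of_real (\<integral>t. f t \<partial>conv x y) - of_real (\<integral>t. f t \<partial>conv (a i) y)) \<le> \<delta>"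
          by (metis norm_of_real of_real_diff)
      qed
      ultimately show ?thesis by simp
    qed
    \<comment> \<open>A step function with the value of \<open>H\<close> at \<open>a i\<close> on
      \<open>B i\<close>, and 0 off \<open>C\<close>; there \<open>H\<close> is only bounded, but
      \<open>\<sigma>\<close> has little mass.\<close>
    define H' where "H' x = (\<Sum>i<n. H (a i) * of_real (indicator (B i) x))" for x
    have ib: "(\<lambda>x. complex_of_real (indicator (B i) x)) \<in> bborel" if "i < n" for i
      using Bb[OF that] by (intro bborel_of_real[where B=1] borel_measurable_indicator) (auto split: split_indicator)
    have H'b: "H' \<in> bborel" unfolding H'_def[abs_def] by (intro bborel_sum bborel_mult ib) auto
    have cH': "cint \<sigma> H' = (\<Sum>i<n. \<sigma> (B i) * H (a i))"
    proof -
      have "cint \<sigma> H' = (\<Sum>i<n. cint \<sigma> (\<lambda>x. H (a i) * of_real (indicator (B i) x)))"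
        unfolding H'_def[abs_def] by (intro cint_sum[OF c\<sigma>] bborel_mult ib) auto
      also have "\<dots> = (\<Sum>i<n. \<sigma> (B i) * H (a i))"
        by (intro sum.cong refl) (simp add: cint_mult[OF c\<sigma> ib] cint_indicator[OF c\<sigma>] Bb)
      finally show ?thesis .
    qed
    have le: "norm (H x - H' x) \<le> q * \<delta> + q * indicator (UNIV - C) x" for x
    proof (cases "x \<in> C")
      case True
      then obtain i where i: "i < n" "x \<in> B i" using Bex by blast
      have "H' x = (\<Sum>j<n. if j = i then H (a i) else 0)"
        unfolding H'_def using i Bun by (intro sum.cong) (auto simp: indicator_def)
      then have "H' x = H (a i)" using i(1) by simp
      then show ?thesis using Hd[OF i(1), of x] i(2) True by (simp add: B_def mult.commute)
    next
      case False
      then have "H' x = 0" unfolding H'_def by (intro sum.neutral) (auto simp: B_def)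
      then show ?thesis using Hle[of x] False q0 \<delta>(1) by (simp add: add_increasing)
    qed
    have "norm (cint \<sigma> H - cint \<sigma> H') = norm (cint \<sigma> (\<lambda>x. H x - H' x))"
      using cint_diff[OF c\<sigma> Hb H'b] by simp
    also have "\<dots> \<le> (\<Sum>k<4. \<integral>x. norm (H x - H' x) \<partial>dirpart \<sigma> k)"
      by (rule norm_cint_le_parts[OF c\<sigma> bborel_diff[OF Hb H'b]])
    also have "\<dots> \<le> (\<Sum>k<4. q * \<delta> * measure (dirpart \<sigma> k) UNIV + q * \<delta>)"
    proof (rule sum_mono)
      fix k :: nat assume k: "k \<in> {..<4}"
      interpret finite_measure "dirpart \<sigma> k" by (rule finite_measure_dirpart[OF c\<sigma>])
      have int: "integrable (dirpart \<sigma> k) (\<lambda>x. indicator (UNIV - C) x :: real)"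
        using Cb by (intro integrable_real_indicator) (auto simp: emeasure_eq_measure)
      have "(\<integral>x. norm (H x - H' x) \<partial>dirpart \<sigma> k) \<le> (\<integral>x. q * \<delta> + q * indicator (UNIV - C) x \<partial>dirpart \<sigma> k)"
        using le int by (intro integral_mono integrable_norm integrable_dirpart[OF c\<sigma>] bborel_diff Hb H'b) auto
      also have "\<dots> = q * \<delta> * measure (dirpart \<sigma> k) UNIV + q * measure (dirpart \<sigma> k) (UNIV - C)"
        using int by (subst Bochner_Integration.integral_add) (auto simp: mult.commute)
      also have "\<dots> \<le> q * \<delta> * measure (dirpart \<sigma> k) UNIV + q * \<delta>"
        using C(2)[of k] k q0 by (intro add_left_mono mult_left_mono) auto
      finally show "(\<integral>x. norm (H x - H' x) \<partial>dirpart \<sigma> k) \<le> q * \<delta> * measure (dirpart \<sigma> k) UNIV + q * \<delta>" .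
    qed
    also have "\<dots> = q * (\<delta> * (s + 4))"
      unfolding s_def by (simp add: sum.distrib sum_distrib_left[symmetric] algebra_simps)
    also have "\<dots> = \<epsilon> * q" using \<delta>(2) by simp
    finally show ?thesis
      using cint_mconv[OF \<sigma> \<nu> fD(2,3,4)] cH' unfolding H_def[abs_def] q_def by simp
  qed
  then show ?thesis
    by (intro exI[of _ n] exI[of _ a] exI[of _ "\<lambda>i. \<sigma> (B i)"] ballI)
qed

end

section \<open>Ergodic averages and the projection\<close>

lemma mnorm_eq_ennreal: "\<mu> \<in> MK \<Longrightarrow> mnorm \<mu> = ennreal (enn2real (mnorm \<mu>))"
  using tvar_finite[OF MK_complex_measure, of \<mu> UNIV] by (simp add: mnorm_def)

lemma enn2real_mnorm_le: "mnorm \<mu> \<le> ennreal c \<Longrightarrow> 0 \<le> c \<Longrightarrow> enn2real (mnorm \<mu>) \<le> c"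
  by (simp add: enn2real_leI)

lemma sum_norm_le_mnorm:
  assumes \<mu>: "\<mu> \<in> MK" and P: "finite P" "disjoint P" "P \<subseteq> sets borel"
  shows "(\<Sum>B\<in>P. norm (\<mu> B)) \<le> enn2real (mnorm \<mu>)"
proof -
  have "ennreal (\<Sum>B\<in>P. norm (\<mu> B)) \<le> mnorm \<mu>"
    unfolding mnorm_def using P
    by (intro tvar_ge_sum[of \<mu> P "\<lambda>B. B"] complex_measure_empty MK_complex_measure \<mu>)
       (auto simp: disjoint_family_on_def disjoint_def)
  then show ?thesis
    by (subst (asm) mnorm_eq_ennreal[OF \<mu>]) (simp add: ennreal_le_iff)
qed

lemma mnorm_linear_le:
  assumes \<mu>: "\<mu> \<in> MK" and \<nu>: "\<nu> \<in> MK"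
  shows "enn2real (mnorm (\<lambda>A. a * \<mu> A + b * \<nu> A)) \<le> norm a * enn2real (mnorm \<mu>) + norm b * enn2real (mnorm \<nu>)"
proof (rule enn2real_mnorm_le)
  show "mnorm (\<lambda>A. a * \<mu> A + b * \<nu> A) \<le> ennreal (norm a * enn2real (mnorm \<mu>) + norm b * enn2real (mnorm \<nu>))"
    unfolding mnorm_def[of "\<lambda>A. a * \<mu> A + b * \<nu> A"] tvar_def
  proof (rule SUP_least)
    fix P :: "'a set set" assume "P \<in> {P. finite P \<and> disjoint P \<and> P \<subseteq> sets borel \<and> \<Union>P \<subseteq> UNIV}"
    then have P: "finite P" "disjoint P" "P \<subseteq> sets borel" by auto
    have "(\<Sum>B\<in>P. norm (a * \<mu> B + b * \<nu> B)) \<le> (\<Sum>B\<in>P. norm a * norm (\<mu> B) + norm b * norm (\<nu> B))"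
      by (intro sum_mono) (metis norm_mult norm_triangle_ineq)
    also have "\<dots> = norm a * (\<Sum>B\<in>P. norm (\<mu> B)) + norm b * (\<Sum>B\<in>P. norm (\<nu> B))"
      by (simp add: sum.distrib sum_distrib_left)
    also have "\<dots> \<le> norm a * enn2real (mnorm \<mu>) + norm b * enn2real (mnorm \<nu>)"
      by (intro add_mono mult_left_mono sum_norm_le_mnorm \<mu> \<nu> P) auto
    finally show "(\<Sum>B\<in>P. ennreal (norm (a * \<mu> B + b * \<nu> B))) \<le>
        ennreal (norm a * enn2real (mnorm \<mu>) + norm b * enn2real (mnorm \<nu>))"
      by (simp add: sum_ennreal ennreal_leI del: ennreal_plus)
  qed
qed simp

lemma norm_sum_disjoint_le_1:
  fixes f :: "'i \<Rightarrow> real" and z :: "'i \<Rightarrow> complex"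
  assumes "finite P" "\<And>i. i \<in> P \<Longrightarrow> \<bar>f i\<bar> \<le> 1" "\<And>i. i \<in> P \<Longrightarrow> norm (z i) \<le> 1"
    and dis: "\<And>i j. i \<in> P \<Longrightarrow> j \<in> P \<Longrightarrow> i \<noteq> j \<Longrightarrow> f i = 0 \<or> f j = 0"
  shows "norm (\<Sum>i\<in>P. z i * of_real (f i)) \<le> 1"
proof (cases "\<exists>i\<in>P. f i \<noteq> 0")
  case True
  then obtain i where i: "i \<in> P" "f i \<noteq> 0" by blast
  have "(\<Sum>j\<in>P - {i}. z j * of_real (f j)) = 0"
    using i dis by (intro sum.neutral) fastforce
  then have "(\<Sum>j\<in>P. z j * of_real (f j)) = z i * of_real (f i)"
    using sum.remove[OF assms(1) i(1), of "\<lambda>j. z j * of_real (f j)"] by simp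
  moreover have "norm (z i) * \<bar>f i\<bar> \<le> 1 * 1" using assms(2,3)[OF i(1)] by (intro mult_mono) auto
  ultimately show ?thesis by (simp add: norm_mult)
qed simp

text \<open>The ultrafilter is a parameter so that one choice serves all measures; membership of
  \<open>proj\<close> values and linearity rest on this common choice.\<close>

locale hypergroup_contraction = hypergroup_space +
  fixes \<sigma> :: "'a set \<Rightarrow> complex" and G :: "nat filter"
  assumes \<sigma>: "\<sigma> \<in> MK" and norm_\<sigma>: "mnorm \<sigma> = 1"
    and G: "G \<le> sequentially" "G \<noteq> bot" "\<And>P. eventually P G \<or> eventually (\<lambda>x. \<not> P x) G"
begin

abbreviation T :: "('a set \<Rightarrow> complex) \<Rightarrow> 'a set \<Rightarrow> complex" where
  "T \<equiv> mconv conv \<sigma>"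

abbreviation nr :: "('a set \<Rightarrow> complex) \<Rightarrow> real" where
  "nr \<mu> \<equiv> enn2real (mnorm \<mu>)"

abbreviation cr :: "('a set \<Rightarrow> complex) \<Rightarrow> ('a \<Rightarrow> real) \<Rightarrow> complex" where
  "cr \<mu> f \<equiv> cint \<mu> (\<lambda>x. of_real (f x))"

lemma nr_T_le: "\<mu> \<in> MK \<Longrightarrow> nr (T \<mu>) \<le> nr \<mu>"
  using enn2real_mnorm_le[OF mnorm_mconv_le[OF \<sigma>, of \<mu>]] norm_\<sigma> by simp

lemma T_power_MK: "\<mu> \<in> MK \<Longrightarrow> (T ^^ k) \<mu> \<in> MK"
  by (induction k) (auto intro: mconv_MK[OF \<sigma>])

lemma nr_T_power_le: "\<mu> \<in> MK \<Longrightarrow> nr ((T ^^ k) \<mu>) \<le> nr \<mu>"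
proof (induction k)
  case (Suc k)
  then show ?case using nr_T_le[OF T_power_MK[OF Suc.prems, of k]] by simp
qed simp

lemma T_power_linear:
  assumes "\<mu> \<in> MK" "\<nu> \<in> MK"
  shows "(T ^^ k) (\<lambda>A. a * \<mu> A + b * \<nu> A) = (\<lambda>A. a * (T ^^ k) \<mu> A + b * (T ^^ k) \<nu> A)"
  by (induction k) (simp_all add: mconv_linear[OF \<sigma> T_power_MK[OF assms(1)] T_power_MK[OF assms(2)]])

lemma cr_linear:
  assumes "\<mu> \<in> MK" "\<nu> \<in> MK" "f \<in> Cc01"
  shows "cr (\<lambda>A. a * \<mu> A + b * \<nu> A) f = a * cr \<mu> f + b * cr \<nu> f"
  using assms by (intro cint_linear_measure MK_complex_measure MK_linear Cc01D(2,3,4)) auto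

lemma norm_cr_le:
  assumes "\<mu> \<in> MK" "f \<in> Cc01"
  shows "norm (cr \<mu> f) \<le> nr \<mu>"
proof -
  have "norm (cr \<mu> f) \<le> 1 * nr \<mu>"
    using Cc01D(2,5)[OF assms(2)] by (intro norm_cint_le[OF MK_complex_measure[OF assms(1)]]) auto
  then show ?thesis by simp
qed

section \<open>Cesaro averages\<close>

definition orbit_sum :: "nat \<Rightarrow> ('a set \<Rightarrow> complex) \<Rightarrow> 'a set \<Rightarrow> complex" where
  "orbit_sum n \<mu> = (\<lambda>A. \<Sum>k<n. (T ^^ k) \<mu> A)"

text \<open>The mean of the first \<open>n + 1\<close> iterates, so that the divisor is never
  0.\<close>

definition avg :: "nat \<Rightarrow> ('a set \<Rightarrow> complex) \<Rightarrow> 'a set \<Rightarrow> complex" where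
  "avg n \<mu> = (\<lambda>A. orbit_sum (Suc n) \<mu> A / of_nat (Suc n))"

text \<open>The factors 1 give the recursion the shape \<open>a * \<mu> A + b * \<nu> A\<close>
  shared by all linearity lemmas; the summand \<open>0 * \<mu> A\<close> in \<open>avg_eq\<close>
  has the same purpose.\<close>

lemma orbit_sum_Suc: "orbit_sum (Suc n) \<mu> = (\<lambda>A. 1 * orbit_sum n \<mu> A + 1 * (T ^^ n) \<mu> A)"
  by (simp add: orbit_sum_def)

lemma zero_MK: "(\<lambda>A::'a set. 0) \<in> MK"
  using MK_linear[OF \<sigma> \<sigma>, of 0 0] by simp

lemma cr_zero: "cr (\<lambda>A. 0) f = 0" if "f \<in> Cc01"
  using cr_linear[OF \<sigma> \<sigma> that, of 0 0] by simp

lemma T_zero: "T (\<lambda>A. 0) = (\<lambda>A. 0)"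
  using mconv_linear[OF \<sigma> \<sigma> \<sigma>, of 0 0] by simp

lemma orbit_sum_MK: "\<mu> \<in> MK \<Longrightarrow> orbit_sum n \<mu> \<in> MK"
proof (induction n)
  case 0
  show ?case using zero_MK by (simp add: orbit_sum_def)
next
  case (Suc n)
  then show ?case unfolding orbit_sum_Suc by (intro MK_linear T_power_MK) auto
qed

lemma nr_orbit_sum_le: "\<mu> \<in> MK \<Longrightarrow> nr (orbit_sum n \<mu>) \<le> n * nr \<mu>"
proof (induction n)
  case 0
  show ?case using mnorm_linear_le[OF \<sigma> \<sigma>, of 0 0] by (simp add: orbit_sum_def)
next
  case (Suc n)
  have "nr (orbit_sum (Suc n) \<mu>) \<le> norm (1::complex) * nr (orbit_sum n \<mu>) + norm (1::complex) * nr ((T ^^ n) \<mu>)"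
    unfolding orbit_sum_Suc by (rule mnorm_linear_le[OF orbit_sum_MK[OF Suc.prems] T_power_MK[OF Suc.prems]])
  also have "\<dots> \<le> n * nr \<mu> + nr \<mu>" using Suc.IH[OF Suc.prems] nr_T_power_le[OF Suc.prems, of n] by simp
  finally show ?case by (simp add: algebra_simps)
qed

lemma cr_orbit_sum: "\<mu> \<in> MK \<Longrightarrow> f \<in> Cc01 \<Longrightarrow> cr (orbit_sum n \<mu>) f = (\<Sum>k<n. cr ((T ^^ k) \<mu>) f)"
proof (induction n)
  case 0
  then show ?case using cr_zero by (simp add: orbit_sum_def)
next
  case (Suc n)
  have "cr (orbit_sum (Suc n) \<mu>) f = 1 * cr (orbit_sum n \<mu>) f + 1 * cr ((T ^^ n) \<mu>) f"
    unfolding orbit_sum_Suc using Suc.prems by (intro cr_linear orbit_sum_MK T_power_MK)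
  then show ?case using Suc by simp
qed

lemma T_orbit_sum: "\<mu> \<in> MK \<Longrightarrow> T (orbit_sum n \<mu>) = (\<lambda>A. \<Sum>k<n. (T ^^ Suc k) \<mu> A)"
proof (induction n)
  case 0
  show ?case using T_zero by (simp add: orbit_sum_def)
next
  case (Suc n)
  have "T (orbit_sum (Suc n) \<mu>) = (\<lambda>A. 1 * T (orbit_sum n \<mu>) A + 1 * T ((T ^^ n) \<mu>) A)"
    unfolding orbit_sum_Suc using Suc.prems by (intro mconv_linear orbit_sum_MK T_power_MK \<sigma>)
  then show ?case using Suc by simp
qed

lemma avg_eq: "avg n \<mu> = (\<lambda>A. (1 / of_nat (Suc n)) * orbit_sum (Suc n) \<mu> A + 0 * \<mu> A)"
  by (simp add: avg_def)

lemma avg_MK: "\<mu> \<in> MK \<Longrightarrow> avg n \<mu> \<in> MK"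
  unfolding avg_eq by (intro MK_linear orbit_sum_MK)

lemma nr_avg_le:
  assumes \<mu>: "\<mu> \<in> MK"
  shows "nr (avg n \<mu>) \<le> nr \<mu>"
proof -
  have "nr (avg n \<mu>) \<le> norm (1 / of_nat (Suc n) :: complex) * nr (orbit_sum (Suc n) \<mu>) + norm (0::complex) * nr \<mu>"
    unfolding avg_eq by (rule mnorm_linear_le[OF orbit_sum_MK[OF \<mu>] \<mu>])
  also have "\<dots> = nr (orbit_sum (Suc n) \<mu>) / Suc n"
    by (simp add: norm_divide del: of_nat_Suc)
  also have "\<dots> \<le> (Suc n * nr \<mu>) / Suc n"
    by (intro divide_right_mono nr_orbit_sum_le \<mu>) auto
  also have "\<dots> = nr \<mu>" by (simp del: of_nat_Suc)
  finally show ?thesis .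
qed

lemma cr_avg:
  assumes \<mu>: "\<mu> \<in> MK" and f: "f \<in> Cc01"
  shows "cr (avg n \<mu>) f = (\<Sum>k<Suc n. cr ((T ^^ k) \<mu>) f) / of_nat (Suc n)"
  unfolding avg_eq cr_linear[OF orbit_sum_MK[OF \<mu>] \<mu> f] cr_orbit_sum[OF \<mu> f] by simp

lemma cr_T_avg:
  assumes \<mu>: "\<mu> \<in> MK" and f: "f \<in> Cc01"
  shows "cr (T (avg n \<mu>)) f - cr (avg n \<mu>) f = (cr ((T ^^ Suc n) \<mu>) f - cr \<mu> f) / of_nat (Suc n)"
proof -
  \<comment> \<open>Telescoping: \<open>T\<close> shifts the orbit sum by one, so only the last and
    the first term remain.\<close>
  have eq: "T (orbit_sum (Suc n) \<mu>) = (\<lambda>A. 1 * orbit_sum (Suc n) \<mu> A + 1 * (1 * (T ^^ Suc n) \<mu> A + (-1) * \<mu> A))"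
  proof
    fix A
    have "(\<Sum>k<Suc n. (T ^^ Suc k) \<mu> A) = (\<Sum>k<Suc (Suc n). (T ^^ k) \<mu> A) - \<mu> A"
      by (subst (2) sum.lessThan_Suc_shift) simp
    then show "T (orbit_sum (Suc n) \<mu>) A = 1 * orbit_sum (Suc n) \<mu> A + 1 * (1 * (T ^^ Suc n) \<mu> A + (-1) * \<mu> A)"
      unfolding T_orbit_sum[OF \<mu>] by (simp add: orbit_sum_def)
  qed
  have "T (avg n \<mu>) = (\<lambda>A. (1 / of_nat (Suc n)) * T (orbit_sum (Suc n) \<mu>) A + 0 * T \<mu> A)"
    unfolding avg_eq by (rule mconv_linear[OF \<sigma> orbit_sum_MK[OF \<mu>] \<mu>])
  then have "cr (T (avg n \<mu>)) f = (1 / of_nat (Suc n)) * cr (T (orbit_sum (Suc n) \<mu>)) f + 0 * cr (T \<mu>) f"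
    by (simp only: cr_linear[OF mconv_MK[OF \<sigma> orbit_sum_MK[OF \<mu>]] mconv_MK[OF \<sigma> \<mu>] f])
  then have "cr (T (avg n \<mu>)) f = (1 / of_nat (Suc n)) * cr (T (orbit_sum (Suc n) \<mu>)) f" by simp
  also have "cr (T (orbit_sum (Suc n) \<mu>)) f =
      1 * cr (orbit_sum (Suc n) \<mu>) f + 1 * cr (\<lambda>A. 1 * (T ^^ Suc n) \<mu> A + (-1) * \<mu> A) f"
    unfolding eq by (rule cr_linear[OF orbit_sum_MK[OF \<mu>] MK_linear[OF T_power_MK[OF \<mu>] \<mu>] f])
  also have "cr (\<lambda>A. 1 * (T ^^ Suc n) \<mu> A + (-1) * \<mu> A) f = 1 * cr ((T ^^ Suc n) \<mu>) f + (-1) * cr \<mu> f"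
    by (rule cr_linear[OF T_power_MK[OF \<mu>] \<mu> f])
  finally have "cr (T (avg n \<mu>)) f = (cr (orbit_sum (Suc n) \<mu>) f + (cr ((T ^^ Suc n) \<mu>) f - cr \<mu> f)) / of_nat (Suc n)"
    by simp
  moreover have "cr (avg n \<mu>) f = cr (orbit_sum (Suc n) \<mu>) f / of_nat (Suc n)"
    unfolding avg_eq cr_linear[OF orbit_sum_MK[OF \<mu>] \<mu> f] by simp
  ultimately show ?thesis by (simp add: add_divide_distrib)
qed

section \<open>The limit operator\<close>

definition is_limit :: "('a set \<Rightarrow> complex) \<Rightarrow> ('a set \<Rightarrow> complex) \<Rightarrow> bool" where
  "is_limit \<mu> \<kappa> \<longleftrightarrow> \<kappa> \<in> MK \<and> (\<forall>f\<in>Cc01. ((\<lambda>n. cr (avg n \<mu>) f) \<longlongrightarrow> cr \<kappa> f) G)"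

definition proj :: "('a set \<Rightarrow> complex) \<Rightarrow> 'a set \<Rightarrow> complex" where
  "proj \<mu> = (SOME \<kappa>. is_limit \<mu> \<kappa>)"

lemma is_limit_unique:
  assumes "is_limit \<mu> \<kappa>" "is_limit \<mu> \<kappa>'"
  shows "\<kappa> = \<kappa>'"
  using assms unfolding is_limit_def by (intro MK_eqI[OF lc]) (auto intro: tendsto_unique[OF G(2)])

lemma is_limit_proj:
  assumes \<mu>: "\<mu> \<in> MK"
  shows "is_limit \<mu> (proj \<mu>)"
proof -
  have "mnorm (avg n \<mu>) \<le> ennreal (nr \<mu>)" for n
    by (subst mnorm_eq_ennreal[OF avg_MK[OF \<mu>]]) (intro ennreal_leI nr_avg_le \<mu>)
  then have "\<exists>\<kappa>. is_limit \<mu> \<kappa>"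
    using ultralimit_MK[OF G(2,3), of "\<lambda>n. avg n \<mu>" "nr \<mu>"] avg_MK[OF \<mu>] unfolding is_limit_def by auto
  then show ?thesis unfolding proj_def by (rule someI_ex)
qed

lemma proj_eqI: "\<mu> \<in> MK \<Longrightarrow> is_limit \<mu> \<kappa> \<Longrightarrow> proj \<mu> = \<kappa>"
  using is_limit_unique is_limit_proj by blast

lemma proj_MK: "\<mu> \<in> MK \<Longrightarrow> proj \<mu> \<in> MK"
  using is_limit_proj by (simp add: is_limit_def)

lemma proj_linear:
  assumes \<mu>: "\<mu> \<in> MK" and \<nu>: "\<nu> \<in> MK"
  shows "proj (\<lambda>A. a * \<mu> A + b * \<nu> A) = (\<lambda>A. a * proj \<mu> A + b * proj \<nu> A)"
proof (rule proj_eqI[OF MK_linear[OF \<mu> \<nu>]])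
  show "is_limit (\<lambda>A. a * \<mu> A + b * \<nu> A) (\<lambda>A. a * proj \<mu> A + b * proj \<nu> A)"
    unfolding is_limit_def
  proof (intro conjI ballI MK_linear proj_MK \<mu> \<nu>)
    fix f :: "'a \<Rightarrow> real" assume f: "f \<in> Cc01"
    have "cr (avg n (\<lambda>A. a * \<mu> A + b * \<nu> A)) f = a * cr (avg n \<mu>) f + b * cr (avg n \<nu>) f" for n
    proof -
      have "cr ((T ^^ k) (\<lambda>A. a * \<mu> A + b * \<nu> A)) f = a * cr ((T ^^ k) \<mu>) f + b * cr ((T ^^ k) \<nu>) f" for k
        unfolding T_power_linear[OF \<mu> \<nu>] by (rule cr_linear[OF T_power_MK[OF \<mu>] T_power_MK[OF \<nu>] f])
      then show ?thesis
        unfolding cr_avg[OF MK_linear[OF \<mu> \<nu>] f] cr_avg[OF \<mu> f] cr_avg[OF \<nu> f]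
        by (simp only: sum.distrib sum_distrib_left add_divide_distrib times_divide_eq_right)
    qed
    moreover have "((\<lambda>n. a * cr (avg n \<mu>) f + b * cr (avg n \<nu>) f) \<longlongrightarrow> a * cr (proj \<mu>) f + b * cr (proj \<nu>) f) G"
      using is_limit_proj[OF \<mu>] is_limit_proj[OF \<nu>] f unfolding is_limit_def
      by (intro tendsto_add tendsto_mult_left) auto
    ultimately show "((\<lambda>n. cr (avg n (\<lambda>A. a * \<mu> A + b * \<nu> A)) f) \<longlongrightarrow> cr (\<lambda>A. a * proj \<mu> A + b * proj \<nu> A) f) G"
      using cr_linear[OF proj_MK[OF \<mu>] proj_MK[OF \<nu>] f] by simp
  qed
qed

text \<open>Each finite sum in the dual description of the norm is bounded on every average by the
  norm of \<open>\<mu>\<close>, as a disjointly supported sum has modulus at most 1 everywhere; the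
  bound passes to the limit along \<open>G\<close>.\<close>

lemma mnorm_proj_le:
  assumes \<mu>: "\<mu> \<in> MK"
  shows "mnorm (proj \<mu>) \<le> mnorm \<mu>"
proof (subst mnorm_eq_ennreal[OF \<mu>], rule mnorm_le_Cc01[OF lc proj_MK[OF \<mu>]])
  fix P :: "'a set set" and f :: "'a set \<Rightarrow> 'a \<Rightarrow> real" and z :: "'a set \<Rightarrow> complex"
  assume P: "finite P" and f: "\<And>B. B \<in> P \<Longrightarrow> f B \<in> Cc01" and z: "\<And>B. B \<in> P \<Longrightarrow> norm (z B) \<le> 1"
    and dis: "\<And>B B' x. B \<in> P \<Longrightarrow> B' \<in> P \<Longrightarrow> B \<noteq> B' \<Longrightarrow> f B x = 0 \<or> f B' x = 0"
  have "((\<lambda>n. \<Sum>B\<in>P. z B * cr (avg n \<mu>) (f B)) \<longlongrightarrow> (\<Sum>B\<in>P. z B * cr (proj \<mu>) (f B))) G"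
    using is_limit_proj[OF \<mu>] f unfolding is_limit_def by (intro tendsto_sum tendsto_mult_left) auto
  then have lim: "((\<lambda>n. norm (\<Sum>B\<in>P. z B * cr (avg n \<mu>) (f B))) \<longlongrightarrow> norm (\<Sum>B\<in>P. z B * cr (proj \<mu>) (f B))) G"
    by (rule tendsto_norm)
  show "norm (\<Sum>B\<in>P. z B * cr (proj \<mu>) (f B)) \<le> nr \<mu>"
  proof (rule tendsto_upperbound[OF lim _ G(2)], intro always_eventually allI)
    fix n
    note cm = MK_complex_measure[OF avg_MK[OF \<mu>, of n]]
    have fb: "(\<lambda>x. complex_of_real (f B x)) \<in> bborel" if "B \<in> P" for B
      using Cc01D(2,5)[OF f[OF that]] by (rule bborel_of_real)
    have "(\<Sum>B\<in>P. z B * cr (avg n \<mu>) (f B)) = cint (avg n \<mu>) (\<lambda>x. \<Sum>B\<in>P. z B * of_real (f B x))"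
      by (simp add: cint_sum[OF cm] cint_mult[OF cm] bborel_mult fb)
    also have "norm \<dots> \<le> 1 * nr (avg n \<mu>)"
    proof (rule norm_cint_le[OF cm])
      show "(\<lambda>x. \<Sum>B\<in>P. z B * complex_of_real (f B x)) \<in> borel_measurable borel"
        using bborel_sum[of P "\<lambda>B x. z B * complex_of_real (f B x)"] bborel_mult[OF fb] by (auto simp: bborel_def)
      show "norm (\<Sum>B\<in>P. z B * complex_of_real (f B x)) \<le> 1" for x
        using Cc01D(5)[OF f] z dis by (intro norm_sum_disjoint_le_1[OF P]) auto
    qed
    also have "\<dots> \<le> nr \<mu>" using nr_avg_le[OF \<mu>] by simp
    finally show "norm (\<Sum>B\<in>P. z B * cr (avg n \<mu>) (f B)) \<le> nr \<mu>" .
  qed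
qed simp

text \<open>The finite functional \<open>\<Phi>\<close> uses only test functions in
  \<open>Cc01\<close>, so it converges along \<open>G\<close>; its distance from \<open>T\<close> is
  uniform over the averages because their norms stay below that of \<open>\<mu>\<close>.\<close>

lemma tendsto_cr_T:
  assumes \<mu>: "\<mu> \<in> MK" and lim: "is_limit \<mu> \<kappa>" and f: "f \<in> Cc01"
  shows "((\<lambda>n. cr (T (avg n \<mu>)) f) \<longlongrightarrow> cr (T \<kappa>) f) G"
proof (rule tendstoI)
  fix \<epsilon> :: real assume "0 < \<epsilon>"
  have \<kappa>: "\<kappa> \<in> MK" using lim by (simp add: is_limit_def)
  define \<delta> where "\<delta> = \<epsilon> / (nr \<mu> + nr \<kappa> + 2)"
  have pos: "0 < nr \<mu> + nr \<kappa> + 2" using enn2real_nonneg[of "mnorm \<mu>"] enn2real_nonneg[of "mnorm \<kappa>"] by linarith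
  have \<delta>: "0 < \<delta>" "\<delta> * (nr \<mu> + nr \<kappa> + 2) = \<epsilon>" unfolding \<delta>_def using pos \<open>0 < \<epsilon>\<close> by auto
  obtain m :: nat and a b where ab: "\<forall>\<nu>\<in>MK. norm (cr (T \<nu>) f -
      (\<Sum>i<m. b i * cr \<nu> (\<lambda>y. \<integral>t. f t \<partial>conv (a i) y))) \<le> \<delta> * nr \<nu>"
    using cint_mconv_approx[OF \<sigma> f \<delta>(1)] by (elim exE)
  define \<Phi> where "\<Phi> \<nu> = (\<Sum>i<m. b i * cr \<nu> (\<lambda>y. \<integral>t. f t \<partial>conv (a i) y))" for \<nu>
  have "((\<lambda>n. \<Phi> (avg n \<mu>)) \<longlongrightarrow> \<Phi> \<kappa>) G"
    unfolding \<Phi>_def using lim integral_conv_Cc01[OF f] unfolding is_limit_def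
    by (intro tendsto_sum tendsto_mult_left) auto
  then have "eventually (\<lambda>n. dist (\<Phi> (avg n \<mu>)) (\<Phi> \<kappa>) < \<delta>) G" using \<delta>(1) by (rule tendstoD)
  then show "eventually (\<lambda>n. dist (cr (T (avg n \<mu>)) f) (cr (T \<kappa>) f) < \<epsilon>) G"
  proof eventually_elim
    case (elim n)
    have "norm (cr (T (avg n \<mu>)) f - \<Phi> (avg n \<mu>)) \<le> \<delta> * nr (avg n \<mu>)"
      using ab avg_MK[OF \<mu>] unfolding \<Phi>_def by blast
    moreover have "\<delta> * nr (avg n \<mu>) \<le> \<delta> * nr \<mu>" using \<delta>(1) nr_avg_le[OF \<mu>] by (intro mult_left_mono) auto
    moreover have "norm (cr (T \<kappa>) f - \<Phi> \<kappa>) \<le> \<delta> * nr \<kappa>" using ab \<kappa> unfolding \<Phi>_def by blast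
    moreover have "dist (cr (T (avg n \<mu>)) f) (cr (T \<kappa>) f) \<le>
        norm (cr (T (avg n \<mu>)) f - \<Phi> (avg n \<mu>)) + dist (\<Phi> (avg n \<mu>)) (\<Phi> \<kappa>) + norm (cr (T \<kappa>) f - \<Phi> \<kappa>)"
      using dist_triangle[of "cr (T (avg n \<mu>)) f" "cr (T \<kappa>) f" "\<Phi> (avg n \<mu>)"]
        dist_triangle[of "\<Phi> (avg n \<mu>)" "cr (T \<kappa>) f" "\<Phi> \<kappa>"]
      by (simp add: dist_norm norm_minus_commute)
    ultimately have "dist (cr (T (avg n \<mu>)) f) (cr (T \<kappa>) f) < \<delta> * nr \<mu> + \<delta> * nr \<kappa> + 2 * \<delta>"
      using elim \<delta>(1) by linarith
    also have "\<dots> = \<epsilon>" using \<delta>(2) by (simp add: algebra_simps)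
    finally show ?case .
  qed
qed

text \<open>\<open>T\<close> changes the \<open>n\<close>-th average by at most
  \<open>2 * nr \<mu> / (n + 1)\<close> on each test function. This tends to 0 sequentially, hence
  along \<open>G\<close>, while the same difference tends to that of \<open>T (proj \<mu>)\<close>
  and \<open>proj \<mu>\<close>.\<close>

lemma T_proj:
  assumes \<mu>: "\<mu> \<in> MK"
  shows "T (proj \<mu>) = proj \<mu>"
proof (rule MK_eqI[OF lc mconv_MK[OF \<sigma> proj_MK[OF \<mu>]] proj_MK[OF \<mu>]])
  fix f :: "'a \<Rightarrow> real" assume f: "f \<in> Cc01"
  have "(\<lambda>n. cr (T (avg n \<mu>)) f - cr (avg n \<mu>) f) \<longlonglongrightarrow> 0"
  proof (rule Lim_null_comparison)
    show "\<forall>\<^sub>F n in sequentially. norm (cr (T (avg n \<mu>)) f - cr (avg n \<mu>) f) \<le> (2 * nr \<mu>) / real (Suc n)"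
    proof (intro always_eventually allI)
      fix n
      have "norm (cr ((T ^^ Suc n) \<mu>) f - cr \<mu> f) \<le> nr \<mu> + nr \<mu>"
        using norm_triangle_ineq4[of "cr ((T ^^ Suc n) \<mu>) f" "cr \<mu> f"] norm_cr_le[OF T_power_MK[OF \<mu>] f, of "Suc n"]
          nr_T_power_le[OF \<mu>, of "Suc n"] norm_cr_le[OF \<mu> f] by linarith
      then have "norm (cr ((T ^^ Suc n) \<mu>) f - cr \<mu> f) / Suc n \<le> (2 * nr \<mu>) / Suc n"
        by (intro divide_right_mono) auto
      then show "norm (cr (T (avg n \<mu>)) f - cr (avg n \<mu>) f) \<le> (2 * nr \<mu>) / real (Suc n)"
        unfolding cr_T_avg[OF \<mu> f] norm_divide norm_of_nat .
    qed
    show "(\<lambda>n. (2 * nr \<mu>) / real (Suc n)) \<longlonglongrightarrow> 0"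
      using LIMSEQ_Suc[OF lim_const_over_n[of "2 * nr \<mu>"]] .
  qed
  then have "((\<lambda>n. cr (T (avg n \<mu>)) f - cr (avg n \<mu>) f) \<longlongrightarrow> 0) G"
    using G(1) by (rule tendsto_mono[rotated])
  moreover have "((\<lambda>n. cr (T (avg n \<mu>)) f - cr (avg n \<mu>) f) \<longlongrightarrow> cr (T (proj \<mu>)) f - cr (proj \<mu>) f) G"
    using is_limit_proj[OF \<mu>] f by (intro tendsto_diff tendsto_cr_T[OF \<mu>]) (auto simp: is_limit_def)
  ultimately have "cr (T (proj \<mu>)) f - cr (proj \<mu>) f = 0" using tendsto_unique[OF G(2)] by blast
  then show "cr (T (proj \<mu>)) f = cr (proj \<mu>) f" by simp
qed

lemma proj_fixed:
  assumes \<mu>: "\<mu> \<in> MK" and T: "T \<mu> = \<mu>"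
  shows "proj \<mu> = \<mu>"
proof (rule proj_eqI[OF \<mu>])
  have "(T ^^ k) \<mu> = \<mu>" for k by (induction k) (simp_all add: T)
  then have "cr (avg n \<mu>) f = cr \<mu> f" if "f \<in> Cc01" for f n
    unfolding cr_avg[OF \<mu> that] by (simp del: of_nat_Suc)
  then show "is_limit \<mu> \<mu>" unfolding is_limit_def using \<mu> by simp
qed

end

theorem theorem4p14:
  fixes conv :: "'a::t2_space \<Rightarrow> 'a \<Rightarrow> 'a measure"
    and iv :: "'a \<Rightarrow> 'a" and e :: 'a
    and \<sigma> :: "'a set \<Rightarrow> complex"
  assumes "hypergroup conv iv e"
    and "\<exists>\<omega>. left_haar conv \<omega>"
    and "\<sigma> \<in> MK" and "mnorm \<sigma> = 1"
  shows "\<exists>P :: ('a set \<Rightarrow> complex) \<Rightarrow> ('a set \<Rightarrow> complex).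
           (\<forall>\<mu>\<in>MK. P \<mu> \<in> MK) \<and>
           (\<forall>\<mu>\<in>MK. \<forall>\<nu>\<in>MK. \<forall>a b::complex.
               P (\<lambda>A. a * \<mu> A + b * \<nu> A) = (\<lambda>A. a * P \<mu> A + b * P \<nu> A)) \<and>
           (\<forall>\<mu>\<in>MK. P (P \<mu>) = P \<mu>) \<and>
           (\<forall>\<mu>\<in>MK. mnorm (P \<mu>) \<le> mnorm \<mu>) \<and>
           P ` MK = harmonic conv \<sigma>"
proof -
  obtain G :: "nat filter" where G: "G \<le> sequentially" "G \<noteq> bot"
      "\<And>P. eventually P G \<or> eventually (\<lambda>x. \<not> P x) G"
    using ultrafilter_below[of "sequentially :: nat filter"] by (metis sequentially_bot)
  interpret hypergroup_contraction conv iv e \<sigma> G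
    using assms G by unfold_locales auto
  have "proj ` MK = harmonic conv \<sigma>"
  proof (intro equalityI subsetI)
    fix \<mu> assume "\<mu> \<in> proj ` MK"
    then show "\<mu> \<in> harmonic conv \<sigma>" using proj_MK T_proj by (auto simp: harmonic_def)
  next
    fix \<mu> assume "\<mu> \<in> harmonic conv \<sigma>"
    then have "\<mu> \<in> MK" "proj \<mu> = \<mu>" using proj_fixed by (auto simp: harmonic_def)
    then show "\<mu> \<in> proj ` MK" by force
  qed
  \<comment> \<open>Idempotence needs no iterated limit: \<open>proj \<mu>\<close> is a fixed point
    of \<open>T\<close>, and \<open>proj\<close> leaves fixed points unchanged.\<close>
  then show ?thesis
    using proj_MK proj_linear mnorm_proj_le proj_fixed[OF proj_MK T_proj]
    by (intro exI[of _ proj]) simp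
qed

end
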